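(* Let $\theta\in\mathbb{R}$ and let $\lambda=(\lambda_{ij})_{1\le i,j\le 3}$ be a real antisymmetric matrix with $\theta=\lambda_{12}=-\lambda_{13}=\lambda_{23}$. Let $\rho:SU(4)_\lambda\to SU(3)_\theta\otimes SU(4)_\lambda$ be the left action of $SU(3)_\theta$ on $SU(4)_\lambda$ given on the coordinate generators by $\rho(v_{kl})=\sum_{\alpha=1}^{3}u_{k\alpha}\otimes v_{\alpha l}$ for $k=1,2,3$, $l=1,2,3,4$, and $\rho(v_{4l})=1\otimes v_{4l}$ for $l=1,2,3,4$. Then the fixed-point subalgebra $B=(SU(4)_\lambda)^{SU(3)_\theta}$, generated as a $*$-algebra by $x_l:=v_{4l}$ ($l=1,2,3,4$), is isomorphic to the noncommutative 7-sphere $S^7_{\theta'}$ with $$\theta'=\begin{pmatrix}0&-\theta&\theta&0\\ \theta&0&-\theta&0\\ -\theta&\theta&0&0\\ 0&0&0&0\end{pmatrix}.$$ The generators satisfy $$x_1x_2=e^{-2\pi i\theta}x_2x_1,\quad x_1x_3=e^{2\pi i\theta}x_3x_1,\quad x_2x_3=e^{-2\pi i\theta}x_3x_2,\quad x_jx_4=x_4x_j\ (j=1,2,3),$$ $$x_1x_1^*+x_2x_2^*+x_3x_3^*+x_4x_4^*=1.$$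
   Context: Deformed algebras. For $n\ge 3$, let $\mathcal{O}(SU(n))$ be the commutative $*$-algebra of functions on $SU(n)$ generated by the matrix coordinate functions, with involution complex conjugation. Let $\mathbb{T}^{n-1}\subset SU(n)$ be the diagonal maximal torus, whose elements are written $t=\mathrm{diag}(e^{2\pi i\varphi_1},\dots,e^{2\pi i\varphi_n})$ with $\varphi_n=-(\varphi_1+\dots+\varphi_{n-1})$. The group $\mathbb{T}^{n-1}\times\mathbb{T}^{n-1}$ acts by $\alpha_{(t,s)}(f)(U)=f(tUs)$, which decomposes $\mathcal{O}(SU(n))$ into isotypic components indexed by $(r,q)\in\mathbb{Z}^{n-1}\times\mathbb{Z}^{n-1}$. The $(i,j)$ coordinate function lies in the component of index $(w_i,w_j)$, where $w_1,\dots,w_{n-1}$ is the standard basis of $\mathbb{Z}^{n-1}$ and $w_n=-(w_1+\dots+w_{n-1})$. Given a real antisymmetric $(n-1)\times(n-1)$ matrix $K$, the deformed algebra is the same vector space $\mathcal{O}(SU(n))$ with the same involution and with the associative product determined by $$f\times g=e^{\pi i\,(r^{T}Kr'-q^{T}Kq')}\,fg$$ for $f$ of index $(r,q)$ and $g$ of index $(r',q')$ (i.e. the deformation by $K\oplus(-K)$). $SU(3)_\theta$ denotes the deformed algebra for $n=3$ with $K=\begin{pmatrix}0&\theta\\-\theta&0\end{pmatrix}$; its coordinate generators are denoted $u_{ij}$. $SU(4)_\lambda$ denotes the deformed algebra for $n=4$ with $K=\lambda=(\lambda_{ij})_{1\le i,j\le3}$; its coordinate generators are denoted $v_{kl}$.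 Both are compact quantum groups (Hopf $*$-algebras) with the undeformed coalgebra structure; for $SU(3)_\theta$ it is $\Delta(u_{ij})=\sum_{k}u_{ik}\otimes u_{kj}$, $\epsilon(u_{ij})=\delta_{ij}$, $S(u_{ij})=u_{ji}^*$. Everything is at the algebraic level (no $C^*$-completion), and $\otimes$ is the tensor product of algebras. Action. For a compact quantum group $H$ and an algebra $A$, a (left) action of $H$ on $A$ is an algebra homomorphism $\rho:A\to H\otimes A$ with $(\Delta\otimes\mathrm{id})\circ\rho=(\mathrm{id}\otimes\rho)\circ\rho$ and $(\epsilon\otimes\mathrm{id})\circ\rho=\mathrm{id}$. The fixed-point subalgebra is $A^H=\{a\in A:\rho(a)=1\otimes a\}$. It is known that, for the parameters in the claim, the given formulas on generators do define such an action. Noncommutative sphere. For a real antisymmetric $4\times4$ matrix $\theta'=(\theta'_{jk})$, $S^7_{\theta'}$ denotes the $*$-algebra generated by normal elements $z_1,z_2,z_3,z_4$ subject to $z_jz_k=e^{2\pi i\theta'_{jk}}z_kz_j$, $z_jz_k^*=e^{-2\pi i\theta'_{jk}}z_k^*z_j$ and $\sum_{k=1}^4z_kz_k^*=1$. Isomorphism means isomorphism of $*$-algebras. *)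

theory Defs
  imports "Jordan_Normal_Form.Schur_Decomposition" "HOL-Algebra.QuotRing"
begin

text \<open>
  Algebras are unital, associative, over the complex numbers and in general noncommutative; this
  is why the locale \<open>algebra\<close>, which is restricted to commutative multiplication, is not used.

  All indices start at 0: the generators are \<open>u\<^sub>i\<^sub>j\<close> with \<open>i, j < n\<close>, the rows and columns of the
  deformation matrices are numbered \<open>0, \<dots>, n - 2\<close>, and \<open>n - 1\<close> is the last index.
\<close>

section \<open>Complex algebras and star-algebras\<close>

record 'a star_algebra = "(complex, 'a) module" +
  star :: "'a \<Rightarrow> 'a"

definition alg_hom ::
    "(complex, 'a, 'm) module_scheme \<Rightarrow> (complex, 'b, 'k) module_scheme \<Rightarrow> ('a \<Rightarrow> 'b) set" where
  "alg_hom A B = {h \<in> Ring.ring_hom A B.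
     \<forall>c. \<forall>a\<in>carrier A. h (c \<odot>\<^bsub>A\<^esub> a) = c \<odot>\<^bsub>B\<^esub> h a}"

definition star_alg_iso ::
    "('a, 'm) star_algebra_scheme \<Rightarrow> ('b, 'k) star_algebra_scheme \<Rightarrow> ('a \<Rightarrow> 'b) set" where
  "star_alg_iso A B = {h \<in> alg_hom A B \<inter> ring_iso A B.
     \<forall>a\<in>carrier A. h (star A a) = star B (h a)}"

definition star_alg_isomorphic ::
    "('a, 'm) star_algebra_scheme \<Rightarrow> ('b, 'k) star_algebra_scheme \<Rightarrow> bool" where
  "star_alg_isomorphic A B \<longleftrightarrow> star_alg_iso A B \<noteq> {}"

text \<open>Closure under additive inverses follows from closure under scalar multiplication.\<close>

definition star_subalgebra :: "'a set \<Rightarrow> ('a, 'm) star_algebra_scheme \<Rightarrow> bool" where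
  "star_subalgebra S A \<longleftrightarrow>
     S \<subseteq> carrier A \<and> \<one>\<^bsub>A\<^esub> \<in> S \<and>
     (\<forall>a\<in>S. \<forall>b\<in>S. a \<oplus>\<^bsub>A\<^esub> b \<in> S \<and> a \<otimes>\<^bsub>A\<^esub> b \<in> S) \<and>
     (\<forall>c. \<forall>a\<in>S. c \<odot>\<^bsub>A\<^esub> a \<in> S) \<and> (\<forall>a\<in>S. star A a \<in> S)"

definition star_generated :: "('a, 'm) star_algebra_scheme \<Rightarrow> 'a set \<Rightarrow> 'a set" where
  "star_generated A X = \<Inter>{S. star_subalgebra S A \<and> X \<subseteq> S}"

definition quot_algebra ::
    "(complex, 'a, 'm) module_scheme \<Rightarrow> 'a set \<Rightarrow> (complex, 'a set) module" where
  "quot_algebra A I = ring.extend (A Quot I)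
     (module.fields (\<lambda>c X. \<Union>x\<in>X. I +>\<^bsub>A\<^esub> (c \<odot>\<^bsub>A\<^esub> x)))"

definition quot_star_algebra ::
    "('a, 'm) star_algebra_scheme \<Rightarrow> 'a set \<Rightarrow> 'a set star_algebra" where
  "quot_star_algebra A I = module.extend (quot_algebra A I)
     (star_algebra.fields (\<lambda>X. \<Union>x\<in>X. I +>\<^bsub>A\<^esub> star A x))"


section \<open>Monoid algebras and tensor products\<close>

definition monoid_algebra :: "('a, 'm) monoid_scheme \<Rightarrow> (complex, 'a \<Rightarrow> complex) module" where
  "monoid_algebra M =
     \<lparr>carrier = {p. finite {x. p x \<noteq> 0} \<and> {x. p x \<noteq> 0} \<subseteq> carrier M},
      monoid.mult = (\<lambda>p q x. \<Sum>y | p y \<noteq> 0. \<Sum>z | q z \<noteq> 0. if y \<otimes>\<^bsub>M\<^esub> z = x then p y * q z else 0),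
      one = (\<lambda>x. if x = \<one>\<^bsub>M\<^esub> then 1 else 0),
      zero = (\<lambda>_. 0),
      add = (\<lambda>p q x. p x + q x),
      module.smult = (\<lambda>c p x. c * p x)\<rparr>"

definition basis_elt :: "'a \<Rightarrow> 'a \<Rightarrow> complex" where
  "basis_elt a = (\<lambda>x. if x = a then 1 else 0)"

text \<open>
  The algebraic tensor product is the free vector space on \<open>A \<times> B\<close> modulo the bilinearity
  relations.  With its product \<open>(a, b) (a', b') = (a a', b b')\<close> the free vector space is the monoid
  algebra of the multiplicative monoid \<open>A \<times> B\<close>, and the linear span of the bilinearity relations is
  a two-sided ideal in it, so that it equals the ideal they generate.
\<close>

definition tensor_relations ::
    "(complex, 'a, 'm) module_scheme \<Rightarrow> (complex, 'b, 'k) module_scheme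
      \<Rightarrow> ('a \<times> 'b \<Rightarrow> complex) set" where
  "tensor_relations A B = (let F = monoid_algebra (A \<times>\<times> B); e = (\<lambda>a b. basis_elt (a, b)) in
     {e (a \<oplus>\<^bsub>A\<^esub> a') b \<ominus>\<^bsub>F\<^esub> (e a b \<oplus>\<^bsub>F\<^esub> e a' b) | a a' b.
        a \<in> carrier A \<and> a' \<in> carrier A \<and> b \<in> carrier B} \<union>
     {e a (b \<oplus>\<^bsub>B\<^esub> b') \<ominus>\<^bsub>F\<^esub> (e a b \<oplus>\<^bsub>F\<^esub> e a b') | a b b'.
        a \<in> carrier A \<and> b \<in> carrier B \<and> b' \<in> carrier B} \<union>
     {e (c \<odot>\<^bsub>A\<^esub> a) b \<ominus>\<^bsub>F\<^esub> (c \<odot>\<^bsub>F\<^esub> e a b) | c a b. a \<in> carrier A \<and> b \<in> carrier B} \<union>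
     {e a (c \<odot>\<^bsub>B\<^esub> b) \<ominus>\<^bsub>F\<^esub> (c \<odot>\<^bsub>F\<^esub> e a b) | c a b. a \<in> carrier A \<and> b \<in> carrier B})"

definition tensor_ideal ::
    "(complex, 'a, 'm) module_scheme \<Rightarrow> (complex, 'b, 'k) module_scheme
      \<Rightarrow> ('a \<times> 'b \<Rightarrow> complex) set" where
  "tensor_ideal A B = Idl\<^bsub>monoid_algebra (A \<times>\<times> B)\<^esub> (tensor_relations A B)"

definition tensor ::
    "(complex, 'a, 'm) module_scheme \<Rightarrow> (complex, 'b, 'k) module_scheme
      \<Rightarrow> (complex, ('a \<times> 'b \<Rightarrow> complex) set) module" where
  "tensor A B = quot_algebra (monoid_algebra (A \<times>\<times> B)) (tensor_ideal A B)"

definition pure_tensor ::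
    "(complex, 'a, 'm) module_scheme \<Rightarrow> (complex, 'b, 'k) module_scheme
      \<Rightarrow> 'a \<Rightarrow> 'b \<Rightarrow> ('a \<times> 'b \<Rightarrow> complex) set" where
  "pure_tensor A B a b = tensor_ideal A B +>\<^bsub>monoid_algebra (A \<times>\<times> B)\<^esub> basis_elt (a, b)"

text \<open>
  The linear map on \<open>A \<otimes> B\<close> with values in \<open>C\<close> induced by a bilinear map \<open>\<beta>\<close>.
\<close>

definition tensor_lift ::
    "(complex, 'a, 'm) module_scheme \<Rightarrow> (complex, 'b, 'k) module_scheme
      \<Rightarrow> (complex, 'c, 'l) module_scheme \<Rightarrow> ('a \<Rightarrow> 'b \<Rightarrow> 'c)
      \<Rightarrow> ('a \<times> 'b \<Rightarrow> complex) set \<Rightarrow> 'c" where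
  "tensor_lift A B C \<beta> T = (THE y. \<exists>(m::nat) a b.
     (\<forall>i<m. a i \<in> carrier A \<and> b i \<in> carrier B) \<and>
     T = (\<Oplus>\<^bsub>tensor A B\<^esub>i\<in>{..<m}. pure_tensor A B (a i) (b i)) \<and>
     y = (\<Oplus>\<^bsub>C\<^esub>i\<in>{..<m}. \<beta> (a i) (b i)))"


section \<open>Actions of quantum groups\<close>

text \<open>
  In the coassociativity condition, \<open>H \<otimes> (H \<otimes> A)\<close> is identified with \<open>(H \<otimes> H) \<otimes> A\<close> in the
  usual way.
\<close>

definition is_action ::
    "(complex, 'h, 'm) module_scheme \<Rightarrow> ('h \<Rightarrow> ('h \<times> 'h \<Rightarrow> complex) set) \<Rightarrow> ('h \<Rightarrow> complex)
      \<Rightarrow> (complex, 'a, 'k) module_scheme \<Rightarrow> ('a \<Rightarrow> ('h \<times> 'a \<Rightarrow> complex) set) \<Rightarrow> bool" where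
  "is_action H \<Delta> \<epsilon> A \<rho> \<longleftrightarrow>
     \<rho> \<in> alg_hom A (tensor H A) \<and>
     (let HH = tensor H H; HHA = tensor HH A in
       \<forall>a\<in>carrier A.
         tensor_lift H A HHA (\<lambda>h b. pure_tensor HH A (\<Delta> h) b) (\<rho> a) =
         tensor_lift H A HHA
           (\<lambda>h b. tensor_lift H A HHA (\<lambda>h' b'. pure_tensor HH A (pure_tensor H H h h') b') (\<rho> b))
           (\<rho> a)) \<and>
     (\<forall>a\<in>carrier A. tensor_lift H A A (\<lambda>h b. \<epsilon> h \<odot>\<^bsub>A\<^esub> b) (\<rho> a) = a)"

definition fixed_points ::
    "(complex, 'h, 'm) module_scheme \<Rightarrow> (complex, 'a, 'k) module_scheme
      \<Rightarrow> ('a \<Rightarrow> ('h \<times> 'a \<Rightarrow> complex) set) \<Rightarrow> 'a set" where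
  "fixed_points H A \<rho> = {a \<in> carrier A. \<rho> a = pure_tensor H A \<one>\<^bsub>H\<^esub> a}"


section \<open>The coordinate algebra of \<open>SU(n)\<close> and its deformations\<close>

definition SU :: "nat \<Rightarrow> complex mat set" where
  "SU n = {U \<in> carrier_mat n n. U * mat_adjoint U = 1\<^sub>m n \<and> det U = 1}"

definition fun_algebra :: "'x set \<Rightarrow> ('x \<Rightarrow> complex) star_algebra" where
  "fun_algebra X =
     \<lparr>carrier = extensional X,
      monoid.mult = (\<lambda>f g. \<lambda>x\<in>X. f x * g x),
      one = (\<lambda>x\<in>X. 1),
      zero = (\<lambda>x\<in>X. 0),
      add = (\<lambda>f g. \<lambda>x\<in>X. f x + g x),
      module.smult = (\<lambda>c f. \<lambda>x\<in>X. c * f x),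
      star = (\<lambda>f. \<lambda>x\<in>X. cnj (f x))\<rparr>"

definition coord :: "nat \<Rightarrow> nat \<Rightarrow> nat \<Rightarrow> complex mat \<Rightarrow> complex" where
  "coord n i j = (\<lambda>U\<in>SU n. U $$ (i, j))"

definition coord_algebra :: "nat \<Rightarrow> (complex mat \<Rightarrow> complex) star_algebra" where
  "coord_algebra n = (fun_algebra (SU n))
     \<lparr>carrier := star_generated (fun_algebra (SU n)) {coord n i j | i j. i < n \<and> j < n}\<rparr>"

definition torus_elt :: "nat \<Rightarrow> real vec \<Rightarrow> complex mat" where
  "torus_elt n \<phi> = mat n n (\<lambda>(i, j).
     if i \<noteq> j then 0
     else if i < n - 1 then cis (2 * pi * \<phi> $ i)
     else cis (- 2 * pi * (\<Sum>k<n - 1. \<phi> $ k)))"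

definition torus_char :: "int vec \<Rightarrow> real vec \<Rightarrow> complex" where
  "torus_char r \<phi> = cis (2 * pi * (map_vec real_of_int r \<bullet> \<phi>))"

definition weights :: "nat \<Rightarrow> (int vec \<times> int vec) set" where
  "weights n = carrier_vec (n - 1) \<times> carrier_vec (n - 1)"

definition isotypic :: "nat \<Rightarrow> int vec \<times> int vec \<Rightarrow> (complex mat \<Rightarrow> complex) set" where
  "isotypic n = (\<lambda>(r, q). {f \<in> carrier (coord_algebra n).
     \<forall>\<phi>\<in>carrier_vec (n - 1). \<forall>\<psi>\<in>carrier_vec (n - 1). \<forall>U\<in>SU n.
       f (torus_elt n \<phi> * U * torus_elt n \<psi>) = torus_char r \<phi> * torus_char q \<psi> * f U})"

text \<open>The family of isotypic components of \<open>f\<close>, extended by zero to indices of the wrong dimension.\<close>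

definition isotypic_components ::
    "nat \<Rightarrow> (complex mat \<Rightarrow> complex) \<Rightarrow> int vec \<times> int vec \<Rightarrow> complex mat \<Rightarrow> complex" where
  "isotypic_components n f = (THE c.
     (\<forall>a\<in>weights n. c a \<in> isotypic n a) \<and>
     (\<forall>a. a \<notin> weights n \<longrightarrow> c a = \<zero>\<^bsub>coord_algebra n\<^esub>) \<and>
     finite {a. c a \<noteq> \<zero>\<^bsub>coord_algebra n\<^esub>} \<and>
     (\<forall>U\<in>SU n. f U = (\<Sum>a | c a \<noteq> \<zero>\<^bsub>coord_algebra n\<^esub>. c a U)))"

definition deform_phase :: "real mat \<Rightarrow> int vec \<times> int vec \<Rightarrow> int vec \<times> int vec \<Rightarrow> complex" where
  "deform_phase K = (\<lambda>(r, q) (r', q').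
     cis (pi * (map_vec real_of_int r \<bullet> (K *\<^sub>v map_vec real_of_int r')
              - map_vec real_of_int q \<bullet> (K *\<^sub>v map_vec real_of_int q'))))"

text \<open>The bilinear extension of the product of homogeneous elements.\<close>

definition deform_mult ::
    "nat \<Rightarrow> real mat \<Rightarrow> (complex mat \<Rightarrow> complex) \<Rightarrow> (complex mat \<Rightarrow> complex)
      \<Rightarrow> complex mat \<Rightarrow> complex" where
  "deform_mult n K f g = (\<lambda>U\<in>SU n.
     \<Sum>a | isotypic_components n f a \<noteq> \<zero>\<^bsub>coord_algebra n\<^esub>.
     \<Sum>b | isotypic_components n g b \<noteq> \<zero>\<^bsub>coord_algebra n\<^esub>.
       deform_phase K a b * isotypic_components n f a U * isotypic_components n g b U)"

definition deformed_SU :: "nat \<Rightarrow> real mat \<Rightarrow> (complex mat \<Rightarrow> complex) star_algebra" where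
  "deformed_SU n K = (coord_algebra n)\<lparr>monoid.mult := deform_mult n K\<rparr>"

text \<open>
  The undeformed coalgebra structure: \<open>\<Delta> f = \<Sum>\<^sub>i a\<^sub>i \<otimes> b\<^sub>i\<close> when \<open>f (U V) = \<Sum>\<^sub>i a\<^sub>i(U) b\<^sub>i(V)\<close>, so that
  \<open>\<Delta> u\<^sub>i\<^sub>j = \<Sum>\<^sub>k u\<^sub>i\<^sub>k \<otimes> u\<^sub>k\<^sub>j\<close>, and \<open>\<epsilon>\<close> is evaluation at the identity matrix.
\<close>

definition SU_comult ::
    "nat \<Rightarrow> real mat \<Rightarrow> (complex mat \<Rightarrow> complex)
      \<Rightarrow> ((complex mat \<Rightarrow> complex) \<times> (complex mat \<Rightarrow> complex) \<Rightarrow> complex) set" where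
  "SU_comult n K f = (let H = deformed_SU n K in
     THE T. \<exists>(m::nat) a b.
       (\<forall>i<m. a i \<in> carrier H \<and> b i \<in> carrier H) \<and>
       (\<forall>U\<in>SU n. \<forall>V\<in>SU n. f (U * V) = (\<Sum>i<m. a i U * b i V)) \<and>
       T = (\<Oplus>\<^bsub>tensor H H\<^esub>i\<in>{..<m}. pure_tensor H H (a i) (b i)))"

definition SU_counit :: "nat \<Rightarrow> (complex mat \<Rightarrow> complex) \<Rightarrow> complex" where
  "SU_counit n f = f (1\<^sub>m n)"

definition SU3 :: "real \<Rightarrow> (complex mat \<Rightarrow> complex) star_algebra" where
  "SU3 \<theta> = deformed_SU 3 (mat_of_rows_list 2 [[0, \<theta>], [- \<theta>, 0]])"

definition SU3_comult ::
    "real \<Rightarrow> (complex mat \<Rightarrow> complex)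
      \<Rightarrow> ((complex mat \<Rightarrow> complex) \<times> (complex mat \<Rightarrow> complex) \<Rightarrow> complex) set" where
  "SU3_comult \<theta> = SU_comult 3 (mat_of_rows_list 2 [[0, \<theta>], [- \<theta>, 0]])"

definition SU4 :: "real mat \<Rightarrow> (complex mat \<Rightarrow> complex) star_algebra" where
  "SU4 \<Lambda> = deformed_SU 4 \<Lambda>"


section \<open>Noncommutative spheres\<close>

datatype 'x letter = Gen 'x | GenStar 'x

primrec letter_star :: "'x letter \<Rightarrow> 'x letter" where
  "letter_star (Gen x) = GenStar x"
| "letter_star (GenStar x) = Gen x"

definition free_monoid :: "'x set \<Rightarrow> 'x list monoid" where
  "free_monoid X = \<lparr>carrier = lists X, monoid.mult = (@), one = []\<rparr>"

definition free_star_algebra :: "'x set \<Rightarrow> ('x letter list \<Rightarrow> complex) star_algebra" where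
  "free_star_algebra X = module.extend (monoid_algebra (free_monoid (Gen ` X \<union> GenStar ` X)))
     (star_algebra.fields (\<lambda>p w. cnj (p (rev (map letter_star w)))))"

text \<open>
  The \<open>(2 m - 1)\<close>-dimensional sphere \<open>S\<^sub>\<Theta>\<close>, for a real antisymmetric \<open>m \<times> m\<close> matrix \<open>\<Theta>\<close>.  The
  relations are completed by their adjoints, so that the ideal they generate is closed under the
  involution.
\<close>

definition sphere_relations :: "nat \<Rightarrow> real mat \<Rightarrow> (nat letter list \<Rightarrow> complex) set" where
  "sphere_relations m \<Theta> =
    (let F = free_star_algebra {..<m}; z = (\<lambda>j. basis_elt [Gen j]);
         zs = (\<lambda>j. star F (basis_elt [Gen j])) in
     {z j \<otimes>\<^bsub>F\<^esub> zs j \<ominus>\<^bsub>F\<^esub> zs j \<otimes>\<^bsub>F\<^esub> z j | j. j < m} \<union>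
     {z j \<otimes>\<^bsub>F\<^esub> z k \<ominus>\<^bsub>F\<^esub> cis (2 * pi * \<Theta> $$ (j, k)) \<odot>\<^bsub>F\<^esub> (z k \<otimes>\<^bsub>F\<^esub> z j)
        | j k. j < m \<and> k < m} \<union>
     {z j \<otimes>\<^bsub>F\<^esub> zs k \<ominus>\<^bsub>F\<^esub> cis (- 2 * pi * \<Theta> $$ (j, k)) \<odot>\<^bsub>F\<^esub> (zs k \<otimes>\<^bsub>F\<^esub> z j)
        | j k. j < m \<and> k < m} \<union>
     {(\<Oplus>\<^bsub>F\<^esub>k\<in>{..<m}. z k \<otimes>\<^bsub>F\<^esub> zs k) \<ominus>\<^bsub>F\<^esub> \<one>\<^bsub>F\<^esub>})"

definition nc_sphere :: "nat \<Rightarrow> real mat \<Rightarrow> (nat letter list \<Rightarrow> complex) set star_algebra" where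
  "nc_sphere m \<Theta> = (let F = free_star_algebra {..<m}; R = sphere_relations m \<Theta> in
     quot_star_algebra F (Idl\<^bsub>F\<^esub> (R \<union> star F ` R)))"

end

theory Submission
  imports Defs
begin

text \<open>
  Multiplying from the left by a homogeneous element of index \<open>a\<close> is the undeformed multiplication
  after translating the right factor by the torus element that \<open>a\<close> determines through the deformation
  matrix.  Elements of \<open>SU(3)\<^sub>\<theta> \<otimes> SU(4)\<^sub>\<lambda>\<close> are faithfully represented as functions on
  \<open>SU(3) \<times> SU(4)\<close>, and \<open>SU(4)\<^sub>\<lambda>\<close> is generated as an algebra by the \<open>v\<^sub>k\<^sub>l\<close> alone, since their
  adjoints are cofactors.  As the torus translations of the two factors cancel under the
  conditions on \<open>\<lambda>\<close>, the action is \<open>\<rho>(f)(h, U) = f(\<iota>(h) U)\<close> with \<open>\<iota>\<close> the block embedding, exactly as in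
  the undeformed case.  So the fixed points are the invariant functions.

  An invariant \<open>f\<close> is determined by its values on a section \<open>S\<^sup>7 \<rightarrow> SU(4)\<close>.  The complex reflections
  moving \<open>c e\<^sub>3\<close> to a given row give a section whose entries are polynomial up to powers of
  \<open>\<bar>c - x\<^sub>3\<bar>\<^sup>2\<close>; these denominators for \<open>c = 1, -1, \<i>\<close> generate the unit ideal, hence \<open>f\<close> is a polynomial
  in the last row.

  Finally, up to a phase every word in the generators of the sphere is determined by its multiset
  of letters, in the sphere as well as in \<open>SU(4)\<^sub>\<lambda>\<close>.  An element of the kernel therefore amounts to a
  commutative polynomial in \<open>x\<close> and \<open>x\<^sup>*\<close> vanishing on \<open>S\<^sup>7\<close>.  After homogenizing with \<open>\<Sum> x\<^sub>k x\<^sub>k\<^sup>* = 1\<close>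
  it vanishes on \<open>\<complex>\<^sup>4\<close>, and is zero because distinct monomials are distinct characters of the
  multiplicative monoid \<open>\<complex>\<^sup>4\<close>.
\<close>

section \<open>Linear independence of characters\<close>

text \<open>Generation by the \<open>v\<close> alone matters because an action is only an algebra
  homomorphism: its values on adjoints are not prescribed. The conditions on
  \<open>\<Lambda>\<close> say that its row sums vanish. Hence the weight of the fourth index pairs
  to zero with every weight and left twists do not touch the last row, while on the first three
  indices both matrices induce the same cyclic form \<open>\<sigma>\<close>. In a product of
  last-row coordinates only the column weights survive, with the sign of -K; comparing both orders
  doubles the phase, which gives the matrix - \<open>\<sigma>\<close> of the sphere. The obstacle
  for invariants is that SU(4) has no continuous section over S^7, so a section can be polynomial
  only after localization. Denominators without common zero on the sphere do not suffice to remove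
  the localization, since they must generate the unit ideal among polynomials: with z and its
  conjugate as independent variables, the ones for 1 and -1 still vanish together at (1, -1) and
  (-1, 1). The third centre excludes these points.\<close>

lemma characters_independent:
  fixes \<chi> :: "'i \<Rightarrow> 'm \<Rightarrow> complex"
  assumes "finite S"
    and mult: "\<And>a x y. a \<in> S \<Longrightarrow> x \<in> M \<Longrightarrow> y \<in> M \<Longrightarrow> \<chi> a (op x y) = \<chi> a x * \<chi> a y"
    and closed: "\<And>x y. x \<in> M \<Longrightarrow> y \<in> M \<Longrightarrow> op x y \<in> M"
    and nz: "\<And>a. a \<in> S \<Longrightarrow> \<exists>x\<in>M. \<chi> a x \<noteq> 0"
    and distinct: "\<And>a b. a \<in> S \<Longrightarrow> b \<in> S \<Longrightarrow> a \<noteq> b \<Longrightarrow> \<exists>x\<in>M. \<chi> a x \<noteq> \<chi> b x"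
    and "\<And>x. x \<in> M \<Longrightarrow> (\<Sum>a\<in>S. c a * \<chi> a x) = 0"
    and "b \<in> S"
  shows "c b = 0"
  using assms(1,6,7) mult nz distinct
proof (induction S arbitrary: c b rule: finite_induct)
  case empty
  then show ?case by simp
next
  case (insert d S)
  have eq: "c d * \<chi> d x + (\<Sum>a\<in>S. c a * \<chi> a x) = 0" if "x \<in> M" for x
    using insert.prems(1)[OF that] insert.hyps by simp
  \<comment> \<open>Dedekind's shortening: the relation at \<open>op y x\<close> minus
    \<open>\<chi> d y\<close> times the relation at \<open>x\<close> loses the term of
    \<open>d\<close> and has coefficients \<open>c e * (\<chi> e y - \<chi> d y)\<close>, with a
    nonzero second factor at \<open>e = a\<close>.\<close>
  have S0: "c a = 0" if a: "a \<in> S" for a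
  proof -
    have "a \<noteq> d" using a insert.hyps by auto
    then obtain y where y: "y \<in> M" "\<chi> a y \<noteq> \<chi> d y"
      using insert.prems(5)[of a d] a by blast
    have "(\<Sum>e\<in>S. (c e * (\<chi> e y - \<chi> d y)) * \<chi> e x) = 0" if x: "x \<in> M" for x
    proof -
      have "c d * \<chi> d (op y x) + (\<Sum>e\<in>S. c e * \<chi> e (op y x)) = 0"
        by (rule eq[OF closed[OF y(1) x]])
      moreover have "(\<Sum>e\<in>S. c e * \<chi> e (op y x)) = (\<Sum>e\<in>S. c e * \<chi> e y * \<chi> e x)"
        by (rule sum.cong) (auto simp: insert.prems(3) y x)
      ultimately have "c d * \<chi> d y * \<chi> d x + (\<Sum>e\<in>S. c e * \<chi> e y * \<chi> e x) = 0"
        by (simp add: insert.prems(3) y x mult.assoc)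
      moreover have "c d * \<chi> d y * \<chi> d x + \<chi> d y * (\<Sum>e\<in>S. c e * \<chi> e x)
          = \<chi> d y * (c d * \<chi> d x + (\<Sum>e\<in>S. c e * \<chi> e x))"
        by (simp add: algebra_simps)
      ultimately have "(\<Sum>e\<in>S. c e * \<chi> e y * \<chi> e x) - \<chi> d y * (\<Sum>e\<in>S. c e * \<chi> e x) = 0"
        using eq[OF x] by (metis add_left_imp_eq mult_zero_right right_minus_eq)
      then show ?thesis
        by (simp add: sum_distrib_left sum_subtractf[symmetric] algebra_simps)
    qed
    from insert.IH[OF this a]
    have "c a * (\<chi> a y - \<chi> d y) = 0" using insert.prems(3,4,5) by blast
    then show ?thesis using y by simp
  qed
  obtain x where "x \<in> M" "\<chi> d x \<noteq> 0" using insert.prems(4) by blast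
  then have "c d = 0" using eq[of x] S0 by simp
  then show ?case using S0 insert.prems by auto
qed

section \<open>Monoid algebras\<close>

text \<open>The linear functional on a free vector space with value \<open>\<beta> y\<close> on the
  basis element \<open>y\<close>. Convolution, functionals on tensors and the homomorphism
  \<open>\<Phi>\<close> are all expressed through it, so that their laws reduce to
  linearity.\<close>

definition lin_ext :: "('a \<Rightarrow> complex) \<Rightarrow> ('a \<Rightarrow> complex) \<Rightarrow> complex" where
  "lin_ext \<beta> p = (\<Sum>y | p y \<noteq> 0. p y * \<beta> y)"

lemma lin_ext_superset:
  assumes "finite S" "{y. p y \<noteq> 0} \<subseteq> S"
  shows "lin_ext \<beta> p = (\<Sum>y\<in>S. p y * \<beta> y)"
  unfolding lin_ext_def by (rule sum.mono_neutral_left) (use assms in auto)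

lemma lin_ext_add:
  assumes "finite {y. p y \<noteq> 0}" "finite {y. q y \<noteq> 0}"
  shows "lin_ext \<beta> (\<lambda>y. p y + q y) = lin_ext \<beta> p + lin_ext \<beta> q"
proof -
  let ?S = "{y. p y \<noteq> 0} \<union> {y. q y \<noteq> 0}"
  have "lin_ext \<beta> (\<lambda>y. p y + q y) = (\<Sum>y\<in>?S. (p y + q y) * \<beta> y)"
    by (rule lin_ext_superset) (use assms in auto)
  moreover have "lin_ext \<beta> p = (\<Sum>y\<in>?S. p y * \<beta> y)"
    by (rule lin_ext_superset) (use assms in auto)
  moreover have "lin_ext \<beta> q = (\<Sum>y\<in>?S. q y * \<beta> y)"
    by (rule lin_ext_superset) (use assms in auto)
  ultimately show ?thesis by (simp add: sum.distrib algebra_simps)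
qed

lemma lin_ext_smult: "lin_ext \<beta> (\<lambda>y. c * p y) = c * lin_ext \<beta> p"
  by (cases "c = 0") (auto simp: lin_ext_def sum_distrib_left mult.assoc)

lemma lin_ext_diff:
  assumes "finite {y. p y \<noteq> 0}" "finite {y. q y \<noteq> 0}"
  shows "lin_ext \<beta> (\<lambda>y. p y - q y) = lin_ext \<beta> p - lin_ext \<beta> q"
  using lin_ext_add[of p "\<lambda>y. - 1 * q y" \<beta>] lin_ext_smult[of \<beta> "- 1" q] assms by simp

lemma lin_ext_basis_elt [simp]: "lin_ext \<beta> (basis_elt a) = \<beta> a"
  by (simp add: lin_ext_superset[of "{a}"] basis_elt_def)

lemma lin_ext_zero [simp]: "lin_ext \<beta> (\<lambda>_. 0) = 0"
  by (simp add: lin_ext_def)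

lemma lin_ext_sum:
  assumes "finite I" "\<And>i. i \<in> I \<Longrightarrow> finite {y. p i y \<noteq> 0}"
  shows "lin_ext \<beta> (\<lambda>y. \<Sum>i\<in>I. p i y) = (\<Sum>i\<in>I. lin_ext \<beta> (p i))
    \<and> finite {y. (\<Sum>i\<in>I. p i y) \<noteq> 0}"
  using assms
proof (induction I rule: finite_induct)
  case (insert i I)
  have "{y. (\<Sum>i\<in>insert i I. p i y) \<noteq> 0} \<subseteq> {y. p i y \<noteq> 0} \<union> {y. (\<Sum>i\<in>I. p i y) \<noteq> 0}"
    using insert by auto
  then have "finite {y. (\<Sum>i\<in>insert i I. p i y) \<noteq> 0}"
    using insert by (meson finite_UnI finite_subset insertI1 insertI2)
  then show ?case using insert by (simp add: lin_ext_add)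
qed simp

lemma lin_ext_cong:
  "(\<And>y. p y \<noteq> 0 \<Longrightarrow> \<beta> y = \<gamma> y) \<Longrightarrow> lin_ext \<beta> p = lin_ext \<gamma> p"
  by (simp add: lin_ext_def)

lemma lin_ext_beta_smult: "lin_ext (\<lambda>y. c * \<beta> y) p = c * lin_ext \<beta> p"
  by (simp add: lin_ext_def sum_distrib_left ac_simps)

lemma lin_ext_beta_add: "lin_ext (\<lambda>y. \<beta> y + \<gamma> y) p = lin_ext \<beta> p + lin_ext \<gamma> p"
  by (simp add: lin_ext_def sum.distrib algebra_simps)

lemma monoid_algebra_simps:
  "p \<in> carrier (monoid_algebra M) \<longleftrightarrow> finite {x. p x \<noteq> 0} \<and> {x. p x \<noteq> 0} \<subseteq> carrier M"
  "\<one>\<^bsub>monoid_algebra M\<^esub> = basis_elt \<one>\<^bsub>M\<^esub>"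
  "\<zero>\<^bsub>monoid_algebra M\<^esub> = (\<lambda>_. 0)"
  "p \<oplus>\<^bsub>monoid_algebra M\<^esub> q = (\<lambda>x. p x + q x)"
  "c \<odot>\<^bsub>monoid_algebra M\<^esub> p = (\<lambda>x. c * p x)"
  by (auto simp: monoid_algebra_def basis_elt_def)

text \<open>The coefficient of a convolution at \<open>x\<close> is the bilinear extension of the
  indicator of \<open>y z = x\<close>; in this form the ring laws become identities between nested
  linear extensions.\<close>

lemma monoid_algebra_mult:
  "p \<otimes>\<^bsub>monoid_algebra M\<^esub> q =
    (\<lambda>x. lin_ext (\<lambda>y. lin_ext (\<lambda>z. if y \<otimes>\<^bsub>M\<^esub> z = x then 1 else 0) q) p)"
  by (auto simp: monoid_algebra_def lin_ext_def sum_distrib_left if_distrib mult.assoc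
      intro!: ext sum.cong cong: if_cong)

lemma lin_ext_eval: "finite {y. p y \<noteq> 0} \<Longrightarrow> lin_ext (\<lambda>z. if z = x then 1 else 0) p = p x"
  by (auto simp: lin_ext_def if_distrib sum.delta' cong: if_cong)

lemma monoid_algebra_mult_supp:
  assumes p: "finite {y. p y \<noteq> 0}" and q: "finite {y. q y \<noteq> 0}"
  shows "{x. (p \<otimes>\<^bsub>monoid_algebra M\<^esub> q) x \<noteq> 0}
    \<subseteq> (\<lambda>(y, z). y \<otimes>\<^bsub>M\<^esub> z) ` ({y. p y \<noteq> 0} \<times> {y. q y \<noteq> 0})"
proof -
  have "(p \<otimes>\<^bsub>monoid_algebra M\<^esub> q) x = 0"
    if "x \<notin> (\<lambda>(y, z). y \<otimes>\<^bsub>M\<^esub> z) ` ({y. p y \<noteq> 0} \<times> {y. q y \<noteq> 0})" for x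
    unfolding monoid_algebra_mult lin_ext_def
    by (rule sum.neutral) (use that in \<open>auto intro!: sum.neutral\<close>)
  then show ?thesis by blast
qed

text \<open>Every pair \<open>(y, z)\<close> contributes to exactly one product, so the sum over
  products may be replaced by the sum over pairs.\<close>

lemma lin_ext_mult:
  assumes p: "finite {y. p y \<noteq> 0}" and q: "finite {y. q y \<noteq> 0}"
  shows "lin_ext \<beta> (p \<otimes>\<^bsub>monoid_algebra M\<^esub> q)
    = lin_ext (\<lambda>y. lin_ext (\<lambda>z. \<beta> (y \<otimes>\<^bsub>M\<^esub> z)) q) p"
proof -
  let ?P = "{y. p y \<noteq> 0}" and ?Q = "{y. q y \<noteq> 0}"
  let ?S = "(\<lambda>(y, z). y \<otimes>\<^bsub>M\<^esub> z) ` (?P \<times> ?Q)"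
  have "lin_ext \<beta> (p \<otimes>\<^bsub>monoid_algebra M\<^esub> q) = (\<Sum>x\<in>?S. (p \<otimes>\<^bsub>monoid_algebra M\<^esub> q) x * \<beta> x)"
    by (rule lin_ext_superset[OF _ monoid_algebra_mult_supp[OF p q]]) (use p q in auto)
  also have "\<dots> = (\<Sum>x\<in>?S. \<Sum>y\<in>?P. \<Sum>z\<in>?Q. if y \<otimes>\<^bsub>M\<^esub> z = x then p y * q z * \<beta> x else 0)"
    by (auto simp: monoid_algebra_mult lin_ext_def sum_distrib_left sum_distrib_right if_distrib
      intro!: sum.cong cong: if_cong)
  also have "\<dots> = (\<Sum>y\<in>?P. \<Sum>x\<in>?S. \<Sum>z\<in>?Q. if y \<otimes>\<^bsub>M\<^esub> z = x then p y * q z * \<beta> x else 0)"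
    by (rule sum.swap)
  also have "\<dots> = (\<Sum>y\<in>?P. \<Sum>z\<in>?Q. \<Sum>x\<in>?S. if y \<otimes>\<^bsub>M\<^esub> z = x then p y * q z * \<beta> x else 0)"
    by (rule sum.cong[OF refl], rule sum.swap)
  also have "\<dots> = (\<Sum>y\<in>?P. \<Sum>z\<in>?Q. p y * q z * \<beta> (y \<otimes>\<^bsub>M\<^esub> z))"
    by (intro sum.cong refl) (use p q in \<open>auto simp: sum.delta' sum.delta\<close>)
  also have "\<dots> = lin_ext (\<lambda>y. lin_ext (\<lambda>z. \<beta> (y \<otimes>\<^bsub>M\<^esub> z)) q) p"
    by (simp add: lin_ext_def sum_distrib_left mult.assoc)
  finally show ?thesis .
qed

lemma basis_elt_carrier [simp]: "basis_elt a \<in> carrier (monoid_algebra M) \<longleftrightarrow> a \<in> carrier M"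
  by (auto simp: monoid_algebra_simps basis_elt_def)

lemma finite_supp_add: "finite {x. p x \<noteq> (0::complex)} \<Longrightarrow> finite {x. q x \<noteq> 0} \<Longrightarrow> finite {x. p x + q x \<noteq> 0}"
  by (rule finite_subset[of _ "{x. p x \<noteq> 0} \<union> {x. q x \<noteq> 0}"]) auto

lemma monoid_algebra_ring:
  assumes "Group.monoid M"
  shows "ring (monoid_algebra M)"
proof -
  interpret M: Group.monoid M by fact
  let ?R = "monoid_algebra M"
  have fin: "finite {x. p x \<noteq> 0}" if "p \<in> carrier ?R" for p
    using that by (simp add: monoid_algebra_simps)
  have car: "p x \<noteq> 0 \<Longrightarrow> x \<in> carrier M" if "p \<in> carrier ?R" for p x
    using that by (auto simp: monoid_algebra_simps)
  have addc: "p \<oplus>\<^bsub>?R\<^esub> q \<in> carrier ?R" if "p \<in> carrier ?R" "q \<in> carrier ?R" for p q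
    using that finite_supp_add[of p q] by (auto simp: monoid_algebra_simps) (metis add.right_neutral car that)
  have multc: "p \<otimes>\<^bsub>?R\<^esub> q \<in> carrier ?R" if "p \<in> carrier ?R" "q \<in> carrier ?R" for p q
  proof -
    note S = monoid_algebra_mult_supp[OF fin[OF that(1)] fin[OF that(2)], of M]
    have "finite {x. (p \<otimes>\<^bsub>?R\<^esub> q) x \<noteq> 0}"
      by (rule finite_subset[OF S]) (use fin that in auto)
    moreover have "{x. (p \<otimes>\<^bsub>?R\<^esub> q) x \<noteq> 0} \<subseteq> carrier M"
      using S car that by fastforce
    ultimately show ?thesis by (simp add: monoid_algebra_simps)
  qed
  show ?thesis
  proof (rule ringI)
    show "abelian_group ?R"
    proof (rule abelian_groupI)
      fix p assume p: "p \<in> carrier ?R"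
      show "\<exists>q\<in>carrier ?R. q \<oplus>\<^bsub>?R\<^esub> p = \<zero>\<^bsub>?R\<^esub>"
        by (rule bexI[of _ "\<lambda>x. - p x"]) (use p in \<open>auto simp: monoid_algebra_simps\<close>)
    qed (auto simp: addc, auto simp: monoid_algebra_simps ac_simps)
    show "Group.monoid ?R"
    proof (rule monoidI)
      show "\<one>\<^bsub>?R\<^esub> \<in> carrier ?R" by (simp add: monoid_algebra_simps(2))
      fix p q r assume pqr: "p \<in> carrier ?R" "q \<in> carrier ?R" "r \<in> carrier ?R"
      show "p \<otimes>\<^bsub>?R\<^esub> q \<otimes>\<^bsub>?R\<^esub> r = p \<otimes>\<^bsub>?R\<^esub> (q \<otimes>\<^bsub>?R\<^esub> r)"
      proof
        fix x
        \<comment> \<open>Both bracketings are the same triple extension, up to associativity of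
          \<open>M\<close> on the supports.\<close>
        have "(p \<otimes>\<^bsub>?R\<^esub> q \<otimes>\<^bsub>?R\<^esub> r) x
          = lin_ext (\<lambda>y. lin_ext (\<lambda>z. lin_ext (\<lambda>w. if y \<otimes>\<^bsub>M\<^esub> z \<otimes>\<^bsub>M\<^esub> w = x then 1 else 0) r) q) p"
          unfolding monoid_algebra_mult[of M "p \<otimes>\<^bsub>?R\<^esub> q"] by (rule lin_ext_mult) (use pqr fin in auto)
        also have "\<dots> = lin_ext (\<lambda>y. lin_ext (\<lambda>z. lin_ext (\<lambda>w. if y \<otimes>\<^bsub>M\<^esub> (z \<otimes>\<^bsub>M\<^esub> w) = x then 1 else 0) r) q) p"
          by (intro lin_ext_cong) (use pqr car M.m_assoc in simp)
        also have "\<dots> = (p \<otimes>\<^bsub>?R\<^esub> (q \<otimes>\<^bsub>?R\<^esub> r)) x"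
          unfolding monoid_algebra_mult[of M p]
          by (intro lin_ext_cong lin_ext_mult[symmetric]) (use pqr fin in auto)
        finally show "(p \<otimes>\<^bsub>?R\<^esub> q \<otimes>\<^bsub>?R\<^esub> r) x = (p \<otimes>\<^bsub>?R\<^esub> (q \<otimes>\<^bsub>?R\<^esub> r)) x" .
      qed
    next
      fix p assume p: "p \<in> carrier ?R"
      have "lin_ext (\<lambda>z. if \<one>\<^bsub>M\<^esub> \<otimes>\<^bsub>M\<^esub> z = x then 1 else 0) p = p x" for x
        by (subst lin_ext_eval[OF fin[OF p], symmetric], rule lin_ext_cong) (use car[OF p] in auto)
      then show "\<one>\<^bsub>?R\<^esub> \<otimes>\<^bsub>?R\<^esub> p = p"
        by (simp add: monoid_algebra_mult monoid_algebra_simps)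
      have "lin_ext (\<lambda>z. if z \<otimes>\<^bsub>M\<^esub> \<one>\<^bsub>M\<^esub> = x then 1 else 0) p = p x" for x
        by (subst lin_ext_eval[OF fin[OF p], symmetric], rule lin_ext_cong) (use car[OF p] in auto)
      then show "p \<otimes>\<^bsub>?R\<^esub> \<one>\<^bsub>?R\<^esub> = p"
        by (simp add: monoid_algebra_mult monoid_algebra_simps)
    qed (rule multc)
    fix p q r assume pqr: "p \<in> carrier ?R" "q \<in> carrier ?R" "r \<in> carrier ?R"
    show "(p \<oplus>\<^bsub>?R\<^esub> q) \<otimes>\<^bsub>?R\<^esub> r = p \<otimes>\<^bsub>?R\<^esub> r \<oplus>\<^bsub>?R\<^esub> q \<otimes>\<^bsub>?R\<^esub> r"
      unfolding monoid_algebra_mult monoid_algebra_simps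
      by (intro ext lin_ext_add) (use pqr fin in auto)
    show "r \<otimes>\<^bsub>?R\<^esub> (p \<oplus>\<^bsub>?R\<^esub> q) = r \<otimes>\<^bsub>?R\<^esub> p \<oplus>\<^bsub>?R\<^esub> r \<otimes>\<^bsub>?R\<^esub> q"
      unfolding monoid_algebra_mult monoid_algebra_simps
      by (simp add: lin_ext_add fin pqr lin_ext_beta_add)
  qed
qed

lemma monoid_algebra_smult_mult:
  "c \<odot>\<^bsub>monoid_algebra M\<^esub> p \<otimes>\<^bsub>monoid_algebra M\<^esub> q = c \<odot>\<^bsub>monoid_algebra M\<^esub> (p \<otimes>\<^bsub>monoid_algebra M\<^esub> q)"
  "p \<otimes>\<^bsub>monoid_algebra M\<^esub> (c \<odot>\<^bsub>monoid_algebra M\<^esub> q) = c \<odot>\<^bsub>monoid_algebra M\<^esub> (p \<otimes>\<^bsub>monoid_algebra M\<^esub> q)"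
  by (auto simp: monoid_algebra_mult monoid_algebra_simps lin_ext_smult lin_ext_beta_smult)

lemma basis_elt_mult:
  "basis_elt a \<otimes>\<^bsub>monoid_algebra M\<^esub> basis_elt b = basis_elt (a \<otimes>\<^bsub>M\<^esub> b)"
  by (auto simp: monoid_algebra_mult) (auto simp: basis_elt_def)

lemma monoid_algebra_minus:
  assumes "Group.monoid M" "p \<in> carrier (monoid_algebra M)" "q \<in> carrier (monoid_algebra M)"
  shows "p \<ominus>\<^bsub>monoid_algebra M\<^esub> q = (\<lambda>x. p x - q x)"
proof -
  interpret ring "monoid_algebra M" by (rule monoid_algebra_ring) fact
  have m: "(\<lambda>x. - q x) \<in> carrier (monoid_algebra M)"
    using assms by (auto simp: monoid_algebra_simps)
  have "\<ominus>\<^bsub>monoid_algebra M\<^esub> q = (\<lambda>x. - q x)"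
    by (rule minus_equality) (use assms m in \<open>auto simp: monoid_algebra_simps\<close>)
  then show ?thesis by (simp add: a_minus_def monoid_algebra_simps)
qed

text \<open>Being a ring depends only on the ring fields; this transfers it to records that also
  carry scalars or a star.\<close>

lemma ring_extend_cong:
  assumes "ring R" "carrier S = carrier R" "monoid.mult S = monoid.mult R" "one S = one R"
    "zero S = zero R" "add S = add R"
  shows "ring S"
proof -
  interpret ring R by fact
  show ?thesis
  proof (rule ringI)
    show "abelian_group S"
      by (rule abelian_groupI)
        (use assms in \<open>auto simp: a_ac intro: add.l_inv_ex\<close>)
    show "Group.monoid S"
      by (rule monoidI) (use assms in \<open>auto simp: m_assoc\<close>)
  qed (use assms in \<open>auto simp: l_distr r_distr\<close>)
qed

section \<open>Tensor products\<close>

locale complex_algebra = ring A for A :: "(complex, 'a, 'm) module_scheme" (structure) +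
  assumes smult_closed [simp]: "a \<in> carrier A \<Longrightarrow> c \<odot> a \<in> carrier A"
    and smult_mult: "a \<in> carrier A \<Longrightarrow> b \<in> carrier A \<Longrightarrow> (c \<odot> a) \<otimes> b = c \<odot> (a \<otimes> b)"
    and mult_smult: "a \<in> carrier A \<Longrightarrow> b \<in> carrier A \<Longrightarrow> a \<otimes> (c \<odot> b) = c \<odot> (a \<otimes> b)"

text \<open>Uncurried, so that a form can be fed to \<open>lin_ext\<close> on the free vector space
  over pairs.\<close>

definition bilinear_form ::
    "(complex, 'a, 'm) module_scheme \<Rightarrow> (complex, 'b, 'k) module_scheme \<Rightarrow> ('a \<times> 'b \<Rightarrow> complex) \<Rightarrow> bool"
  where "bilinear_form A B \<beta> \<longleftrightarrow>
    (\<forall>a\<in>carrier A. \<forall>a'\<in>carrier A. \<forall>b\<in>carrier B. \<beta> (a \<oplus>\<^bsub>A\<^esub> a', b) = \<beta> (a, b) + \<beta> (a', b)) \<and>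
    (\<forall>a\<in>carrier A. \<forall>b\<in>carrier B. \<forall>b'\<in>carrier B. \<beta> (a, b \<oplus>\<^bsub>B\<^esub> b') = \<beta> (a, b) + \<beta> (a, b')) \<and>
    (\<forall>c. \<forall>a\<in>carrier A. \<forall>b\<in>carrier B. \<beta> (c \<odot>\<^bsub>A\<^esub> a, b) = c * \<beta> (a, b)) \<and>
    (\<forall>c. \<forall>a\<in>carrier A. \<forall>b\<in>carrier B. \<beta> (a, c \<odot>\<^bsub>B\<^esub> b) = c * \<beta> (a, b))"

definition linear_form :: "(complex, 'a, 'm) module_scheme \<Rightarrow> ('a \<Rightarrow> complex) \<Rightarrow> bool" where
  "linear_form A e \<longleftrightarrow>
    (\<forall>a\<in>carrier A. \<forall>a'\<in>carrier A. e (a \<oplus>\<^bsub>A\<^esub> a') = e a + e a') \<and>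
    (\<forall>c. \<forall>a\<in>carrier A. e (c \<odot>\<^bsub>A\<^esub> a) = c * e a)"

lemma bilinear_form_prod:
  "linear_form A e \<Longrightarrow> linear_form B e' \<Longrightarrow> bilinear_form A B (\<lambda>(a, b). e a * e' b)"
  by (auto simp: linear_form_def bilinear_form_def algebra_simps)

locale tensor_algebras = A: complex_algebra A + B: complex_algebra B
  for A :: "(complex, 'a, 'm) module_scheme" and B :: "(complex, 'b, 'k) module_scheme"
begin

abbreviation "F \<equiv> monoid_algebra (A \<times>\<times> B)"
abbreviation "J \<equiv> tensor_ideal A B"

lemma monoid_AB: "Group.monoid (A \<times>\<times> B)"
  by (rule DirProd_monoid) unfold_locales

sublocale F: ring F
  by (rule monoid_algebra_ring[OF monoid_AB])

lemma finite_supp: "p \<in> carrier F \<Longrightarrow> finite {x. p x \<noteq> 0}"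
  by (simp add: monoid_algebra_simps)

lemma F_minus: "p \<in> carrier F \<Longrightarrow> q \<in> carrier F \<Longrightarrow> p \<ominus>\<^bsub>F\<^esub> q = (\<lambda>x. p x - q x)"
  by (rule monoid_algebra_minus[OF monoid_AB])

lemma smult_F_closed: "p \<in> carrier F \<Longrightarrow> c \<odot>\<^bsub>F\<^esub> p \<in> carrier F"
  by (auto simp: monoid_algebra_simps)

lemma relations_carrier: "tensor_relations A B \<subseteq> carrier F"
  unfolding tensor_relations_def Let_def
  by (auto intro!: F.minus_closed F.add.m_closed smult_F_closed)

sublocale J: ideal J F
  unfolding tensor_ideal_def by (rule F.genideal_ideal[OF relations_carrier])

lemma J_carrier: "p \<in> J \<Longrightarrow> p \<in> carrier F"
  by (rule J.a_Hcarr)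

lemma J_add: "p \<in> J \<Longrightarrow> q \<in> J \<Longrightarrow> (\<lambda>x. p x + q x) \<in> J"
  using J.a_closed[of p q] by (simp add: monoid_algebra_simps)

text \<open>\<open>J\<close> is generated as a ring ideal; scalars are absorbed as multiples of the
  unit of the monoid algebra.\<close>

lemma J_smult: assumes "p \<in> J" shows "(\<lambda>x. c * p x) \<in> J"
proof -
  have "(c \<odot>\<^bsub>F\<^esub> \<one>\<^bsub>F\<^esub>) \<otimes>\<^bsub>F\<^esub> p \<in> J"
    by (rule J.I_l_closed[OF assms]) (simp add: smult_F_closed)
  then show ?thesis
    using J_carrier[OF assms] by (simp add: monoid_algebra_smult_mult) (simp add: monoid_algebra_simps)
qed

lemma J_diff: "p \<in> J \<Longrightarrow> q \<in> J \<Longrightarrow> (\<lambda>x. p x - q x) \<in> J"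
  using J_add[of p "\<lambda>x. - 1 * q x"] J_smult[of q "- 1"] by simp

lemma J_zero: "(\<lambda>x. 0) \<in> J"
  using J.zero_closed by (simp add: monoid_algebra_simps)

lemma J_sum: "finite I \<Longrightarrow> (\<And>i. i \<in> I \<Longrightarrow> p i \<in> J) \<Longrightarrow> (\<lambda>x. \<Sum>i\<in>I. p i x) \<in> J"
  by (induction I rule: finite_induct) (auto simp: J_zero intro: J_add)

lemma J_relations:
  assumes "a \<in> carrier A" "b \<in> carrier B"
  shows "a' \<in> carrier A \<Longrightarrow>
      (\<lambda>x. basis_elt (a \<oplus>\<^bsub>A\<^esub> a', b) x - (basis_elt (a, b) x + basis_elt (a', b) x)) \<in> J"
    and "b' \<in> carrier B \<Longrightarrow>
      (\<lambda>x. basis_elt (a, b \<oplus>\<^bsub>B\<^esub> b') x - (basis_elt (a, b) x + basis_elt (a, b') x)) \<in> J"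
    and "(\<lambda>x. basis_elt (c \<odot>\<^bsub>A\<^esub> a, b) x - c * basis_elt (a, b) x) \<in> J"
    and "(\<lambda>x. basis_elt (a, c \<odot>\<^bsub>B\<^esub> b) x - c * basis_elt (a, b) x) \<in> J"
proof -
  have R: "r \<in> tensor_relations A B \<Longrightarrow> r \<in> J" for r
    using F.genideal_self[OF relations_carrier] unfolding tensor_ideal_def by blast
  note [simp] = F_minus smult_F_closed assms
  show "(\<lambda>x. basis_elt (a \<oplus>\<^bsub>A\<^esub> a', b) x - (basis_elt (a, b) x + basis_elt (a', b) x)) \<in> J"
    if a': "a' \<in> carrier A"
  proof -
    have "basis_elt (a \<oplus>\<^bsub>A\<^esub> a', b) \<ominus>\<^bsub>F\<^esub> (basis_elt (a, b) \<oplus>\<^bsub>F\<^esub> basis_elt (a', b)) \<in> tensor_relations A B"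
      unfolding tensor_relations_def Let_def using assms a' by blast
    from R[OF this] a' show ?thesis by simp (simp add: monoid_algebra_simps(4))
  qed
  show "(\<lambda>x. basis_elt (a, b \<oplus>\<^bsub>B\<^esub> b') x - (basis_elt (a, b) x + basis_elt (a, b') x)) \<in> J"
    if b': "b' \<in> carrier B"
  proof -
    have "basis_elt (a, b \<oplus>\<^bsub>B\<^esub> b') \<ominus>\<^bsub>F\<^esub> (basis_elt (a, b) \<oplus>\<^bsub>F\<^esub> basis_elt (a, b')) \<in> tensor_relations A B"
      unfolding tensor_relations_def Let_def using assms b' by blast
    from R[OF this] b' show ?thesis by simp (simp add: monoid_algebra_simps(4))
  qed
  have "basis_elt (c \<odot>\<^bsub>A\<^esub> a, b) \<ominus>\<^bsub>F\<^esub> (c \<odot>\<^bsub>F\<^esub> basis_elt (a, b)) \<in> tensor_relations A B"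
    unfolding tensor_relations_def Let_def using assms by blast
  from R[OF this] show "(\<lambda>x. basis_elt (c \<odot>\<^bsub>A\<^esub> a, b) x - c * basis_elt (a, b) x) \<in> J"
    by simp (simp add: monoid_algebra_simps(5))
  have "basis_elt (a, c \<odot>\<^bsub>B\<^esub> b) \<ominus>\<^bsub>F\<^esub> (c \<odot>\<^bsub>F\<^esub> basis_elt (a, b)) \<in> tensor_relations A B"
    unfolding tensor_relations_def Let_def using assms by blast
  from R[OF this] show "(\<lambda>x. basis_elt (a, c \<odot>\<^bsub>B\<^esub> b) x - c * basis_elt (a, b) x) \<in> J"
    by simp (simp add: monoid_algebra_simps(5))
qed

section \<open>Tensor relations and bilinear forms\<close>

lemma bilinear_form_mult:
  assumes "bilinear_form A B \<beta>" "x \<in> carrier A \<times> carrier B"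
  shows "bilinear_form A B (\<lambda>y. \<beta> (y \<otimes>\<^bsub>A \<times>\<times> B\<^esub> x))" "bilinear_form A B (\<lambda>y. \<beta> (x \<otimes>\<^bsub>A \<times>\<times> B\<^esub> y))"
  using assms unfolding bilinear_form_def
  by (auto simp: A.l_distr B.l_distr A.r_distr B.r_distr A.smult_mult B.smult_mult
      A.mult_smult B.mult_smult)

text \<open>Multiplying the argument of a bilinear form by a fixed pair gives a bilinear form again.
  Since \<open>J\<close> is generated as a two-sided ideal, vanishing of forms on its generators
  extends to \<open>J\<close> only through this fact.\<close>

lemma bilinear_form_ideal:
  "ideal {p \<in> carrier F. \<forall>\<beta>. bilinear_form A B \<beta> \<longrightarrow> lin_ext \<beta> p = 0} F" (is "ideal ?K F")
proof (rule idealI)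
  show "subgroup ?K (add_monoid F)"
  proof (rule F.add.subgroupI)
    show "?K \<noteq> {}" by (auto intro!: exI[of _ "\<zero>\<^bsub>F\<^esub>"]) (simp add: monoid_algebra_simps)
    show "\<ominus>\<^bsub>F\<^esub> p \<in> ?K" if p: "p \<in> ?K" for p
    proof -
      have "\<ominus>\<^bsub>F\<^esub> p = (\<lambda>x. - 1 * p x)"
        using F_minus[of "\<zero>\<^bsub>F\<^esub>" p] p by (simp add: a_minus_def) (simp add: monoid_algebra_simps)
      then show ?thesis using p lin_ext_smult[of _ "- 1" p] by (auto simp: monoid_algebra_simps)
    qed
    show "p \<oplus>\<^bsub>F\<^esub> q \<in> ?K" if "p \<in> ?K" "q \<in> ?K" for p q
    proof -
      have "lin_ext \<beta> (p \<oplus>\<^bsub>F\<^esub> q) = lin_ext \<beta> p + lin_ext \<beta> q" for \<beta>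
        using that by (simp add: monoid_algebra_simps(4) lin_ext_add finite_supp)
      then show ?thesis using that by auto
    qed
  qed auto
next
  fix p q assume p: "p \<in> ?K" and q: "q \<in> carrier F"
  have fin: "finite {x. p x \<noteq> 0}" "finite {x. q x \<noteq> 0}" using p q finite_supp by auto
  have car: "y \<in> carrier A \<times> carrier B" if "q y \<noteq> 0" for y
    using q that by (auto simp: monoid_algebra_simps)
  show "q \<otimes>\<^bsub>F\<^esub> p \<in> ?K"
  proof (safe intro!: F.m_closed)
    fix \<beta> assume \<beta>: "bilinear_form A B \<beta>"
    have "lin_ext (\<lambda>y. \<beta> (x \<otimes>\<^bsub>A \<times>\<times> B\<^esub> y)) p = 0" if "q x \<noteq> 0" for x
      using p bilinear_form_mult(2)[OF \<beta> car[OF that]] by blast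
    then show "lin_ext \<beta> (q \<otimes>\<^bsub>F\<^esub> p) = 0"
      unfolding lin_ext_mult[OF fin(2) fin(1)] by (simp add: lin_ext_def[of _ q])
  qed (use p q in simp_all)
  show "p \<otimes>\<^bsub>F\<^esub> q \<in> ?K"
  proof (safe intro!: F.m_closed)
    fix \<beta> assume \<beta>: "bilinear_form A B \<beta>"
    \<comment> \<open>Here \<open>p\<close> governs the outer sum, so the sums are exchanged before
      the hypothesis on \<open>p\<close> applies to the form translated by \<open>y\<close>.\<close>
    have "lin_ext \<beta> (p \<otimes>\<^bsub>F\<^esub> q) = (\<Sum>x | p x \<noteq> 0. \<Sum>y | q y \<noteq> 0. p x * (q y * \<beta> (x \<otimes>\<^bsub>A \<times>\<times> B\<^esub> y)))"
      unfolding lin_ext_mult[OF fin] by (simp add: lin_ext_def sum_distrib_left)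
    also have "\<dots> = (\<Sum>y | q y \<noteq> 0. q y * lin_ext (\<lambda>x. \<beta> (x \<otimes>\<^bsub>A \<times>\<times> B\<^esub> y)) p)"
      by (subst sum.swap) (simp add: lin_ext_def sum_distrib_left mult.left_commute)
    also have "\<dots> = 0"
    proof (intro sum.neutral ballI)
      fix y assume "y \<in> {y. q y \<noteq> 0}"
      then have "y \<in> carrier A \<times> carrier B" using car by blast
      with p bilinear_form_mult(1)[OF \<beta>] have "lin_ext (\<lambda>x. \<beta> (x \<otimes>\<^bsub>A \<times>\<times> B\<^esub> y)) p = 0" by blast
      then show "q y * lin_ext (\<lambda>x. \<beta> (x \<otimes>\<^bsub>A \<times>\<times> B\<^esub> y)) p = 0" by simp
    qed
    finally show "lin_ext \<beta> (p \<otimes>\<^bsub>F\<^esub> q) = 0" .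
  qed (use p q in simp_all)
qed (rule F.ring_axioms)

lemma J_bilinear_form:
  assumes "p \<in> J" "bilinear_form A B \<beta>"
  shows "lin_ext \<beta> p = 0"
proof -
  let ?K = "{p \<in> carrier F. \<forall>\<beta>. bilinear_form A B \<beta> \<longrightarrow> lin_ext \<beta> p = 0}"
  have "tensor_relations A B \<subseteq> ?K"
  proof
    fix r assume r: "r \<in> tensor_relations A B"
    have fin: "finite {x. basis_elt z x \<noteq> (0::complex)}" for z :: "'a \<times> 'b"
      by (auto simp: basis_elt_def)
    have "lin_ext \<gamma> r = 0" if "bilinear_form A B \<gamma>" for \<gamma>
      using r that unfolding tensor_relations_def Let_def
      by (auto simp: F_minus smult_F_closed bilinear_form_def)
        (auto simp: monoid_algebra_simps lin_ext_diff lin_ext_add lin_ext_smult fin finite_supp_add)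
    then show "r \<in> ?K" using r relations_carrier by auto
  qed
  then have "J \<subseteq> ?K"
    unfolding tensor_ideal_def by (rule F.genideal_minimal[OF bilinear_form_ideal])
  then show ?thesis using assms by auto
qed

lemma linear_form_zero: "linear_form A e \<Longrightarrow> e \<zero>\<^bsub>A\<^esub> = 0" "linear_form B e' \<Longrightarrow> e' \<zero>\<^bsub>B\<^esub> = 0"
  unfolding linear_form_def
  by (metis A.l_zero A.zero_closed add_cancel_right_left, metis B.l_zero B.zero_closed add_cancel_right_left)

lemma linear_form_finsum:
  assumes "linear_form B e" "\<And>i. i < (m::nat) \<Longrightarrow> b i \<in> carrier B"
  shows "e (\<Oplus>\<^bsub>B\<^esub>i\<in>{..<m}. b i) = (\<Sum>i<m. e (b i))"
  using assms(2)
proof (induction m)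
  case (Suc m)
  then have "(\<Oplus>\<^bsub>B\<^esub>i\<in>{..<m}. b i) \<in> carrier B" by (intro B.finsum_closed) auto
  then show ?case
    using Suc assms(1) by (simp add: lessThan_Suc linear_form_def Pi_def add.commute)
qed (simp add: linear_form_zero assms)

lemma J_finsum:
  assumes "a \<in> carrier A" "\<And>i. i < (m::nat) \<Longrightarrow> b i \<in> carrier B"
  shows "(\<lambda>x. basis_elt (a, \<Oplus>\<^bsub>B\<^esub>i\<in>{..<m}. b i) x - (\<Sum>i<m. basis_elt (a, b i) x)) \<in> J"
  using assms(2)
proof (induction m)
  case 0
  \<comment> \<open>The basis element of \<open>(a, 0)\<close> is not zero in the free vector space;
    it is minus the additivity relation for 0 + 0.\<close>
  have "(\<lambda>x. - 1 * (basis_elt (a, \<zero>\<^bsub>B\<^esub> \<oplus>\<^bsub>B\<^esub> \<zero>\<^bsub>B\<^esub>) x - (basis_elt (a, \<zero>\<^bsub>B\<^esub>) x + basis_elt (a, \<zero>\<^bsub>B\<^esub>) x))) \<in> J"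
    by (intro J_smult J_relations assms) auto
  then show ?case by simp
next
  case (Suc m)
  let ?s = "\<Oplus>\<^bsub>B\<^esub>i\<in>{..<m}. b i"
  have s: "?s \<in> carrier B" by (intro B.finsum_closed) (use Suc in auto)
  have "(\<lambda>x. (basis_elt (a, b m \<oplus>\<^bsub>B\<^esub> ?s) x - (basis_elt (a, b m) x + basis_elt (a, ?s) x))
      + (basis_elt (a, ?s) x - (\<Sum>i<m. basis_elt (a, b i) x))) \<in> J"
    by (intro J_add J_relations assms s Suc) (use Suc.prems in auto)
  moreover have "(\<Oplus>\<^bsub>B\<^esub>i\<in>{..<Suc m}. b i) = b m \<oplus>\<^bsub>B\<^esub> ?s"
    using Suc.prems by (simp add: lessThan_Suc Pi_def)
  ultimately show ?case by (simp add: algebra_simps)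
qed

text \<open>
  Solving for \<open>b\<^sub>m\<close> at a point where \<open>a\<^sub>m\<close> does not vanish reduces the number of summands by one.
\<close>

lemma J_sum_of_pure:
  fixes eA :: "'x \<Rightarrow> 'a \<Rightarrow> complex" and eB :: "'y \<Rightarrow> 'b \<Rightarrow> complex"
  assumes A: "\<And>x. x \<in> X \<Longrightarrow> linear_form A (eA x)"
    and B: "\<And>y. y \<in> Y \<Longrightarrow> linear_form B (eB y)"
    and sepA: "\<And>a. a \<in> carrier A \<Longrightarrow> (\<And>x. x \<in> X \<Longrightarrow> eA x a = 0) \<Longrightarrow> a = \<zero>\<^bsub>A\<^esub>"
    and sepB: "\<And>b b'. b \<in> carrier B \<Longrightarrow> b' \<in> carrier B \<Longrightarrow> (\<And>y. y \<in> Y \<Longrightarrow> eB y b = eB y b') \<Longrightarrow> b = b'"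
    and "\<And>i. i < (m::nat) \<Longrightarrow> a i \<in> carrier A \<and> b i \<in> carrier B"
    and "\<And>x y. x \<in> X \<Longrightarrow> y \<in> Y \<Longrightarrow> (\<Sum>i<m. eA x (a i) * eB y (b i)) = 0"
  shows "(\<lambda>z. \<Sum>i<m. basis_elt (a i, b i) z) \<in> J"
  using assms(5,6)
proof (induction m arbitrary: a)
  case 0
  then show ?case by (simp add: J_zero)
next
  case (Suc m)
  have ca: "a i \<in> carrier A" and cb: "b i \<in> carrier B" if "i < Suc m" for i
    using Suc.prems that by auto
  show ?case
  proof (cases "a m = \<zero>\<^bsub>A\<^esub>")
    case True
    have "(\<lambda>z. \<Sum>i<m. basis_elt (a i, b i) z) \<in> J"
      by (rule Suc.IH) (use Suc.prems True linear_form_zero(1)[OF A] in auto)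
    moreover have "(\<lambda>z. - 1 * (basis_elt (\<zero>\<^bsub>A\<^esub> \<oplus>\<^bsub>A\<^esub> \<zero>\<^bsub>A\<^esub>, b m) z
        - (basis_elt (\<zero>\<^bsub>A\<^esub>, b m) z + basis_elt (\<zero>\<^bsub>A\<^esub>, b m) z))) \<in> J"
      by (intro J_smult J_relations) (auto simp: cb)
    ultimately have "(\<lambda>z. (\<Sum>i<m. basis_elt (a i, b i) z) + basis_elt (\<zero>\<^bsub>A\<^esub>, b m) z) \<in> J"
      by (intro J_add) simp_all
    then show ?thesis using True by simp
  next
    case False
    then obtain x0 where x0: "x0 \<in> X" "eA x0 (a m) \<noteq> 0" using sepA ca by blast
    define c where "c i = - eA x0 (a i) / eA x0 (a m)" for i
    have cbm: "c i \<odot>\<^bsub>B\<^esub> b i \<in> carrier B" if "i < m" for i using cb that by auto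
    have bm: "b m = (\<Oplus>\<^bsub>B\<^esub>i\<in>{..<m}. c i \<odot>\<^bsub>B\<^esub> b i)"
    proof (rule sepB)
      fix y assume y: "y \<in> Y"
      have "(\<Sum>i<m. eA x0 (a i) * eB y (b i)) + eA x0 (a m) * eB y (b m) = 0"
        using Suc.prems(2)[OF x0(1) y] by simp
      then have "eB y (b m) = - (\<Sum>i<m. eA x0 (a i) * eB y (b i)) / eA x0 (a m)"
        using x0 by (simp add: field_simps eq_neg_iff_add_eq_0 add.commute)
      also have "\<dots> = (\<Sum>i<m. c i * eB y (b i))"
        by (simp add: c_def sum_divide_distrib sum_negf)
      also have "\<dots> = eB y (\<Oplus>\<^bsub>B\<^esub>i\<in>{..<m}. c i \<odot>\<^bsub>B\<^esub> b i)"
        using linear_form_finsum[OF B[OF y], of m "\<lambda>i. c i \<odot>\<^bsub>B\<^esub> b i"] cbm B[OF y] cb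
        by (simp add: linear_form_def)
      finally show "eB y (b m) = eB y (\<Oplus>\<^bsub>B\<^esub>i\<in>{..<m}. c i \<odot>\<^bsub>B\<^esub> b i)" .
    qed (use cb cbm in \<open>auto intro!: B.finsum_closed\<close>)
    \<comment> \<open>Substituting the expression for \<open>b m\<close> moves the last summand into
      the first factors of the others. The \<open>b i\<close> stay as they are, so only
      \<open>a\<close> is generalized in the induction.\<close>
    define a' where "a' i = a i \<oplus>\<^bsub>A\<^esub> c i \<odot>\<^bsub>A\<^esub> a m" for i
    have IH: "(\<lambda>z. \<Sum>i<m. basis_elt (a' i, b i) z) \<in> J"
    proof (rule Suc.IH)
      fix x y assume xy: "x \<in> X" "y \<in> Y"
      have "(\<Sum>i<m. eA x (a' i) * eB y (b i))
        = (\<Sum>i<m. eA x (a i) * eB y (b i)) + eA x (a m) * (\<Sum>i<m. c i * eB y (b i))"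
        using A[OF xy(1)] ca
        by (simp add: a'_def linear_form_def sum.distrib sum_distrib_left algebra_simps)
      also have "(\<Sum>i<m. c i * eB y (b i)) = eB y (b m)"
        unfolding bm using linear_form_finsum[OF B[OF xy(2)], of m "\<lambda>i. c i \<odot>\<^bsub>B\<^esub> b i"] cbm B[OF xy(2)] cb
        by (simp add: linear_form_def)
      finally show "(\<Sum>i<m. eA x (a' i) * eB y (b i)) = 0"
        using Suc.prems(2)[OF xy] by simp
    qed (use ca cb in \<open>auto simp: a'_def\<close>)
    have 1: "(\<lambda>z. \<Sum>i<m. (basis_elt (a' i, b i) z - (basis_elt (a i, b i) z + basis_elt (c i \<odot>\<^bsub>A\<^esub> a m, b i) z))
        + (basis_elt (c i \<odot>\<^bsub>A\<^esub> a m, b i) z - c i * basis_elt (a m, b i) z)) \<in> J"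
      unfolding a'_def by (intro J_sum J_add J_relations) (auto simp: ca cb)
    have 2: "(\<lambda>z. (basis_elt (a m, b m) z - (\<Sum>i<m. basis_elt (a m, c i \<odot>\<^bsub>B\<^esub> b i) z))
        + (\<Sum>i<m. basis_elt (a m, c i \<odot>\<^bsub>B\<^esub> b i) z - c i * basis_elt (a m, b i) z)) \<in> J"
      by (rule J_add, subst bm, rule J_finsum, use ca cbm in simp_all)
        (intro J_sum J_relations, auto simp: ca cb)
    have "(\<lambda>z. (\<Sum>i<m. basis_elt (a' i, b i) z)
      - (\<Sum>i<m. (basis_elt (a' i, b i) z - (basis_elt (a i, b i) z + basis_elt (c i \<odot>\<^bsub>A\<^esub> a m, b i) z))
        + (basis_elt (c i \<odot>\<^bsub>A\<^esub> a m, b i) z - c i * basis_elt (a m, b i) z))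
      + ((basis_elt (a m, b m) z - (\<Sum>i<m. basis_elt (a m, c i \<odot>\<^bsub>B\<^esub> b i) z))
        + (\<Sum>i<m. basis_elt (a m, c i \<odot>\<^bsub>B\<^esub> b i) z - c i * basis_elt (a m, b i) z))) \<in> J"
      by (intro J_add[OF J_diff[OF IH 1] 2])
    then show ?thesis by (simp add: sum.distrib sum_subtractf algebra_simps)
  qed
qed

text \<open>Points that separate each factor jointly separate the tensor product, so tensors are
  faithfully functions on \<open>X\<close> times \<open>Y\<close>. The coefficients of
  \<open>p\<close> are absorbed into the first factors, which leaves a sum of pure tensors.\<close>

lemma J_separating:
  fixes eA :: "'x \<Rightarrow> 'a \<Rightarrow> complex" and eB :: "'y \<Rightarrow> 'b \<Rightarrow> complex"
  assumes A: "\<And>x. x \<in> X \<Longrightarrow> linear_form A (eA x)"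
    and B: "\<And>y. y \<in> Y \<Longrightarrow> linear_form B (eB y)"
    and sepA: "\<And>a. a \<in> carrier A \<Longrightarrow> (\<And>x. x \<in> X \<Longrightarrow> eA x a = 0) \<Longrightarrow> a = \<zero>\<^bsub>A\<^esub>"
    and sepB: "\<And>b b'. b \<in> carrier B \<Longrightarrow> b' \<in> carrier B \<Longrightarrow> (\<And>y. y \<in> Y \<Longrightarrow> eB y b = eB y b') \<Longrightarrow> b = b'"
    and p: "p \<in> carrier F"
    and z: "\<And>x y. x \<in> X \<Longrightarrow> y \<in> Y \<Longrightarrow> lin_ext (\<lambda>(a, b). eA x a * eB y b) p = 0"
  shows "p \<in> J"
proof -
  obtain m and f :: "nat \<Rightarrow> 'a \<times> 'b" where f: "bij_betw f {..<m} {z. p z \<noteq> 0}"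
    using ex_bij_betw_nat_finite[OF finite_supp[OF p]] by (auto simp: atLeast0LessThan)
  have car: "fst (f i) \<in> carrier A" "snd (f i) \<in> carrier B" if "i < m" for i
    using bij_betwE[OF f, rule_format, of i] that p by (auto simp: monoid_algebra_simps)
  have "(\<lambda>z. \<Sum>i<m. basis_elt (p (f i) \<odot>\<^bsub>A\<^esub> fst (f i), snd (f i)) z) \<in> J"
  proof (rule J_sum_of_pure[where eA = eA and eB = eB and X = X and Y = Y])
    fix x y assume xy: "x \<in> X" "y \<in> Y"
    have "lin_ext (\<lambda>(a, b). eA x a * eB y b) p
      = (\<Sum>i<m. p (f i) * (eA x (fst (f i)) * eB y (snd (f i))))"
      unfolding lin_ext_def by (subst sum.reindex_bij_betw[OF f, symmetric]) (simp add: case_prod_unfold)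
    then show "(\<Sum>i<m. eA x (p (f i) \<odot>\<^bsub>A\<^esub> fst (f i)) * eB y (snd (f i))) = 0"
      using z[OF xy] A[OF xy(1)] car by (simp add: linear_form_def mult.assoc)
  qed (use A B sepA sepB car in auto)
  moreover have "(\<lambda>z. \<Sum>i<m. basis_elt (p (f i) \<odot>\<^bsub>A\<^esub> fst (f i), snd (f i)) z
      - p (f i) * basis_elt (fst (f i), snd (f i)) z) \<in> J"
    by (intro J_sum J_relations) (auto simp: car)
  ultimately have "(\<lambda>z. (\<Sum>i<m. basis_elt (p (f i) \<odot>\<^bsub>A\<^esub> fst (f i), snd (f i)) z)
      - (\<Sum>i<m. basis_elt (p (f i) \<odot>\<^bsub>A\<^esub> fst (f i), snd (f i)) z
      - p (f i) * basis_elt (fst (f i), snd (f i)) z)) \<in> J"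
    by (rule J_diff)
  moreover have "(\<Sum>i<m. p (f i) * basis_elt (f i) z) = p z" for z
  proof -
    have "(\<Sum>i<m. p (f i) * basis_elt (f i) z) = (\<Sum>w | p w \<noteq> 0. p w * basis_elt w z)"
      by (rule sum.reindex_bij_betw[OF f])
    also have "\<dots> = p z"
      using finite_supp[OF p] by (auto simp: basis_elt_def if_distrib sum.delta cong: if_cong)
    finally show ?thesis .
  qed
  ultimately show ?thesis by (simp add: sum_subtractf)
qed

section \<open>The quotient algebra and functionals on it\<close>

lemma tensor_simps:
  "carrier (tensor A B) = carrier (F Quot J)"
  "monoid.mult (tensor A B) = monoid.mult (F Quot J)"
  "one (tensor A B) = one (F Quot J)"
  "zero (tensor A B) = zero (F Quot J)"
  "add (tensor A B) = add (F Quot J)"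
  by (simp_all add: tensor_def quot_algebra_def ring.defs module.defs)

sublocale T: ring "tensor A B"
  by (rule ring_extend_cong[OF J.quotient_is_ring]) (simp_all add: tensor_simps)

lemma tensor_carrierE:
  assumes "t \<in> carrier (tensor A B)"
  obtains p where "p \<in> carrier F" "t = J +>\<^bsub>F\<^esub> p"
  using assms by (auto simp: tensor_simps FactRing_def A_RCOSETS_def')

lemma coset_closed: "p \<in> carrier F \<Longrightarrow> J +>\<^bsub>F\<^esub> p \<in> carrier (tensor A B)"
  by (auto simp: tensor_simps FactRing_def A_RCOSETS_def')

lemma coset_eq_iff:
  "p \<in> carrier F \<Longrightarrow> q \<in> carrier F \<Longrightarrow> J +>\<^bsub>F\<^esub> p = J +>\<^bsub>F\<^esub> q \<longleftrightarrow> (\<lambda>x. p x - q x) \<in> J"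
  using F.quotient_eq_iff_same_a_r_cos[OF J.ideal_axioms, of p q] by (simp add: F_minus)

lemma coset_mult:
  "p \<in> carrier F \<Longrightarrow> q \<in> carrier F \<Longrightarrow>
    (J +>\<^bsub>F\<^esub> p) \<otimes>\<^bsub>tensor A B\<^esub> (J +>\<^bsub>F\<^esub> q) = J +>\<^bsub>F\<^esub> (p \<otimes>\<^bsub>F\<^esub> q)"
  by (simp add: tensor_simps FactRing_def J.rcoset_mult_add)

lemma coset_add:
  "p \<in> carrier F \<Longrightarrow> q \<in> carrier F \<Longrightarrow>
    (J +>\<^bsub>F\<^esub> p) \<oplus>\<^bsub>tensor A B\<^esub> (J +>\<^bsub>F\<^esub> q) = J +>\<^bsub>F\<^esub> (p \<oplus>\<^bsub>F\<^esub> q)"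
  by (simp add: tensor_simps FactRing_def J.a_rcos_sum)

text \<open>Scalar multiplication of a coset is defined as a union over all representatives; it
  collapses to one coset because \<open>J\<close> is closed under scalars.\<close>

lemma coset_smult:
  assumes p: "p \<in> carrier F"
  shows "c \<odot>\<^bsub>tensor A B\<^esub> (J +>\<^bsub>F\<^esub> p) = J +>\<^bsub>F\<^esub> (c \<odot>\<^bsub>F\<^esub> p)"
proof -
  have "J +>\<^bsub>F\<^esub> (c \<odot>\<^bsub>F\<^esub> q) = J +>\<^bsub>F\<^esub> (c \<odot>\<^bsub>F\<^esub> p)" if q: "q \<in> J +>\<^bsub>F\<^esub> p" for q
  proof -
    have qF: "q \<in> carrier F" using q F.a_r_coset_subset_G[OF J.a_subset p] by auto
    have "J +>\<^bsub>F\<^esub> q = J +>\<^bsub>F\<^esub> p" using J.a_repr_independence'[OF q p] by simp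
    then have "(\<lambda>x. c * (q x - p x)) \<in> J" using coset_eq_iff[OF qF p] J_smult by blast
    then show ?thesis
      using coset_eq_iff[OF smult_F_closed[OF qF] smult_F_closed[OF p], of c c]
      by (simp add: monoid_algebra_simps algebra_simps)
  qed
  moreover have "p \<in> J +>\<^bsub>F\<^esub> p" by (rule J.a_rcos_self[OF p])
  moreover have "c \<odot>\<^bsub>tensor A B\<^esub> (J +>\<^bsub>F\<^esub> p) = (\<Union>x\<in>J +>\<^bsub>F\<^esub> p. J +>\<^bsub>F\<^esub> (c \<odot>\<^bsub>F\<^esub> x))"
    by (simp add: tensor_def quot_algebra_def ring.defs module.defs)
  ultimately show ?thesis by blast
qed

text \<open>The functional on the tensor product induced by \<open>\<beta>\<close>. For bilinear
  \<open>\<beta>\<close> the chosen representative does not matter, since \<open>\<beta>\<close>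
  annihilates \<open>J\<close>.\<close>

definition ev :: "('a \<times> 'b \<Rightarrow> complex) \<Rightarrow> ('a \<times> 'b \<Rightarrow> complex) set \<Rightarrow> complex" where
  "ev \<beta> t = lin_ext \<beta> (SOME p. p \<in> carrier F \<and> t = J +>\<^bsub>F\<^esub> p)"

lemma ev_coset:
  assumes "bilinear_form A B \<beta>" "p \<in> carrier F"
  shows "ev \<beta> (J +>\<^bsub>F\<^esub> p) = lin_ext \<beta> p"
proof -
  define q where "q = (SOME q. q \<in> carrier F \<and> J +>\<^bsub>F\<^esub> p = J +>\<^bsub>F\<^esub> q)"
  have q: "q \<in> carrier F \<and> J +>\<^bsub>F\<^esub> p = J +>\<^bsub>F\<^esub> q"
    unfolding q_def by (rule someI[of _ p]) (use assms in simp)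
  then have "lin_ext \<beta> (\<lambda>x. p x - q x) = 0"
    using coset_eq_iff assms J_bilinear_form by blast
  then show ?thesis
    unfolding ev_def q_def[symmetric] using lin_ext_diff[of p q \<beta>] finite_supp assms q by auto
qed

end

text \<open>
  Induction over sets of functions produces \<open>\<eta>\<close>-expanded terms, in which the unconditional
  rule would unfold \<open>restrict\<close>.
\<close>

declare restrict_apply [simp del] restrict_apply' [simp] restrict_cong [cong]

section \<open>The group \<open>SU(n)\<close> and its torus\<close>

lemma mat_adjoint_carrier [simp]: "U \<in> carrier_mat n m \<Longrightarrow> mat_adjoint U \<in> carrier_mat m n"
  by (auto simp: mat_adjoint_def)

lemma mat_adjoint_index:
  "U \<in> carrier_mat n m \<Longrightarrow> i < m \<Longrightarrow> j < n \<Longrightarrow> mat_adjoint U $$ (i, j) = conjugate (U $$ (j, i))"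
  by (auto simp: mat_adjoint_def mat_of_rows_index)

lemma mat_mult_index:
  "A \<in> carrier_mat n m \<Longrightarrow> B \<in> carrier_mat m k \<Longrightarrow> i < n \<Longrightarrow> j < k \<Longrightarrow>
    (A * B) $$ (i, j) = (\<Sum>l<m. A $$ (i, l) * B $$ (l, j))"
  by (auto simp: scalar_prod_def atLeast0LessThan)

lemma mat_adjoint_mult:
  assumes "A \<in> carrier_mat n m" "B \<in> carrier_mat m k"
  shows "mat_adjoint (A * B :: complex mat) = mat_adjoint B * mat_adjoint A"
proof (rule eq_matI)
  fix i j assume "i < dim_row (mat_adjoint B * mat_adjoint A)" "j < dim_col (mat_adjoint B * mat_adjoint A)"
  then have ij: "i < k" "j < n" using mat_adjoint_carrier[OF assms(1)] mat_adjoint_carrier[OF assms(2)] by auto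
  have "mat_adjoint (A * B) $$ (i, j) = cnj (\<Sum>l<m. A $$ (j, l) * B $$ (l, i))"
    using assms ij by (subst mat_adjoint_index[of _ n k]) (simp_all only: mat_mult_index[OF assms] mult_carrier_mat conjugate_complex_def)
  also have "\<dots> = (\<Sum>l<m. mat_adjoint B $$ (i, l) * mat_adjoint A $$ (l, j))"
    unfolding cnj_sum
    by (rule sum.cong) (use ij in \<open>auto simp: mat_adjoint_index[OF assms(1)] mat_adjoint_index[OF assms(2)]\<close>)
  also have "\<dots> = (mat_adjoint B * mat_adjoint A) $$ (i, j)"
    by (rule mat_mult_index[symmetric]) (use assms ij in auto)
  finally show "mat_adjoint (A * B) $$ (i, j) = (mat_adjoint B * mat_adjoint A) $$ (i, j)" .
qed (use mat_adjoint_carrier[OF assms(1)] mat_adjoint_carrier[OF assms(2)]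
    mat_adjoint_carrier[OF mult_carrier_mat[OF assms]] in auto)

lemma SU_iff:
  "U \<in> SU n \<longleftrightarrow> U \<in> carrier_mat n n \<and> det U = 1 \<and>
    (\<forall>i<n. \<forall>j<n. (\<Sum>k<n. U $$ (i, k) * cnj (U $$ (j, k))) = (if i = j then 1 else 0))"
proof (cases "U \<in> carrier_mat n n")
  case True
  have idx: "(U * mat_adjoint U) $$ (i, j) = (\<Sum>k<n. U $$ (i, k) * cnj (U $$ (j, k)))"
    if "i < n" "j < n" for i j
    using that True by (subst mat_mult_index[of _ n n _ n]) (auto simp: mat_adjoint_index[OF True])
  have dim: "dim_col (mat_adjoint U) = n" "dim_row (mat_adjoint U) = n"
    using mat_adjoint_carrier[OF True] by auto
  have "U * mat_adjoint U = 1\<^sub>m n \<longleftrightarrow>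
      (\<forall>i<n. \<forall>j<n. (U * mat_adjoint U) $$ (i, j) = (if i = j then 1 else 0))"
    using True dim by (auto simp: mat_eq_iff)
  then show ?thesis using True idx by (auto simp: SU_def)
qed (simp add: SU_def)

lemma SU_carrier: "U \<in> SU n \<Longrightarrow> U \<in> carrier_mat n n"
  by (simp add: SU_def)

lemma SU_adjoint_left: "U \<in> SU n \<Longrightarrow> mat_adjoint U * U = 1\<^sub>m n"
  unfolding SU_def using mat_mult_left_right_inverse[of U n "mat_adjoint U"] by auto

lemma SU_mult: assumes "U \<in> SU n" "V \<in> SU n" shows "U * V \<in> SU n"
proof -
  have c: "U \<in> carrier_mat n n" "V \<in> carrier_mat n n"
    "mat_adjoint U \<in> carrier_mat n n" "mat_adjoint V \<in> carrier_mat n n"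
    using assms SU_carrier by auto
  have "U * V * mat_adjoint (U * V) = U * (V * mat_adjoint V) * mat_adjoint U"
    unfolding mat_adjoint_mult[OF c(1,2)] using c by (simp add: assoc_mult_mat[of _ n n _ n _ n] mult_carrier_mat[of _ n n])
  also have "\<dots> = 1\<^sub>m n" using assms c by (simp add: SU_def)
  finally show ?thesis using assms c by (simp add: SU_def det_mult)
qed

section \<open>Weights and characters of the diagonal torus\<close>

definition wvec :: "nat \<Rightarrow> nat \<Rightarrow> int vec" where
  "wvec n i = vec (n - 1) (\<lambda>k. if i < n - 1 then if k = i then 1 else 0 else - 1)"

lemma wvec_carrier [simp]: "wvec n i \<in> carrier_vec (n - 1)"
  by (simp add: wvec_def)

lemma torus_elt_carrier [simp]: "torus_elt n \<phi> \<in> carrier_mat n n"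
  by (simp add: torus_elt_def)

lemma torus_char_wvec:
  assumes "\<phi> \<in> carrier_vec (n - 1)" "i < n"
  shows "torus_elt n \<phi> $$ (i, i) = torus_char (wvec n i) \<phi>"
proof (cases "i < n - 1")
  case True
  have "map_vec real_of_int (wvec n i) = unit_vec (n - 1) i"
    using True by (intro eq_vecI) (auto simp: wvec_def unit_vec_def)
  then have "map_vec real_of_int (wvec n i) \<bullet> \<phi> = \<phi> $ i"
    using True assms by (simp add: scalar_prod_left_unit[of _ "n - 1"])
  then show ?thesis using True assms by (simp add: torus_elt_def torus_char_def)
next
  case False
  have "map_vec real_of_int (wvec n i) \<bullet> \<phi> = - (\<Sum>k<n-1. \<phi> $ k)"
    using assms False by (auto simp: scalar_prod_def wvec_def atLeast0LessThan sum_negf)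
  then show ?thesis using False assms by (simp add: torus_elt_def torus_char_def)
qed

lemma torus_elt_offdiag: "i < n \<Longrightarrow> j < n \<Longrightarrow> i \<noteq> j \<Longrightarrow> torus_elt n \<phi> $$ (i, j) = 0"
  by (simp add: torus_elt_def)

lemma norm_torus_char [simp]: "torus_char r \<phi> * cnj (torus_char r \<phi>) = 1"
  by (simp add: torus_char_def cis_cnj cis_mult)

lemma torus_char_nonzero [simp]: "torus_char r \<phi> \<noteq> 0"
  by (simp add: torus_char_def)

lemma torus_char_add:
  "\<phi> \<in> carrier_vec m \<Longrightarrow> \<psi> \<in> carrier_vec m \<Longrightarrow> r \<in> carrier_vec m \<Longrightarrow>
    torus_char r (\<phi> + \<psi>) = torus_char r \<phi> * torus_char r \<psi>"
  by (simp add: torus_char_def cis_mult scalar_prod_add_distrib[of _ m] ring_distribs)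

lemma torus_char_add_weight:
  assumes "\<phi> \<in> carrier_vec m" "r \<in> carrier_vec m" "r' \<in> carrier_vec m"
  shows "torus_char (r + r') \<phi> = torus_char r \<phi> * torus_char r' \<phi>"
proof -
  have "map_vec real_of_int (r + r') = map_vec real_of_int r + map_vec real_of_int r'"
    using assms by auto
  then show ?thesis
    using assms by (simp add: torus_char_def cis_mult add_scalar_prod_distrib[of _ m] ring_distribs)
qed

lemma torus_char_uminus_weight:
  assumes "\<phi> \<in> carrier_vec m" "r \<in> carrier_vec m"
  shows "torus_char (- r) \<phi> = cnj (torus_char r \<phi>)"
proof -
  have "map_vec real_of_int (- r) = - map_vec real_of_int r"
    using assms by auto
  then show ?thesis
    using assms by (simp add: torus_char_def cis_cnj)
qed

lemma torus_char_zero_weight [simp]: "\<phi> \<in> carrier_vec m \<Longrightarrow> torus_char (0\<^sub>v m) \<phi> = 1"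
proof -
  assume "\<phi> \<in> carrier_vec m"
  then have "map_vec real_of_int (0\<^sub>v m) \<bullet> \<phi> = 0" by (simp add: scalar_prod_def)
  then show ?thesis by (simp add: torus_char_def)
qed

lemma torus_char_separates:
  assumes "r \<in> carrier_vec m" "r' \<in> carrier_vec m" "r \<noteq> r'"
  shows "\<exists>\<phi>\<in>carrier_vec m. torus_char r \<phi> \<noteq> torus_char r' \<phi>"
proof -
  obtain i where i: "i < m" "r $ i \<noteq> r' $ i" using assms by (auto simp: vec_eq_iff)
  define d where "d = real_of_int (r $ i) - real_of_int (r' $ i)"
  \<comment> \<open>Half a period of the quotient of the two characters, along a coordinate in which
    the weights differ: there the quotient equals -1.\<close>
  define \<phi> where "\<phi> = (1 / (2 * d)) \<cdot>\<^sub>v (unit_vec m i :: real vec)"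
  have \<phi>: "\<phi> \<in> carrier_vec m" by (simp add: \<phi>_def)
  have d: "d \<noteq> 0" using i by (simp add: d_def)
  have sp: "map_vec real_of_int s \<bullet> \<phi> = real_of_int (s $ i) / (2 * d)" if "s \<in> carrier_vec m" for s
    using that i by (simp add: \<phi>_def scalar_prod_smult_distrib[of _ m] scalar_prod_right_unit[of _ m])
  have "torus_char r \<phi> * cnj (torus_char r' \<phi>) = cis (2 * pi * (d / (2 * d)))"
    using assms by (simp add: torus_char_def sp cis_cnj cis_mult d_def diff_divide_distrib ring_distribs)
  also have "\<dots> = - 1" using d by simp
  finally have "torus_char r \<phi> \<noteq> torus_char r' \<phi>" by (metis norm_torus_char one_neq_neg_one)
  then show ?thesis using \<phi> by blast
qed

lemma torus_elt_SU: assumes "n > 0" "\<phi> \<in> carrier_vec (n - 1)" shows "torus_elt n \<phi> \<in> SU n"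
proof -
  let ?t = "torus_elt n \<phi>"
  obtain m where n: "n = Suc m" using assms by (cases n) auto
  have "det ?t = (\<Prod>i<n. ?t $$ (i, i))"
    by (subst det_upper_triangular[of _ n])
      (auto simp: upper_triangular_def torus_elt_def prod_list_diag_prod atLeast0LessThan)
  also have "\<dots> = (\<Prod>i<m. cis (2 * pi * \<phi> $ i)) * cis (- 2 * pi * (\<Sum>k<m. \<phi> $ k))"
    unfolding n by (simp add: torus_elt_def)
  also have "(\<Prod>i<m. cis (2 * pi * \<phi> $ i)) = cis (2 * pi * (\<Sum>k<m. \<phi> $ k))"
    by (induction m) (auto simp: cis_mult ring_distribs)
  finally have "det ?t = 1" by (simp add: cis_mult)
  moreover have "(\<Sum>k<n. ?t $$ (i, k) * cnj (?t $$ (j, k))) = (if i = j then 1 else 0)"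
    if ij: "i < n" "j < n" for i j
  proof -
    have "(\<Sum>k<n. ?t $$ (i, k) * cnj (?t $$ (j, k))) = (\<Sum>k<n. if k = i then ?t $$ (i, i) * cnj (?t $$ (j, i)) else 0)"
      by (rule sum.cong) (use ij torus_elt_offdiag[of i n _ \<phi>] in auto)
    then show ?thesis using ij by (auto simp: torus_elt_offdiag torus_char_wvec[OF assms(2)])
  qed
  ultimately show ?thesis by (simp add: SU_iff)
qed

lemma torus_translate_index:
  assumes U: "U \<in> carrier_mat n n" and \<phi>: "\<phi> \<in> carrier_vec (n - 1)" and \<psi>: "\<psi> \<in> carrier_vec (n - 1)"
    and ij: "i < n" "j < n"
  shows "(torus_elt n \<phi> * U * torus_elt n \<psi>) $$ (i, j) =
    torus_char (wvec n i) \<phi> * torus_char (wvec n j) \<psi> * U $$ (i, j)"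
proof -
  have left: "(torus_elt n \<phi> * U) $$ (i, l) = torus_char (wvec n i) \<phi> * U $$ (i, l)" if "l < n" for l
  proof -
    have "(torus_elt n \<phi> * U) $$ (i, l) = (\<Sum>k<n. if k = i then torus_elt n \<phi> $$ (i, i) * U $$ (i, l) else 0)"
      unfolding mat_mult_index[OF torus_elt_carrier U ij(1) that]
      by (rule sum.cong) (use ij that torus_elt_offdiag[of i n _ \<phi>] in auto)
    then show ?thesis using ij torus_char_wvec[OF \<phi>] by simp
  qed
  have "(torus_elt n \<phi> * U * torus_elt n \<psi>) $$ (i, j)
    = (\<Sum>k<n. if k = j then (torus_elt n \<phi> * U) $$ (i, j) * torus_elt n \<psi> $$ (j, j) else 0)"
    unfolding mat_mult_index[OF mult_carrier_mat[OF torus_elt_carrier U] torus_elt_carrier ij]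
    by (rule sum.cong) (use ij torus_elt_offdiag[of _ n j \<psi>] in auto)
  then show ?thesis using ij torus_char_wvec[OF \<psi>] left by simp
qed

section \<open>Generation of the coordinate algebra by matrix entries\<close>

lemma fun_algebra_simps [simp]:
  "carrier (fun_algebra X) = extensional X"
  "f \<otimes>\<^bsub>fun_algebra X\<^esub> g = (\<lambda>x\<in>X. f x * g x)"
  "\<one>\<^bsub>fun_algebra X\<^esub> = (\<lambda>x\<in>X. 1)"
  "\<zero>\<^bsub>fun_algebra X\<^esub> = (\<lambda>x\<in>X. 0)"
  "f \<oplus>\<^bsub>fun_algebra X\<^esub> g = (\<lambda>x\<in>X. f x + g x)"
  "c \<odot>\<^bsub>fun_algebra X\<^esub> f = (\<lambda>x\<in>X. c * f x)"
  "star (fun_algebra X) f = (\<lambda>x\<in>X. cnj (f x))"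
  by (auto simp: fun_algebra_def)

text \<open>By the Leibniz formula a determinant is a polynomial in the entries. The class
  \<open>K\<close> is arbitrary because the lemma serves both cofactors in \<open>mon_span\<close>
  and determinants in the localization \<open>Loc\<close>.\<close>

lemma det_closed:
  fixes K :: "('x \<Rightarrow> complex) set"
  assumes const: "\<And>c. (\<lambda>_. c) \<in> K"
    and add: "\<And>f g. f \<in> K \<Longrightarrow> g \<in> K \<Longrightarrow> (\<lambda>x. f x + g x) \<in> K"
    and mult: "\<And>f g. f \<in> K \<Longrightarrow> g \<in> K \<Longrightarrow> (\<lambda>x. f x * g x) \<in> K"
    and M: "\<And>x. M x \<in> carrier_mat m m"
    and entries: "\<And>a b. a < m \<Longrightarrow> b < m \<Longrightarrow> (\<lambda>x. M x $$ (a, b)) \<in> K"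
  shows "(\<lambda>x. det (M x)) \<in> K"
proof -
  have sum: "(\<lambda>x. \<Sum>i\<in>I. f i x) \<in> K" if "finite I" "\<And>i. i \<in> I \<Longrightarrow> f i \<in> K" for I :: "(nat \<Rightarrow> nat) set" and f
    using that by (induction I rule: finite_induct) (auto intro: const add)
  have prod: "(\<lambda>x. \<Prod>i\<in>I. f i x) \<in> K" if "finite I" "\<And>i. i \<in> I \<Longrightarrow> f i \<in> K" for I :: "nat set" and f
    using that by (induction I rule: finite_induct) (auto intro: const mult)
  have "(\<lambda>x. \<Sum>p\<in>{p. p permutes {0..<m}}. signof p * (\<Prod>i\<in>{0..<m}. M x $$ (i, p i))) \<in> K"
    by (rule sum, simp add: finite_permutations, rule mult[OF const], rule prod)
      (auto intro!: entries dest: permutes_in_image)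
  then show ?thesis using M by (simp add: det_def'[of _ m])
qed

definition entry_mon :: "nat \<Rightarrow> (nat \<times> nat) list \<Rightarrow> complex mat \<Rightarrow> complex" where
  "entry_mon n L = (\<lambda>U\<in>SU n. \<Prod>ij\<leftarrow>L. U $$ ij)"

abbreviation idx :: "nat \<Rightarrow> (nat \<times> nat) list set" where
  "idx n \<equiv> lists ({..<n} \<times> {..<n})"

text \<open>Conjugates are deliberately left out: closure under conjugation follows from cofactors,
  and inductions over the span meet only coordinates, on which the action is prescribed.\<close>

inductive_set mon_span :: "nat \<Rightarrow> (complex mat \<Rightarrow> complex) set" for n where
  mon: "L \<in> idx n \<Longrightarrow> entry_mon n L \<in> mon_span n"
| add: "f \<in> mon_span n \<Longrightarrow> g \<in> mon_span n \<Longrightarrow> (\<lambda>U\<in>SU n. f U + g U) \<in> mon_span n"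
| smult: "f \<in> mon_span n \<Longrightarrow> (\<lambda>U\<in>SU n. c * f U) \<in> mon_span n"

lemma entry_mon_append: "entry_mon n (L @ L') = (\<lambda>U\<in>SU n. entry_mon n L U * entry_mon n L' U)"
  by (auto simp: entry_mon_def)

lemma mon_span_extensional: "f \<in> mon_span n \<Longrightarrow> f \<in> extensional (SU n)"
  by (induction rule: mon_span.induct) (auto simp: entry_mon_def)

lemma mon_span_mult:
  assumes "f \<in> mon_span n" "g \<in> mon_span n"
  shows "(\<lambda>U\<in>SU n. f U * g U) \<in> mon_span n"
  using assms(1)
proof (induction rule: mon_span.induct)
  case (mon L)
  show ?case using assms(2)
  proof (induction rule: mon_span.induct)
    case (mon L')
    then show ?case using \<open>L \<in> idx n\<close> mon_span.mon[of "L @ L'"] by (simp add: entry_mon_append)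
  next
    case (add f g)
    from mon_span.add[OF add.IH] show ?case by (simp add: algebra_simps)
  next
    case (smult f c)
    from mon_span.smult[OF smult.IH, of c] show ?case by (simp add: algebra_simps)
  qed
next
  case (add f g)
  from mon_span.add[OF add.IH] show ?case by (simp add: algebra_simps)
next
  case (smult f c)
  from mon_span.smult[OF smult.IH, of c] show ?case by (simp add: algebra_simps)
qed

lemma mon_span_const: "(\<lambda>U\<in>SU n. c) \<in> mon_span n"
  using mon_span.smult[OF mon_span.mon[of "[]"], of n c] by (simp add: entry_mon_def)

text \<open>For \<open>U \<in> SU(n)\<close> the adjoint \<open>U\<^sup>*\<close> is the inverse of \<open>U\<close>, hence equals the adjugate since \<open>det U = 1\<close>.\<close>

lemma SU_cnj_cofactor:
  assumes U: "U \<in> SU n" and ij: "i < n" "j < n"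
  shows "cnj (U $$ (i, j)) = cofactor U i j"
proof -
  have c: "U \<in> carrier_mat n n" and d: "det U = 1" and u: "U * mat_adjoint U = 1\<^sub>m n"
    using U by (auto simp: SU_def)
  note ad = adj_mat[OF c] and cc = mat_adjoint_carrier[OF c]
  have "1 \<cdot>\<^sub>m 1\<^sub>m n = (1\<^sub>m n :: complex mat)" by auto
  then have "mat_adjoint U = (adj_mat U * U) * mat_adjoint U"
    using ad cc left_mult_one_mat[OF cc] unfolding d by simp
  also have "\<dots> = adj_mat U * (U * mat_adjoint U)"
    by (rule assoc_mult_mat[OF ad(1) c cc])
  also have "\<dots> = adj_mat U" unfolding u using ad(1) by simp
  finally have "mat_adjoint U $$ (j, i) = cofactor U i j" using c ij by (simp add: adj_mat_def)
  then show ?thesis using c ij by (simp add: mat_adjoint_index)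
qed

lemma mon_span_cnj_coord:
  assumes ij: "i < n" "j < n"
  shows "(\<lambda>U\<in>SU n. cnj (U $$ (i, j))) \<in> mon_span n"
proof -
  let ?K = "{f. restrict f (SU n) \<in> mon_span n}"
  \<comment> \<open>Rebuilding \<open>U\<close> as an n x n matrix gives the dimensions that
    \<open>det_closed\<close> demands for every argument, also outside \<open>SU n\<close>.\<close>
  have "(\<lambda>U. det (mat_delete (mat n n (\<lambda>ab. U $$ ab)) i j)) \<in> ?K"
  proof (rule det_closed[where m = "n - 1"])
    fix f g assume "f \<in> ?K" "g \<in> ?K"
    then show "(\<lambda>x. f x + g x) \<in> ?K" "(\<lambda>x. f x * g x) \<in> ?K"
      using mon_span.add[of "restrict f (SU n)" n "restrict g (SU n)"]
        mon_span_mult[of "restrict f (SU n)" n "restrict g (SU n)"]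
      by (auto)
  next
    fix a b assume ab: "a < n - 1" "b < n - 1"
    have "mat_delete (mat n n (\<lambda>ab. U $$ ab)) i j $$ (a, b) = U $$ (insert_index i a, insert_index j b)" for U :: "complex mat"
      using ab ij by (auto simp: mat_delete_def insert_index_def)
    moreover have "entry_mon n [(insert_index i a, insert_index j b)] \<in> mon_span n"
      by (rule mon_span.mon) (use ab in \<open>auto simp: insert_index_def\<close>)
    ultimately show "(\<lambda>U. mat_delete (mat n n (\<lambda>ab. U $$ ab)) i j $$ (a, b)) \<in> ?K"
      by (simp add: entry_mon_def)
  qed (auto simp: mon_span_const mat_delete_def)
  moreover have "mat n n (\<lambda>ab. U $$ ab) = U" if "U \<in> SU n" for U
    using SU_carrier[OF that] by auto
  ultimately have "(\<lambda>U\<in>SU n. det (mat_delete U i j)) \<in> mon_span n"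
    by simp
  from mon_span.smult[OF this, of "(- 1) ^ (i + j)"] show ?thesis
    by (simp add: SU_cnj_cofactor[OF _ ij] cofactor_def)
qed

lemma mon_span_cnj: "f \<in> mon_span n \<Longrightarrow> (\<lambda>U\<in>SU n. cnj (f U)) \<in> mon_span n"
proof (induction rule: mon_span.induct)
  case (mon L)
  then show ?case
  proof (induction L)
    case Nil
    show ?case using mon_span_const[of 1 n] by (simp add: entry_mon_def)
  next
    case (Cons ij L)
    obtain i j where ij: "ij = (i, j)" "i < n" "j < n" using Cons.hyps by auto
    have "(\<lambda>U\<in>SU n. cnj (entry_mon n L U)) \<in> mon_span n" using Cons by auto
    from mon_span_mult[OF mon_span_cnj_coord[OF ij(2,3)] this]
    show ?case by (simp add: entry_mon_def ij)
  qed
next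
  case (add f g)
  from mon_span.add[OF add.IH] show ?case by simp
next
  case (smult f c)
  from mon_span.smult[OF smult.IH, of "cnj c"] show ?case by simp
qed

lemma coord_algebra_simps [simp]:
  "f \<otimes>\<^bsub>coord_algebra n\<^esub> g = (\<lambda>x\<in>SU n. f x * g x)"
  "\<one>\<^bsub>coord_algebra n\<^esub> = (\<lambda>x\<in>SU n. 1)"
  "\<zero>\<^bsub>coord_algebra n\<^esub> = (\<lambda>x\<in>SU n. 0)"
  "f \<oplus>\<^bsub>coord_algebra n\<^esub> g = (\<lambda>x\<in>SU n. f x + g x)"
  "c \<odot>\<^bsub>coord_algebra n\<^esub> f = (\<lambda>x\<in>SU n. c * f x)"
  "star (coord_algebra n) f = (\<lambda>x\<in>SU n. cnj (f x))"
  by (auto simp: coord_algebra_def)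

lemma coord_eq_entry_mon: "coord n i j = entry_mon n [(i, j)]"
  by (simp add: coord_def entry_mon_def)

lemma star_subalgebraD:
  assumes "star_subalgebra S A"
  shows "S \<subseteq> carrier A" "\<one>\<^bsub>A\<^esub> \<in> S" "a \<in> S \<Longrightarrow> b \<in> S \<Longrightarrow> a \<oplus>\<^bsub>A\<^esub> b \<in> S"
    "a \<in> S \<Longrightarrow> b \<in> S \<Longrightarrow> a \<otimes>\<^bsub>A\<^esub> b \<in> S" "a \<in> S \<Longrightarrow> c \<odot>\<^bsub>A\<^esub> a \<in> S"
    "a \<in> S \<Longrightarrow> star A a \<in> S"
  using assms by (simp_all add: star_subalgebra_def)

lemma star_generated_iff:
  "a \<in> star_generated A X \<longleftrightarrow> (\<forall>S. star_subalgebra S A \<longrightarrow> X \<subseteq> S \<longrightarrow> a \<in> S)"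
  by (auto simp: star_generated_def)

lemma star_generated_subset: "star_subalgebra S A \<Longrightarrow> X \<subseteq> S \<Longrightarrow> star_generated A X \<subseteq> S"
  by (auto simp: star_generated_def)

lemma star_generated_superset: "X \<subseteq> star_generated A X"
  by (auto simp: star_generated_def)

lemma star_subalgebra_star_generated:
  assumes "X \<subseteq> S" "star_subalgebra S A"
  shows "star_subalgebra (star_generated A X) A"
proof -
  have "star_generated A X \<subseteq> carrier A"
    using star_generated_subset[OF assms(2,1)] star_subalgebraD(1)[OF assms(2)] by simp
  moreover have "\<one>\<^bsub>A\<^esub> \<in> star_generated A X"
    by (simp_all add: star_generated_iff star_subalgebraD(2))
  moreover have "a \<oplus>\<^bsub>A\<^esub> b \<in> star_generated A X" "a \<otimes>\<^bsub>A\<^esub> b \<in> star_generated A X"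
    if "a \<in> star_generated A X" "b \<in> star_generated A X" for a b
    using that by (simp_all add: star_generated_iff star_subalgebraD(3,4))
  moreover have "c \<odot>\<^bsub>A\<^esub> a \<in> star_generated A X" "star A a \<in> star_generated A X"
    if "a \<in> star_generated A X" for a c
    using that by (simp_all add: star_generated_iff star_subalgebraD(5,6))
  ultimately show ?thesis by (simp add: star_subalgebra_def)
qed

text \<open>The cofactor formula makes \<open>mon_span n\<close> a star-subalgebra, so generating
  with the star adds nothing to the linear span of monomials in the entries.\<close>

lemma coord_algebra_carrier: "carrier (coord_algebra n) = mon_span n"
proof
  let ?G = "{coord n i j | i j. i < n \<and> j < n}" and ?F = "fun_algebra (SU n)"
  have sub: "star_subalgebra (mon_span n) ?F"
    unfolding star_subalgebra_def fun_algebra_simps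
  proof (intro conjI ballI allI)
    show "mon_span n \<subseteq> extensional (SU n)" using mon_span_extensional by blast
  qed (rule mon_span_const mon_span.add mon_span_mult mon_span.smult mon_span_cnj; assumption)+
  have "coord n i j \<in> mon_span n" if "i < n" "j < n" for i j
    unfolding coord_eq_entry_mon by (rule mon_span.mon) (use that in simp)
  then have G: "?G \<subseteq> mon_span n" by blast
  have carrier: "carrier (coord_algebra n) = star_generated ?F ?G"
    by (simp add: coord_algebra_def)
  show "carrier (coord_algebra n) \<subseteq> mon_span n"
    unfolding carrier by (rule star_generated_subset[OF sub G])
  note D = star_subalgebraD[OF star_subalgebra_star_generated[OF G sub]]
  show "mon_span n \<subseteq> carrier (coord_algebra n)"
  proof
    fix f assume "f \<in> mon_span n"
    then show "f \<in> carrier (coord_algebra n)"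
      unfolding carrier
    proof (induction rule: mon_span.induct)
      case (mon L)
      then show ?case
      proof (induction L)
        case Nil
        show ?case using D(2) by (simp add: entry_mon_def)
      next
        case (Cons ij L)
        obtain i j where ij: "ij = (i, j)" "i < n" "j < n" using Cons.hyps by auto
        have "coord n i j \<in> star_generated ?F ?G"
          by (rule subsetD[OF star_generated_superset]) (use ij in auto)
        from D(4)[OF this Cons.IH] show ?case by (simp add: entry_mon_def coord_def ij)
      qed
    next
      case (add f g)
      from D(3)[OF add.IH] show ?case by simp
    next
      case (smult f c)
      from D(5)[OF smult.IH] show ?case by simp
    qed
  qed
qed

text \<open>Otherwise the simplifier turns the dimension \<open>n - 1\<close> of the weights into \<open>n - Suc 0\<close>.\<close>

declare One_nat_def [simp del]

section \<open>Isotypic components and the deformed product\<close>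

definition bil :: "nat \<Rightarrow> real mat \<Rightarrow> int vec \<Rightarrow> int vec \<Rightarrow> real" where
  "bil m K r r' = (\<Sum>i<m. \<Sum>j<m. real_of_int (r $ i) * K $$ (i, j) * real_of_int (r' $ j))"

text \<open>The angle vector at which the character of weight \<open>r'\<close> takes the value
  \<open>cis (pi * bil m K r r')\<close>; halving converts the 2 pi of characters into the pi of the
  deformation phase.\<close>

definition half_twist :: "nat \<Rightarrow> real mat \<Rightarrow> int vec \<Rightarrow> real vec" where
  "half_twist m K r = vec m (\<lambda>j. (\<Sum>i<m. real_of_int (r $ i) * K $$ (i, j)) / 2)"

fun weight :: "nat \<Rightarrow> (nat \<times> nat) list \<Rightarrow> int vec \<times> int vec" where
  "weight n [] = (0\<^sub>v (n - 1), 0\<^sub>v (n - 1))"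
| "weight n ((i, j) # L) = (wvec n i + fst (weight n L), wvec n j + snd (weight n L))"

locale SU_deformation =
  fixes n :: nat and K :: "real mat"
  assumes n_pos: "n > 0" and K_carrier: "K \<in> carrier_mat (n - 1) (n - 1)"
    and K_antisym: "transpose_mat K = - K"
begin

abbreviation "W \<equiv> weights n"
abbreviation "\<Z> \<equiv> (\<lambda>U\<in>SU n. (0::complex))"
abbreviation "comps \<equiv> isotypic_components n"
abbreviation "dm \<equiv> deform_mult n K"
abbreviation "phase \<equiv> deform_phase K"
abbreviation "\<beta> \<equiv> bil (n - 1) K"

lemma W_iff: "(r, q) \<in> W \<longleftrightarrow> r \<in> carrier_vec (n - 1) \<and> q \<in> carrier_vec (n - 1)"
  by (auto simp: weights_def)

lemma weight_W: "weight n L \<in> W"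
  by (induction L rule: weight.induct) (auto simp: weights_def)

lemma weight_append:
  "weight n (L @ L') = (fst (weight n L) + fst (weight n L'), snd (weight n L) + snd (weight n L'))"
proof (induction L)
  case Nil
  show ?case using weight_W[of L'] by (auto simp: weights_def)
next
  case (Cons a L)
  obtain i j where "a = (i, j)" by force
  then show ?case
    using Cons weight_W[of L] weight_W[of L']
    by (auto simp: weights_def assoc_add_vec[of _ "n - 1"] mem_Times_iff)
qed

section \<open>Decomposition into isotypic components\<close>

lemma isotypic_iff:
  "f \<in> isotypic n (r, q) \<longleftrightarrow> f \<in> mon_span n \<and>
    (\<forall>\<phi>\<in>carrier_vec (n - 1). \<forall>\<psi>\<in>carrier_vec (n - 1). \<forall>U\<in>SU n.
      f (torus_elt n \<phi> * U * torus_elt n \<psi>) = torus_char r \<phi> * torus_char q \<psi> * f U)"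
  by (simp add: isotypic_def coord_algebra_carrier)

lemma translate_SU:
  "\<phi> \<in> carrier_vec (n - 1) \<Longrightarrow> \<psi> \<in> carrier_vec (n - 1) \<Longrightarrow> U \<in> SU n \<Longrightarrow>
    torus_elt n \<phi> * U * torus_elt n \<psi> \<in> SU n"
  by (intro SU_mult torus_elt_SU n_pos)

lemma isotypic_zero: "\<Z> \<in> isotypic n a"
  by (cases a) (simp add: isotypic_iff mon_span_const translate_SU)

lemma isotypic_span: "f \<in> isotypic n a \<Longrightarrow> f \<in> mon_span n"
  by (cases a) (simp add: isotypic_iff)

lemma isotypic_add:
  "f \<in> isotypic n a \<Longrightarrow> g \<in> isotypic n a \<Longrightarrow> (\<lambda>U\<in>SU n. f U + g U) \<in> isotypic n a"
  by (cases a) (simp add: isotypic_iff mon_span.add translate_SU algebra_simps)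

lemma isotypic_smult: "f \<in> isotypic n a \<Longrightarrow> (\<lambda>U\<in>SU n. c * f U) \<in> isotypic n a"
  by (cases a) (simp add: isotypic_iff mon_span.smult translate_SU algebra_simps)

lemma isotypic_cnj:
  "f \<in> isotypic n (r, q) \<Longrightarrow> (r, q) \<in> W \<Longrightarrow> (\<lambda>U\<in>SU n. cnj (f U)) \<in> isotypic n (- r, - q)"
  by (simp add: isotypic_iff mon_span_cnj translate_SU W_iff torus_char_uminus_weight[of _ "n - 1"])

lemma entry_mon_isotypic: "L \<in> idx n \<Longrightarrow> entry_mon n L \<in> isotypic n (weight n L)"
proof -
  assume L: "L \<in> idx n"
  have "(\<Prod>ij\<leftarrow>L. (torus_elt n \<phi> * U * torus_elt n \<psi>) $$ ij) =
      torus_char (fst (weight n L)) \<phi> * torus_char (snd (weight n L)) \<psi> * (\<Prod>ij\<leftarrow>L. U $$ ij)"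
    if \<phi>: "\<phi> \<in> carrier_vec (n - 1)" and \<psi>: "\<psi> \<in> carrier_vec (n - 1)" and U: "U \<in> SU n" for \<phi> \<psi> U
    using L
  proof (induction L)
    case Nil
    then show ?case using \<phi> \<psi> by simp
  next
    case (Cons ij L)
    obtain i j where ij: "ij = (i, j)" "i < n" "j < n" using Cons.hyps by auto
    have w: "fst (weight n L) \<in> carrier_vec (n - 1)" "snd (weight n L) \<in> carrier_vec (n - 1)"
      using weight_W[of L] by (auto simp: weights_def mem_Times_iff)
    show ?case
      using Cons.IH
      by (simp add: ij torus_translate_index[OF SU_carrier[OF U] \<phi> \<psi> ij(2,3)]
          torus_char_add_weight[OF \<phi> wvec_carrier w(1)] torus_char_add_weight[OF \<psi> wvec_carrier w(2)])
  qed
  then show ?thesis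
    by (cases "weight n L") (simp add: isotypic_iff mon_span.mon[OF L, unfolded entry_mon_def] entry_mon_def translate_SU)
qed

text \<open>The predicate under the definite description in \<open>isotypic_components\<close>,
  isolated so that existence and uniqueness can be proved for it.\<close>

definition is_comps :: "(complex mat \<Rightarrow> complex) \<Rightarrow> (int vec \<times> int vec \<Rightarrow> complex mat \<Rightarrow> complex) \<Rightarrow> bool"
  where "is_comps f c \<longleftrightarrow> (\<forall>a\<in>W. c a \<in> isotypic n a) \<and> (\<forall>a. a \<notin> W \<longrightarrow> c a = \<Z>) \<and>
    finite {a. c a \<noteq> \<Z>} \<and> (\<forall>U\<in>SU n. f U = (\<Sum>a | c a \<noteq> \<Z>. c a U))"

lemma sum_supp:
  assumes "finite S" "{a. c a \<noteq> \<Z>} \<subseteq> S" "U \<in> SU n" "\<And>a. c a = \<Z> \<Longrightarrow> h a = 0"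
  shows "(\<Sum>a | c a \<noteq> \<Z>. h a) = (\<Sum>a\<in>S. h a)"
  by (rule sum.mono_neutral_left) (use assms in auto)

lemma is_comps_sum:
  assumes "is_comps f c" "finite S" "{a. c a \<noteq> \<Z>} \<subseteq> S" "U \<in> SU n"
  shows "f U = (\<Sum>a\<in>S. c a U)"
  using assms sum_supp[of S c U "\<lambda>a. c a U"] by (simp add: is_comps_def)

lemma is_compsI:
  assumes "\<And>a. a \<in> W \<Longrightarrow> c a \<in> isotypic n a" "finite S" "S \<subseteq> W" "\<And>a. a \<notin> S \<Longrightarrow> c a = \<Z>"
    "\<And>U. U \<in> SU n \<Longrightarrow> f U = (\<Sum>a\<in>S. c a U)"
  shows "is_comps f c"
proof -
  have S: "{a. c a \<noteq> \<Z>} \<subseteq> S" using assms(4) by blast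
  moreover have "f U = (\<Sum>a | c a \<noteq> \<Z>. c a U)" if "U \<in> SU n" for U
    using assms(5)[OF that] sum_supp[OF assms(2) S that, of "\<lambda>a. c a U"] that by simp
  ultimately show ?thesis
    unfolding is_comps_def using assms(1,3,4) finite_subset[OF S assms(2)] by blast
qed

lemma is_comps_supp: "is_comps f c \<Longrightarrow> finite {a. c a \<noteq> \<Z>} \<and> {a. c a \<noteq> \<Z>} \<subseteq> W"
  by (auto simp: is_comps_def)

lemma is_comps_isotypic: "is_comps f c \<Longrightarrow> c a \<in> isotypic n a"
  unfolding is_comps_def by (metis isotypic_zero)

lemma is_comps_homogeneous:
  assumes "f \<in> isotypic n a" "a \<in> W"
  shows "is_comps f (\<lambda>b. if b = a then f else \<Z>)"
  by (rule is_compsI[of _ "{a}"]) (use assms isotypic_zero in auto)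

lemma is_comps_add:
  assumes "is_comps f c" "is_comps g d"
  shows "is_comps (\<lambda>U\<in>SU n. f U + g U) (\<lambda>a. \<lambda>U\<in>SU n. c a U + d a U)"
proof (rule is_compsI)
  let ?S = "{a. c a \<noteq> \<Z>} \<union> {a. d a \<noteq> \<Z>}"
  show S: "finite ?S" "?S \<subseteq> W" using is_comps_supp[OF assms(1)] is_comps_supp[OF assms(2)] by auto
  show "(\<lambda>U\<in>SU n. c a U + d a U) \<in> isotypic n a" for a
    by (intro isotypic_add is_comps_isotypic[OF assms(1)] is_comps_isotypic[OF assms(2)])
  show "(\<lambda>U\<in>SU n. c a U + d a U) = \<Z>" if "a \<notin> ?S" for a using that by simp
  fix U assume U: "U \<in> SU n"
  have "f U = (\<Sum>a\<in>?S. c a U)" by (rule is_comps_sum[OF assms(1) S(1) _ U]) simp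
  moreover have "g U = (\<Sum>a\<in>?S. d a U)" by (rule is_comps_sum[OF assms(2) S(1) _ U]) simp
  ultimately show "(\<lambda>U\<in>SU n. f U + g U) U = (\<Sum>a\<in>?S. (\<lambda>U\<in>SU n. c a U + d a U) U)"
    using U by (simp add: sum.distrib)
qed

lemma is_comps_smult:
  assumes "is_comps f c"
  shows "is_comps (\<lambda>U\<in>SU n. k * f U) (\<lambda>a. \<lambda>U\<in>SU n. k * c a U)"
proof (rule is_compsI)
  let ?S = "{a. c a \<noteq> \<Z>}"
  show S: "finite ?S" "?S \<subseteq> W" using is_comps_supp[OF assms(1)] by auto
  show "(\<lambda>U\<in>SU n. k * c a U) \<in> isotypic n a" for a
    by (intro isotypic_smult is_comps_isotypic[OF assms(1)])
  show "(\<lambda>U\<in>SU n. k * c a U) = \<Z>" if "a \<notin> ?S" for a using that by simp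
  fix U assume U: "U \<in> SU n"
  have "f U = (\<Sum>a\<in>?S. c a U)" by (rule is_comps_sum[OF assms(1) S(1) _ U]) simp
  then show "(\<lambda>U\<in>SU n. k * f U) U = (\<Sum>a\<in>?S. (\<lambda>U\<in>SU n. k * c a U) U)"
    using U by (simp add: sum_distrib_left)
qed

text \<open>Translating \<open>U\<close> by torus elements multiplies the component of index
  \<open>a\<close> by the character of \<open>a\<close>. The difference of two decompositions is
  thus a vanishing combination of distinct characters of the double torus.\<close>

lemma is_comps_unique:
  assumes c: "is_comps f c" and d: "is_comps f d"
  shows "c = d"
proof (intro ext)
  fix a V
  let ?S = "{a. c a \<noteq> \<Z>} \<union> {a. d a \<noteq> \<Z>}"
  let ?M = "carrier_vec (n - 1) \<times> carrier_vec (n - 1) :: (real vec \<times> real vec) set"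
  let ?\<chi> = "\<lambda>a x. torus_char (fst a) (fst x) * torus_char (snd a) (snd x)"
  have S: "finite ?S" "?S \<subseteq> W" using is_comps_supp[OF c] is_comps_supp[OF d] by auto
  have "c a U = d a U" if U: "U \<in> SU n" for U
  proof (cases "a \<in> ?S")
    case True
    have "c a U - d a U = 0"
    proof (rule characters_independent[where S = ?S and M = ?M and \<chi> = ?\<chi> and c = "\<lambda>a. c a U - d a U"
          and op = "\<lambda>x y. (fst x + fst y, snd x + snd y)"])
      fix b x y assume b: "b \<in> ?S" and x: "x \<in> ?M" and y: "y \<in> ?M"
      have "b \<in> W" using b S by blast
      then show "?\<chi> b (fst x + fst y, snd x + snd y) = ?\<chi> b x * ?\<chi> b y"
        using x y by (auto simp: weights_def torus_char_add[of _ "n - 1"])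
    next
      fix b assume "b \<in> ?S"
      show "\<exists>x\<in>?M. ?\<chi> b x \<noteq> 0" by (rule bexI[of _ "(0\<^sub>v (n - 1), 0\<^sub>v (n - 1))"]) auto
    next
      fix b b' assume b: "b \<in> ?S" "b' \<in> ?S" "b \<noteq> b'"
      have W: "b \<in> W" "b' \<in> W" using b S by blast+
      have z: "torus_char r (0\<^sub>v (n - 1)) = 1" if "r \<in> carrier_vec (n - 1)" for r
        using that by (simp add: torus_char_def)
      show "\<exists>x\<in>?M. ?\<chi> b x \<noteq> ?\<chi> b' x"
      proof (cases "fst b = fst b'")
        case False
        then obtain \<phi> where "\<phi> \<in> carrier_vec (n - 1)" "torus_char (fst b) \<phi> \<noteq> torus_char (fst b') \<phi>"
          using torus_char_separates[of "fst b" "n - 1" "fst b'"] W by (auto simp: weights_def)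
        then show ?thesis
          by (intro bexI[of _ "(\<phi>, 0\<^sub>v (n - 1))"]) (use W z in \<open>auto simp: weights_def\<close>)
      next
        case True
        then have "snd b \<noteq> snd b'" using b by (simp add: prod_eq_iff)
        then obtain \<psi> where "\<psi> \<in> carrier_vec (n - 1)" "torus_char (snd b) \<psi> \<noteq> torus_char (snd b') \<psi>"
          using torus_char_separates[of "snd b" "n - 1" "snd b'"] W by (auto simp: weights_def)
        then show ?thesis
          by (intro bexI[of _ "(0\<^sub>v (n - 1), \<psi>)"]) (use W z in \<open>auto simp: weights_def\<close>)
      qed
    next
      fix x assume x: "x \<in> ?M"
      let ?V = "torus_elt n (fst x) * U * torus_elt n (snd x)"
      have V: "?V \<in> SU n" using x U by (auto intro: translate_SU)
      have tr: "e b ?V = ?\<chi> b x * e b U" if "is_comps f e" for e b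
        using is_comps_isotypic[OF that, of b] x U by (cases b) (auto simp: isotypic_iff)
      have "(\<Sum>b\<in>?S. c b ?V) = (\<Sum>b\<in>?S. d b ?V)"
        using is_comps_sum[OF c S(1) _ V] is_comps_sum[OF d S(1) _ V] by simp
      then have "(\<Sum>b\<in>?S. c b ?V - d b ?V) = 0" by (simp add: sum_subtractf)
      then show "(\<Sum>b\<in>?S. (c b U - d b U) * ?\<chi> b x) = 0"
        unfolding tr[OF c] tr[OF d] by (simp add: algebra_simps)
    qed (use S True in auto)
    then show ?thesis by simp
  next
    case False
    then show ?thesis by simp
  qed
  \<comment> \<open>Equality of functions also concerns arguments outside \<open>SU n\<close>, where
    extensionality fixes the value.\<close>
  moreover have undef: "e a V = undefined" if "is_comps f e" "V \<notin> SU n" for e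
    using mon_span_extensional[OF isotypic_span[OF is_comps_isotypic[OF that(1)]], of a] that(2)
    by (simp add: extensional_def)
  ultimately show "c a V = d a V"
    using undef[OF c] undef[OF d] by (cases "V \<in> SU n") simp_all
qed

text \<open>Monomials are homogeneous, so existence follows by induction over the span; with
  uniqueness this evaluates the definite description.\<close>

lemma is_comps_comps: assumes "f \<in> mon_span n" shows "is_comps f (comps f)"
proof -
  have "\<exists>c. is_comps f c"
    using assms
  proof (induction rule: mon_span.induct)
    case (mon L)
    then show ?case using is_comps_homogeneous[OF entry_mon_isotypic weight_W] by blast
  next
    case (add f g)
    then obtain c d where "is_comps f c" "is_comps g d" by blast
    from is_comps_add[OF this] show ?case by blast
  next
    case (smult f k)
    then obtain c where "is_comps f c" by blast
    from is_comps_smult[OF this] show ?case by blast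
  qed
  then obtain c where c: "is_comps f c" by blast
  have "comps f = (THE c. is_comps f c)"
    unfolding isotypic_components_def is_comps_def coord_algebra_simps ..
  also have "\<dots> = c" by (rule the_equality) (use c is_comps_unique in blast)+
  finally show ?thesis using c by simp
qed

lemma comps_eq: "is_comps f c \<Longrightarrow> f \<in> mon_span n \<Longrightarrow> comps f = c"
  using is_comps_comps is_comps_unique by blast

lemma comps_supp: "f \<in> mon_span n \<Longrightarrow> finite {a. comps f a \<noteq> \<Z>} \<and> {a. comps f a \<noteq> \<Z>} \<subseteq> W"
  using is_comps_supp is_comps_comps by blast

section \<open>Deformation phases as torus translations\<close>

lemma bil_add_left:
  "r \<in> carrier_vec (n - 1) \<Longrightarrow> s \<in> carrier_vec (n - 1) \<Longrightarrow> \<beta> (r + s) r' = \<beta> r r' + \<beta> s r'"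
  by (simp add: bil_def algebra_simps sum.distrib)

lemma bil_add_right:
  "r \<in> carrier_vec (n - 1) \<Longrightarrow> s \<in> carrier_vec (n - 1) \<Longrightarrow> \<beta> r' (r + s) = \<beta> r' r + \<beta> r' s"
  by (simp add: bil_def algebra_simps sum.distrib)

lemma bil_uminus:
  "r \<in> carrier_vec (n - 1) \<Longrightarrow> \<beta> (- r) r' = - \<beta> r r'"
  "r' \<in> carrier_vec (n - 1) \<Longrightarrow> \<beta> r (- r') = - \<beta> r r'"
  by (simp_all add: bil_def sum_negf)

lemma bil_zero: "\<beta> (0\<^sub>v (n - 1)) r = 0" "\<beta> r (0\<^sub>v (n - 1)) = 0"
  by (simp_all add: bil_def)

lemma bil_commute: "\<beta> r r' = - \<beta> r' r"
proof -
  have K: "K $$ (i, j) = - K $$ (j, i)" if "i < n - 1" "j < n - 1" for i j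
  proof -
    have "transpose_mat K $$ (j, i) = (- K) $$ (j, i)" by (simp add: K_antisym)
    then show ?thesis using that K_carrier by simp
  qed
  have "\<beta> r r' = (\<Sum>j<n - 1. \<Sum>i<n - 1. real_of_int (r $ i) * K $$ (i, j) * real_of_int (r' $ j))"
    unfolding bil_def by (rule sum.swap)
  also have "\<dots> = - \<beta> r' r"
    unfolding bil_def sum_negf[symmetric]
  proof (intro sum.cong refl)
    fix i j assume "i \<in> {..<n - 1}" "j \<in> {..<n - 1}"
    then have "K $$ (j, i) = - K $$ (i, j)" by (intro K) simp_all
    then show "real_of_int (r $ j) * K $$ (j, i) * real_of_int (r' $ i)
        = - (real_of_int (r' $ i) * K $$ (i, j) * real_of_int (r $ j))"
      by simp
  qed
  finally show ?thesis .
qed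

lemma scalar_prod_bil:
  assumes "r \<in> carrier_vec (n - 1)" "r' \<in> carrier_vec (n - 1)"
  shows "map_vec real_of_int r \<bullet> (K *\<^sub>v map_vec real_of_int r') = \<beta> r r'"
proof -
  have "(K *\<^sub>v map_vec real_of_int r') $ i = (\<Sum>j<n - 1. K $$ (i, j) * real_of_int (r' $ j))"
    if "i < n - 1" for i
    using that assms K_carrier by (auto simp: scalar_prod_def atLeast0LessThan)
  moreover have "dim_vec (K *\<^sub>v map_vec real_of_int r') = n - 1" using K_carrier by simp
  ultimately show ?thesis
    using assms by (auto simp: scalar_prod_def bil_def atLeast0LessThan sum_distrib_left mult.assoc intro!: sum.cong)
qed

lemma phase_bil:
  "(r, q) \<in> W \<Longrightarrow> (r', q') \<in> W \<Longrightarrow> phase (r, q) (r', q') = cis (pi * (\<beta> r r' - \<beta> q q'))"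
  by (simp add: deform_phase_def W_iff scalar_prod_bil)

lemma half_twist_carrier [simp]: "half_twist m K r \<in> carrier_vec m"
  by (simp add: half_twist_def)

lemma torus_char_half_twist:
  assumes "r' \<in> carrier_vec (n - 1)"
  shows "torus_char r' (half_twist (n - 1) K r) = cis (pi * \<beta> r r')"
    "torus_char r' (- half_twist (n - 1) K r) = cis (- (pi * \<beta> r r'))"
proof -
  have "map_vec real_of_int r' \<bullet> half_twist (n - 1) K r = (\<Sum>j<n - 1. \<Sum>i<n - 1. real_of_int (r $ i) * K $$ (i, j) * real_of_int (r' $ j)) / 2"
    using assms
    by (auto simp: scalar_prod_def half_twist_def atLeast0LessThan sum_divide_distrib sum_distrib_left sum_distrib_right
        ac_simps intro!: sum.cong)
  also have "\<dots> = \<beta> r r' / 2" unfolding bil_def by (subst sum.swap) simp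
  finally have *: "map_vec real_of_int r' \<bullet> half_twist (n - 1) K r = \<beta> r r' / 2" .
  show "torus_char r' (half_twist (n - 1) K r) = cis (pi * \<beta> r r')"
    unfolding torus_char_def * by simp
  have neg: "map_vec real_of_int r' \<bullet> - half_twist (n - 1) K r = - (map_vec real_of_int r' \<bullet> half_twist (n - 1) K r)"
    using assms by (simp add: half_twist_def)
  show "torus_char r' (- half_twist (n - 1) K r) = cis (- (pi * \<beta> r r'))"
    unfolding torus_char_def neg * by simp
qed

text \<open>The opposite sign on the right torus factor reflects the deformation by K on row weights
  and -K on column weights.\<close>

definition twist :: "int vec \<times> int vec \<Rightarrow> complex mat \<Rightarrow> complex mat" where
  "twist a U = torus_elt n (half_twist (n - 1) K (fst a)) * U * torus_elt n (- half_twist (n - 1) K (snd a))"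

lemma twist_SU: "U \<in> SU n \<Longrightarrow> twist a U \<in> SU n"
  unfolding twist_def by (rule translate_SU) auto

lemma twist_index:
  "U \<in> carrier_mat n n \<Longrightarrow> i < n \<Longrightarrow> j < n \<Longrightarrow>
    twist (r, q) U $$ (i, j) = cis (pi * (\<beta> r (wvec n i) - \<beta> q (wvec n j))) * U $$ (i, j)"
  by (simp add: twist_def torus_translate_index torus_char_half_twist cis_mult ring_distribs)

lemma isotypic_twist:
  assumes "a \<in> W" "b \<in> W" "g \<in> isotypic n b" "U \<in> SU n"
  shows "g (twist a U) = phase a b * g U"
proof -
  obtain r q r' q' where ab: "a = (r, q)" "b = (r', q')" by force
  have "g (twist a U) = torus_char r' (half_twist (n - 1) K r) * torus_char q' (- half_twist (n - 1) K q) * g U"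
    using assms(3,4) unfolding ab twist_def isotypic_iff by (simp add: half_twist_carrier)
  then show ?thesis
    using assms(1,2) unfolding ab
    by (simp add: W_iff torus_char_half_twist phase_bil cis_mult ring_distribs)
qed

text \<open>
  Multiplying from the left by a homogeneous element of index \<open>a\<close> amounts to translating the right
  factor by the torus element determined by \<open>a\<close>; this makes the deformed product computable.
\<close>

lemma deform_mult_twist:
  assumes f: "f \<in> mon_span n" and g: "g \<in> mon_span n" and U: "U \<in> SU n"
    and S: "finite S" "{a. comps f a \<noteq> \<Z>} \<subseteq> S"
  shows "dm f g U = (\<Sum>a\<in>S. comps f a U * g (twist a U))"
proof -
  have "dm f g U = (\<Sum>a | comps f a \<noteq> \<Z>. \<Sum>b | comps g b \<noteq> \<Z>. phase a b * comps f a U * comps g b U)"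
    using U by (simp add: deform_mult_def)
  also have "\<dots> = (\<Sum>a | comps f a \<noteq> \<Z>. comps f a U * g (twist a U))"
  proof (rule sum.cong[OF refl])
    fix a assume "a \<in> {a. comps f a \<noteq> \<Z>}"
    then have a: "a \<in> W" using comps_supp[OF f] by blast
    have "(\<Sum>b | comps g b \<noteq> \<Z>. phase a b * comps f a U * comps g b U)
      = (\<Sum>b | comps g b \<noteq> \<Z>. comps f a U * comps g b (twist a U))"
    proof (rule sum.cong[OF refl])
      fix b assume "b \<in> {b. comps g b \<noteq> \<Z>}"
      then have "b \<in> W" using comps_supp[OF g] by blast
      from isotypic_twist[OF a this is_comps_isotypic[OF is_comps_comps[OF g]] U]
      show "phase a b * comps f a U * comps g b U = comps f a U * comps g b (twist a U)" by simp
    qed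
    also have "\<dots> = comps f a U * g (twist a U)"
      using is_comps_sum[OF is_comps_comps[OF g] _ order_refl twist_SU[OF U], of a] comps_supp[OF g]
      by (simp add: sum_distrib_left)
    finally show "(\<Sum>b | comps g b \<noteq> \<Z>. phase a b * comps f a U * comps g b U) = comps f a U * g (twist a U)" .
  qed
  also have "\<dots> = (\<Sum>a\<in>S. comps f a U * g (twist a U))"
    by (rule sum_supp[OF S U]) (use U in simp)
  finally show ?thesis .
qed

section \<open>Algebra laws of the deformed product\<close>

lemma dm_extensional [simp]: "dm f g \<in> extensional (SU n)"
  by (simp add: deform_mult_def)

lemma SU_ext: "f \<in> extensional (SU n) \<Longrightarrow> g \<in> extensional (SU n) \<Longrightarrow> (\<And>U. U \<in> SU n \<Longrightarrow> f U = g U) \<Longrightarrow> f = g"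
  by (rule extensionalityI)

lemma dm_homogeneous:
  assumes "f \<in> isotypic n a" "a \<in> W" "g \<in> mon_span n" "U \<in> SU n"
  shows "dm f g U = f U * g (twist a U)"
proof -
  have f: "f \<in> mon_span n" using assms(1) by (rule isotypic_span)
  have "comps f = (\<lambda>b. if b = a then f else \<Z>)"
    by (rule comps_eq[OF is_comps_homogeneous[OF assms(1,2)] f])
  moreover from this have "{b. comps f b \<noteq> \<Z>} \<subseteq> {a}" by auto
  ultimately show ?thesis
    using deform_mult_twist[OF f assms(3,4), of "{a}"] by simp
qed

lemma dm_homogeneous2:
  assumes "f \<in> isotypic n a" "a \<in> W" "g \<in> isotypic n b" "b \<in> W"
  shows "dm f g = (\<lambda>U\<in>SU n. phase a b * (f U * g U))"
proof (rule SU_ext)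
  fix U assume U: "U \<in> SU n"
  show "dm f g U = (\<lambda>U\<in>SU n. phase a b * (f U * g U)) U"
    using dm_homogeneous[OF assms(1,2) isotypic_span[OF assms(3)] U] isotypic_twist[OF assms(2,4,3) U] U
    by simp
qed auto

lemma dm_add_left:
  assumes f: "f \<in> mon_span n" "f' \<in> mon_span n" and g: "g \<in> mon_span n"
  shows "dm (\<lambda>U\<in>SU n. f U + f' U) g = (\<lambda>U\<in>SU n. dm f g U + dm f' g U)"
proof (rule SU_ext)
  fix U assume U: "U \<in> SU n"
  let ?S = "{a. comps f a \<noteq> \<Z>} \<union> {a. comps f' a \<noteq> \<Z>}"
  have S: "finite ?S" using comps_supp f by blast
  have c: "comps (\<lambda>U\<in>SU n. f U + f' U) = (\<lambda>a. \<lambda>U\<in>SU n. comps f a U + comps f' a U)"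
    by (intro comps_eq is_comps_add is_comps_comps f mon_span.add)
  have "dm (\<lambda>U\<in>SU n. f U + f' U) g U = (\<Sum>a\<in>?S. comps (\<lambda>U\<in>SU n. f U + f' U) a U * g (twist a U))"
    by (rule deform_mult_twist[OF mon_span.add[OF f] g U S]) (auto simp: c)
  moreover have "dm f g U = (\<Sum>a\<in>?S. comps f a U * g (twist a U))"
    by (rule deform_mult_twist[OF f(1) g U S]) auto
  moreover have "dm f' g U = (\<Sum>a\<in>?S. comps f' a U * g (twist a U))"
    by (rule deform_mult_twist[OF f(2) g U S]) auto
  ultimately show "dm (\<lambda>U\<in>SU n. f U + f' U) g U = (\<lambda>U\<in>SU n. dm f g U + dm f' g U) U"
    using U by (simp add: c sum.distrib ring_distribs)
qed auto

lemma dm_smult_left: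
  assumes f: "f \<in> mon_span n" and g: "g \<in> mon_span n"
  shows "dm (\<lambda>U\<in>SU n. k * f U) g = (\<lambda>U\<in>SU n. k * dm f g U)"
proof (rule SU_ext)
  fix U assume U: "U \<in> SU n"
  let ?S = "{a. comps f a \<noteq> \<Z>}"
  have S: "finite ?S" using comps_supp f by blast
  have c: "comps (\<lambda>U\<in>SU n. k * f U) = (\<lambda>a. \<lambda>U\<in>SU n. k * comps f a U)"
    by (intro comps_eq is_comps_smult is_comps_comps f mon_span.smult)
  have "dm (\<lambda>U\<in>SU n. k * f U) g U = (\<Sum>a\<in>?S. comps (\<lambda>U\<in>SU n. k * f U) a U * g (twist a U))"
    by (rule deform_mult_twist[OF mon_span.smult[OF f] g U S]) (auto simp: c)
  moreover have "dm f g U = (\<Sum>a\<in>?S. comps f a U * g (twist a U))"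
    by (rule deform_mult_twist[OF f(1) g U S]) auto
  ultimately show "dm (\<lambda>U\<in>SU n. k * f U) g U = (\<lambda>U\<in>SU n. k * dm f g U) U"
    using U by (simp add: c sum_distrib_left mult.assoc)
qed auto

lemma dm_add_right:
  assumes f: "f \<in> mon_span n" and g: "g \<in> mon_span n" "g' \<in> mon_span n"
  shows "dm f (\<lambda>U\<in>SU n. g U + g' U) = (\<lambda>U\<in>SU n. dm f g U + dm f g' U)"
  using comps_supp[OF f]
  by (intro SU_ext) (auto simp: deform_mult_twist[OF f _ _ _ order_refl] g mon_span.add twist_SU
      sum.distrib ring_distribs)

lemma dm_smult_right:
  assumes f: "f \<in> mon_span n" and g: "g \<in> mon_span n"
  shows "dm f (\<lambda>U\<in>SU n. k * g U) = (\<lambda>U\<in>SU n. k * dm f g U)"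
  using comps_supp[OF f]
  by (intro SU_ext) (auto simp: deform_mult_twist[OF f _ _ _ order_refl] g mon_span.smult twist_SU
      sum_distrib_left mult.left_commute)

lemma dm_entry_mon:
  assumes "L \<in> idx n" "L' \<in> idx n"
  shows "dm (entry_mon n L) (entry_mon n L') = (\<lambda>U\<in>SU n. phase (weight n L) (weight n L') * entry_mon n (L @ L') U)"
  by (simp add: dm_homogeneous2[OF entry_mon_isotypic[OF assms(1)] weight_W entry_mon_isotypic[OF assms(2)] weight_W]
      entry_mon_append)

lemma dm_closed: assumes "f \<in> mon_span n" "g \<in> mon_span n" shows "dm f g \<in> mon_span n"
  using assms
proof (induction rule: mon_span.induct)
  case (mon L)
  from \<open>g \<in> mon_span n\<close> show ?case
  proof (induction rule: mon_span.induct)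
    case (mon L')
    have "L @ L' \<in> idx n" using \<open>L \<in> idx n\<close> mon by simp
    from mon_span.smult[OF mon_span.mon[OF this]] show ?case
      by (simp add: dm_entry_mon \<open>L \<in> idx n\<close> mon)
  next
    case (add f g)
    then show ?case by (simp add: dm_add_right mon_span.mon \<open>L \<in> idx n\<close> mon_span.add)
  next
    case (smult f c)
    then show ?case by (simp add: dm_smult_right mon_span.mon \<open>L \<in> idx n\<close> mon_span.smult)
  qed
next
  case (add f g)
  then show ?case by (simp add: dm_add_left mon_span.add)
next
  case (smult f c)
  then show ?case by (simp add: dm_smult_left mon_span.smult)
qed

lemma phase_add_left:
  "a \<in> W \<Longrightarrow> a' \<in> W \<Longrightarrow> b \<in> W \<Longrightarrow>
    phase (fst a + fst a', snd a + snd a') b = phase a b * phase a' b"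
  by (cases a; cases a'; cases b)
    (simp add: phase_bil W_iff bil_add_left cis_mult algebra_simps)

lemma phase_add_right:
  "a \<in> W \<Longrightarrow> a' \<in> W \<Longrightarrow> b \<in> W \<Longrightarrow>
    phase b (fst a + fst a', snd a + snd a') = phase b a * phase b a'"
  by (cases a; cases a'; cases b)
    (simp add: phase_bil W_iff bil_add_right cis_mult algebra_simps)

lemma phase_uminus_commute:
  "(r, q) \<in> W \<Longrightarrow> (r', q') \<in> W \<Longrightarrow> phase (- r', - q') (- r, - q) = cnj (phase (r, q) (r', q'))"
  by (simp add: phase_bil W_iff bil_uminus bil_commute[of r'] bil_commute[of q'] cis_cnj algebra_simps)

text \<open>By linearity in each argument it suffices to treat monomials. There the phase is a
  bicharacter of the weights, so both bracketings carry the product of the phases of the three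
  pairs.\<close>

lemma dm_assoc:
  assumes f: "f \<in> mon_span n" and g: "g \<in> mon_span n" and h: "h \<in> mon_span n"
  shows "dm (dm f g) h = dm f (dm g h)"
  using f
proof (induction rule: mon_span.induct)
  case (mon L)
  note L = mon mon_span.mon[OF mon]
  show ?case using g
  proof (induction rule: mon_span.induct)
    case (mon L')
    note L' = mon mon_span.mon[OF mon]
    show ?case using h
    proof (induction rule: mon_span.induct)
      case (mon L'')
      note L'' = mon mon_span.mon[OF mon]
      have app: "L @ L' \<in> idx n" "L' @ L'' \<in> idx n" using L L' L'' by auto
      show ?case
        by (simp add: dm_entry_mon[OF L(1) L'(1)] dm_entry_mon[OF L'(1) L''(1)]
            dm_smult_left[OF mon_span.mon[OF app(1)] L''(2)] dm_smult_right[OF L(2) mon_span.mon[OF app(2)]]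
            dm_entry_mon[OF app(1) L''(1)] dm_entry_mon[OF L(1) app(2)] weight_append[of L L'] weight_append[of L' L'']
            phase_add_left weight_W phase_add_right) (simp add: ac_simps)
    next
      case (add f g)
      then show ?case by (simp add: dm_add_right dm_closed mon_span.add L(2) L'(2))
    next
      case (smult f c)
      then show ?case by (simp add: dm_smult_right dm_closed mon_span.smult L(2) L'(2))
    qed
  next
    case (add f g)
    then show ?case by (simp add: dm_add_right dm_add_left dm_closed mon_span.add L(2) h)
  next
    case (smult f c)
    then show ?case by (simp add: dm_smult_right dm_smult_left dm_closed mon_span.smult L(2) h)
  qed
next
  case (add f g)
  then show ?case by (simp add: dm_add_left dm_closed mon_span.add g h)
next
  case (smult f c)
  then show ?case by (simp add: dm_smult_left dm_closed mon_span.smult g h)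
qed

lemma one_isotypic: "(\<lambda>U\<in>SU n. 1) \<in> isotypic n (0\<^sub>v (n - 1), 0\<^sub>v (n - 1))"
  using entry_mon_isotypic[of "[]"] by (simp add: entry_mon_def)

lemma zero_W: "(0\<^sub>v (n - 1), 0\<^sub>v (n - 1)) \<in> W"
  by (simp add: W_iff)

lemma dm_one_left: assumes "f \<in> mon_span n" shows "dm (\<lambda>U\<in>SU n. 1) f = f"
proof (rule SU_ext)
  fix U assume U: "U \<in> SU n"
  have "twist (0\<^sub>v (n - 1), 0\<^sub>v (n - 1)) U = U"
  proof (rule eq_matI)
    fix i j assume "i < dim_row U" "j < dim_col U"
    then show "twist (0\<^sub>v (n - 1), 0\<^sub>v (n - 1)) U $$ (i, j) = U $$ (i, j)"
      using SU_carrier[OF U] by (auto simp: twist_index bil_zero)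
  qed (use SU_carrier[OF U] SU_carrier[OF twist_SU[OF U]] in auto)
  then show "dm (\<lambda>U\<in>SU n. 1) f U = f U"
    using dm_homogeneous[OF one_isotypic zero_W assms U] U by simp
qed (use assms mon_span_extensional in auto)

lemma dm_one_right: assumes "f \<in> mon_span n" shows "dm f (\<lambda>U\<in>SU n. 1) = f"
  using assms
proof (induction rule: mon_span.induct)
  case (mon L)
  have "phase (weight n L) (0\<^sub>v (n - 1), 0\<^sub>v (n - 1)) = 1"
    using weight_W[of L] by (cases "weight n L") (simp add: phase_bil zero_W bil_zero)
  then show ?case
    using dm_homogeneous2[OF entry_mon_isotypic[OF mon] weight_W one_isotypic zero_W]
    by (simp add: entry_mon_def)
next
  case (add f g)
  then show ?case by (simp add: dm_add_left mon_span_const)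
next
  case (smult f c)
  then show ?case by (simp add: dm_smult_left mon_span_const)
qed

text \<open>Conjugation negates weights, and antisymmetry of \<open>K\<close> turns the phase of the
  swapped, negated pair into the conjugate phase. This makes the undeformed star an
  anti-automorphism of the deformed product.\<close>

lemma dm_cnj:
  assumes f: "f \<in> mon_span n" and g: "g \<in> mon_span n"
  shows "(\<lambda>U\<in>SU n. cnj (dm f g U)) = dm (\<lambda>U\<in>SU n. cnj (g U)) (\<lambda>U\<in>SU n. cnj (f U))"
  using f
proof (induction rule: mon_span.induct)
  case (mon L)
  note L = mon mon_span.mon[OF mon] mon_span_cnj[OF mon_span.mon[OF mon]]
  show ?case using g
  proof (induction rule: mon_span.induct)
    case (mon L')
    note iso = entry_mon_isotypic[OF L(1)] entry_mon_isotypic[OF mon]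
    obtain r q r' q' where w: "weight n L = (r, q)" "weight n L' = (r', q')" by force
    then have W: "(r, q) \<in> W" "(r', q') \<in> W" using weight_W[of L] weight_W[of L'] by auto
    have W': "(- r, - q) \<in> W" "(- r', - q') \<in> W" using W by (auto simp: W_iff)
    show ?case
      unfolding dm_homogeneous2[OF iso(1) weight_W iso(2) weight_W]
        dm_homogeneous2[OF isotypic_cnj[OF iso(2)[unfolded w] W(2)] W'(2) isotypic_cnj[OF iso(1)[unfolded w] W(1)] W'(1)]
        phase_uminus_commute[OF W] w
      by (simp add: mult.commute)
  next
    case (add f g)
    have "dm (\<lambda>U\<in>SU n. cnj ((\<lambda>U\<in>SU n. f U + g U) U)) (\<lambda>U\<in>SU n. cnj (entry_mon n L U))
      = dm (\<lambda>U\<in>SU n. (\<lambda>U\<in>SU n. cnj (f U)) U + (\<lambda>U\<in>SU n. cnj (g U)) U) (\<lambda>U\<in>SU n. cnj (entry_mon n L U))"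
      by simp
    also have "\<dots> = (\<lambda>U\<in>SU n. dm (\<lambda>U\<in>SU n. cnj (f U)) (\<lambda>U\<in>SU n. cnj (entry_mon n L U)) U
        + dm (\<lambda>U\<in>SU n. cnj (g U)) (\<lambda>U\<in>SU n. cnj (entry_mon n L U)) U)"
      by (rule dm_add_left) (use add L mon_span_cnj in auto)
    also have "\<dots> = (\<lambda>U\<in>SU n. cnj (dm (entry_mon n L) (\<lambda>U\<in>SU n. f U + g U) U))"
      unfolding add.IH[symmetric] dm_add_right[OF L(2) add.hyps] by simp
    finally show ?case by simp
  next
    case (smult f c)
    have "dm (\<lambda>U\<in>SU n. cnj ((\<lambda>U\<in>SU n. c * f U) U)) (\<lambda>U\<in>SU n. cnj (entry_mon n L U))
      = dm (\<lambda>U\<in>SU n. cnj c * (\<lambda>U\<in>SU n. cnj (f U)) U) (\<lambda>U\<in>SU n. cnj (entry_mon n L U))"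
      by simp
    also have "\<dots> = (\<lambda>U\<in>SU n. cnj c * dm (\<lambda>U\<in>SU n. cnj (f U)) (\<lambda>U\<in>SU n. cnj (entry_mon n L U)) U)"
      by (rule dm_smult_left) (use smult L mon_span_cnj in auto)
    also have "\<dots> = (\<lambda>U\<in>SU n. cnj (dm (entry_mon n L) (\<lambda>U\<in>SU n. c * f U) U))"
      unfolding smult.IH[symmetric] dm_smult_right[OF L(2) smult.hyps] by simp
    finally show ?case by simp
  qed
next
  case (add f f')
  note G = mon_span_cnj[OF g]
  have "dm (\<lambda>U\<in>SU n. cnj (g U)) (\<lambda>U\<in>SU n. cnj ((\<lambda>U\<in>SU n. f U + f' U) U))
    = dm (\<lambda>U\<in>SU n. cnj (g U)) (\<lambda>U\<in>SU n. (\<lambda>U\<in>SU n. cnj (f U)) U + (\<lambda>U\<in>SU n. cnj (f' U)) U)"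
    by simp
  also have "\<dots> = (\<lambda>U\<in>SU n. dm (\<lambda>U\<in>SU n. cnj (g U)) (\<lambda>U\<in>SU n. cnj (f U)) U
      + dm (\<lambda>U\<in>SU n. cnj (g U)) (\<lambda>U\<in>SU n. cnj (f' U)) U)"
    by (rule dm_add_right) (use add G mon_span_cnj in auto)
  also have "\<dots> = (\<lambda>U\<in>SU n. cnj (dm (\<lambda>U\<in>SU n. f U + f' U) g U))"
    unfolding add.IH[symmetric] dm_add_left[OF add.hyps g] by simp
  finally show ?case by simp
next
  case (smult f c)
  note G = mon_span_cnj[OF g]
  have "dm (\<lambda>U\<in>SU n. cnj (g U)) (\<lambda>U\<in>SU n. cnj ((\<lambda>U\<in>SU n. c * f U) U))
    = dm (\<lambda>U\<in>SU n. cnj (g U)) (\<lambda>U\<in>SU n. cnj c * (\<lambda>U\<in>SU n. cnj (f U)) U)"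
    by simp
  also have "\<dots> = (\<lambda>U\<in>SU n. cnj c * dm (\<lambda>U\<in>SU n. cnj (g U)) (\<lambda>U\<in>SU n. cnj (f U)) U)"
    by (rule dm_smult_right) (use smult G mon_span_cnj in auto)
  also have "\<dots> = (\<lambda>U\<in>SU n. cnj (dm (\<lambda>U\<in>SU n. c * f U) g U))"
    unfolding smult.IH[symmetric] dm_smult_left[OF smult.hyps g] by simp
  finally show ?case by simp
qed

abbreviation "D \<equiv> deformed_SU n K"

lemma deformed_SU_simps [simp]:
  "carrier D = mon_span n"
  "f \<otimes>\<^bsub>D\<^esub> g = dm f g"
  "\<one>\<^bsub>D\<^esub> = (\<lambda>x\<in>SU n. 1)"
  "\<zero>\<^bsub>D\<^esub> = (\<lambda>x\<in>SU n. 0)"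
  "f \<oplus>\<^bsub>D\<^esub> g = (\<lambda>x\<in>SU n. f x + g x)"
  "c \<odot>\<^bsub>D\<^esub> f = (\<lambda>x\<in>SU n. c * f x)"
  "star D f = (\<lambda>x\<in>SU n. cnj (f x))"
  using coord_algebra_carrier coord_algebra_simps by (simp_all add: deformed_SU_def)

sublocale D: complex_algebra D
proof (intro complex_algebra.intro complex_algebra_axioms.intro)
  show "ring D"
  proof (rule ringI)
    show "abelian_group D"
    proof (rule abelian_groupI)
      fix f assume f: "f \<in> carrier D"
      show "\<exists>g\<in>carrier D. g \<oplus>\<^bsub>D\<^esub> f = \<zero>\<^bsub>D\<^esub>"
        by (rule bexI[of _ "\<lambda>U\<in>SU n. - 1 * f U"]) (use f mon_span.smult[of f n "- 1"] in simp_all)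
      show "\<zero>\<^bsub>D\<^esub> \<oplus>\<^bsub>D\<^esub> f = f"
        by (rule SU_ext) (use f mon_span_extensional in auto)
    qed (simp_all add: mon_span.add mon_span_const ac_simps)
    show "Group.monoid D"
      by (rule monoidI) (simp_all add: dm_closed dm_assoc mon_span_const dm_one_left dm_one_right)
  qed (simp_all add: dm_add_left dm_add_right)
qed (simp_all add: mon_span.smult dm_smult_left dm_smult_right)

end

lemma (in abelian_monoid) additive_finsum:
  fixes g :: "'a \<Rightarrow> complex"
  assumes "\<And>x y. x \<in> carrier G \<Longrightarrow> y \<in> carrier G \<Longrightarrow> g (x \<oplus> y) = g x + g y" "g \<zero> = 0"
    and "finite I" "\<And>i. i \<in> I \<Longrightarrow> f i \<in> carrier G"
  shows "g (finsum G f I) = (\<Sum>i\<in>I. g (f i))"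
  using assms(3,4)
proof (induction I rule: finite_induct)
  case (insert i I)
  then have "finsum G f I \<in> carrier G" by (intro finsum_closed) auto
  then show ?case using insert assms(1) by (simp add: Pi_def)
qed (simp add: assms(2))

context tensor_algebras
begin

lemma ev_add:
  assumes "bilinear_form A B \<beta>" "t \<in> carrier (tensor A B)" "t' \<in> carrier (tensor A B)"
  shows "ev \<beta> (t \<oplus>\<^bsub>tensor A B\<^esub> t') = ev \<beta> t + ev \<beta> t'"
proof -
  obtain p q where p: "p \<in> carrier F" "t = J +>\<^bsub>F\<^esub> p" and q: "q \<in> carrier F" "t' = J +>\<^bsub>F\<^esub> q"
    using assms tensor_carrierE by metis
  have "ev \<beta> (J +>\<^bsub>F\<^esub> (p \<oplus>\<^bsub>F\<^esub> q)) = lin_ext \<beta> (p \<oplus>\<^bsub>F\<^esub> q)"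
    by (rule ev_coset[OF assms(1)]) (use p q in simp)
  also have "\<dots> = lin_ext \<beta> p + lin_ext \<beta> q"
    using p q by (simp add: monoid_algebra_simps(4) lin_ext_add finite_supp)
  finally show ?thesis using p q by (simp add: coset_add ev_coset[OF assms(1)])
qed

lemma ev_smult:
  assumes "bilinear_form A B \<beta>" "t \<in> carrier (tensor A B)"
  shows "ev \<beta> (c \<odot>\<^bsub>tensor A B\<^esub> t) = c * ev \<beta> t"
proof -
  obtain p where p: "p \<in> carrier F" "t = J +>\<^bsub>F\<^esub> p" using assms tensor_carrierE by metis
  have "ev \<beta> (J +>\<^bsub>F\<^esub> (c \<odot>\<^bsub>F\<^esub> p)) = lin_ext \<beta> (c \<odot>\<^bsub>F\<^esub> p)"
    by (rule ev_coset[OF assms(1)]) (use p smult_F_closed in simp)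
  then show ?thesis
    using p by (simp add: coset_smult ev_coset[OF assms(1)]) (simp add: monoid_algebra_simps(5) lin_ext_smult)
qed

lemma ev_zero: "bilinear_form A B \<beta> \<Longrightarrow> ev \<beta> \<zero>\<^bsub>tensor A B\<^esub> = 0"
  using ev_add[of \<beta> "\<zero>\<^bsub>tensor A B\<^esub>" "\<zero>\<^bsub>tensor A B\<^esub>"] by simp

lemma pure_closed: "a \<in> carrier A \<Longrightarrow> b \<in> carrier B \<Longrightarrow> pure_tensor A B a b \<in> carrier (tensor A B)"
  unfolding pure_tensor_def by (rule coset_closed) simp

lemma ev_pure:
  "bilinear_form A B \<beta> \<Longrightarrow> a \<in> carrier A \<Longrightarrow> b \<in> carrier B \<Longrightarrow> ev \<beta> (pure_tensor A B a b) = \<beta> (a, b)"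
  unfolding pure_tensor_def by (simp add: ev_coset)

lemma tensor_one: "\<one>\<^bsub>tensor A B\<^esub> = pure_tensor A B \<one>\<^bsub>A\<^esub> \<one>\<^bsub>B\<^esub>"
  by (simp add: tensor_simps FactRing_def pure_tensor_def monoid_algebra_simps(2))

text \<open>Left multiplication by a pure tensor pulls \<open>\<beta>\<close> back to another form.
  In the application \<open>\<gamma>\<close> evaluates at a twisted pair of points, and
  \<open>c\<close> is the value of the pure tensor at the original pair.\<close>

lemma ev_pure_mult:
  assumes \<beta>: "bilinear_form A B \<beta>" and \<gamma>: "bilinear_form A B \<gamma>"
    and ab: "a \<in> carrier A" "b \<in> carrier B" and t: "t \<in> carrier (tensor A B)"
    and eq: "\<And>a' b'. a' \<in> carrier A \<Longrightarrow> b' \<in> carrier B \<Longrightarrow> \<beta> (a \<otimes>\<^bsub>A\<^esub> a', b \<otimes>\<^bsub>B\<^esub> b') = c * \<gamma> (a', b')"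
  shows "ev \<beta> (pure_tensor A B a b \<otimes>\<^bsub>tensor A B\<^esub> t) = c * ev \<gamma> t"
proof -
  obtain p where p: "p \<in> carrier F" "t = J +>\<^bsub>F\<^esub> p" using t tensor_carrierE by metis
  have "ev \<beta> (pure_tensor A B a b \<otimes>\<^bsub>tensor A B\<^esub> t) = ev \<beta> (J +>\<^bsub>F\<^esub> (basis_elt (a, b) \<otimes>\<^bsub>F\<^esub> p))"
    using p ab by (simp add: pure_tensor_def coset_mult)
  also have "\<dots> = lin_ext \<beta> (basis_elt (a, b) \<otimes>\<^bsub>F\<^esub> p)"
    by (rule ev_coset[OF \<beta>]) (use p ab in simp)
  also have "\<dots> = lin_ext (\<lambda>z. \<beta> ((a, b) \<otimes>\<^bsub>A \<times>\<times> B\<^esub> z)) p"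
    using lin_ext_mult[OF finite_supp[of "basis_elt (a, b)"] finite_supp[OF p(1)]] ab by simp
  also have "\<dots> = lin_ext (\<lambda>z. c * \<gamma> z) p"
    by (rule lin_ext_cong) (use p(1) eq in \<open>auto simp: monoid_algebra_simps(1)\<close>)
  also have "\<dots> = c * ev \<gamma> t" using p \<gamma> by (simp add: lin_ext_beta_smult ev_coset)
  finally show ?thesis .
qed

end

section \<open>The action and its fixed points\<close>

text \<open>
  The common value of \<open>w\<^sub>i\<^sup>T K w\<^sub>j\<close> for the two deformation matrices; it vanishes if \<open>i = 3\<close> or \<open>j = 3\<close>.
\<close>

definition \<sigma> :: "real \<Rightarrow> nat \<Rightarrow> nat \<Rightarrow> real" where
  "\<sigma> \<theta> i j = (if (i, j) \<in> {(0, 1), (1, 2), (2, 0)} then \<theta>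
    else if (i, j) \<in> {(1, 0), (2, 1), (0, 2)} then - \<theta> else 0)"

definition block_embed :: "complex mat \<Rightarrow> complex mat" where
  "block_embed h = four_block_mat h (0\<^sub>m 3 1) (0\<^sub>m 1 3) (1\<^sub>m 1)"

lemma block_embed_carrier: "h \<in> carrier_mat 3 3 \<Longrightarrow> block_embed h \<in> carrier_mat 4 4"
  unfolding block_embed_def by (rule carrier_matI) auto

lemma block_embed_index:
  assumes "h \<in> carrier_mat 3 3" "i < 4" "j < 4"
  shows "block_embed h $$ (i, j) = (if i < 3 \<and> j < 3 then h $$ (i, j) else if i = j then 1 else 0)"
  using assms by (auto simp: block_embed_def)

lemma block_embed_mult_index:
  assumes h: "h \<in> carrier_mat 3 3" and U: "U \<in> carrier_mat 4 4" and ij: "i < 4" "j < 4"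
  shows "(block_embed h * U) $$ (i, j) = (if i < 3 then \<Sum>k<3. h $$ (i, k) * U $$ (k, j) else U $$ (i, j))"
proof -
  have "(block_embed h * U) $$ (i, j) = (\<Sum>k<4. block_embed h $$ (i, k) * U $$ (k, j))"
    by (rule mat_mult_index[OF block_embed_carrier[OF h] U ij])
  also have "\<dots> = (\<Sum>k<3. block_embed h $$ (i, k) * U $$ (k, j)) + block_embed h $$ (i, 3) * U $$ (3, j)"
    using sum.lessThan_Suc[of "\<lambda>k. block_embed h $$ (i, k) * U $$ (k, j)" 3] by simp
  also have "\<dots> = (if i < 3 then \<Sum>k<3. h $$ (i, k) * U $$ (k, j) else U $$ (i, j))"
  proof (cases "i < 3")
    case False
    then have "i = 3" using ij by simp
    then show ?thesis by (simp add: block_embed_index[OF h])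
  qed (simp add: block_embed_index[OF h])
  finally show ?thesis .
qed

lemma block_embed_SU: assumes "h \<in> SU 3" shows "block_embed h \<in> SU 4"
proof -
  have h: "h \<in> carrier_mat 3 3" using assms by (rule SU_carrier)
  have "det (block_embed h) = 1"
    unfolding block_embed_def using assms
    by (subst det_four_block_mat_lower_left_zero[of _ 3 _ 1]) (auto simp: SU_iff)
  moreover have "(\<Sum>k<4. block_embed h $$ (i, k) * cnj (block_embed h $$ (j, k))) = (if i = j then 1 else 0)"
    if ij: "i < 4" "j < 4" for i j
  proof -
    have "(\<Sum>k<4. block_embed h $$ (i, k) * cnj (block_embed h $$ (j, k)))
      = (\<Sum>k<3. block_embed h $$ (i, k) * cnj (block_embed h $$ (j, k)))
        + block_embed h $$ (i, 3) * cnj (block_embed h $$ (j, 3))"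
      using sum.lessThan_Suc[of "\<lambda>k. block_embed h $$ (i, k) * cnj (block_embed h $$ (j, k))" 3] by simp
    also have "\<dots> = (if i = j then 1 else 0)"
    proof (cases "i < 3 \<and> j < 3")
      case True
      then show ?thesis using assms by (auto simp: SU_iff block_embed_index[OF h])
    next
      case False
      then show ?thesis using ij by (auto simp: block_embed_index[OF h] not_less intro!: sum.neutral)
    qed
    finally show ?thesis .
  qed
  ultimately show ?thesis using block_embed_carrier[OF h] by (simp add: SU_iff)
qed

lemma (in SU_deformation) wvec_W: "(wvec n k, wvec n l) \<in> W"
  by (simp add: W_iff)

locale SU3_action =
  fixes \<theta> :: real and \<Lambda> :: "real mat"
    and \<rho> :: "(complex mat \<Rightarrow> complex)
      \<Rightarrow> ((complex mat \<Rightarrow> complex) \<times> (complex mat \<Rightarrow> complex) \<Rightarrow> complex) set"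
  assumes \<Lambda>_carrier: "\<Lambda> \<in> carrier_mat 3 3" and \<Lambda>_antisym: "transpose_mat \<Lambda> = - \<Lambda>"
    and \<Lambda>_entries: "\<theta> = \<Lambda> $$ (0, 1)" "\<theta> = - \<Lambda> $$ (0, 2)" "\<theta> = \<Lambda> $$ (1, 2)"
    and action: "is_action (SU3 \<theta>) (SU3_comult \<theta>) (SU_counit 3) (SU4 \<Lambda>) \<rho>"
    and \<rho>_upper: "\<And>k l. k < 3 \<Longrightarrow> l < 4 \<Longrightarrow> \<rho> (coord 4 k l) =
      (\<Oplus>\<^bsub>tensor (SU3 \<theta>) (SU4 \<Lambda>)\<^esub>\<alpha>\<in>{..<3}. pure_tensor (SU3 \<theta>) (SU4 \<Lambda>) (coord 3 k \<alpha>) (coord 4 \<alpha> l))"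
    and \<rho>_last: "\<And>l. l < 4 \<Longrightarrow> \<rho> (coord 4 3 l) = pure_tensor (SU3 \<theta>) (SU4 \<Lambda>) \<one>\<^bsub>SU3 \<theta>\<^esub> (coord 4 3 l)"
begin

section \<open>The two deformation matrices and their twists\<close>

abbreviation "K3 \<equiv> mat_of_rows_list 2 [[0, \<theta>], [- \<theta>, 0]]"

lemma \<Lambda>_values:
  "\<Lambda> $$ (0, 0) = 0" "\<Lambda> $$ (0, 1) = \<theta>" "\<Lambda> $$ (0, 2) = - \<theta>"
  "\<Lambda> $$ (1, 0) = - \<theta>" "\<Lambda> $$ (1, 1) = 0" "\<Lambda> $$ (1, 2) = \<theta>"
  "\<Lambda> $$ (2, 0) = \<theta>" "\<Lambda> $$ (2, 1) = - \<theta>" "\<Lambda> $$ (2, 2) = 0"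
proof -
  have "\<Lambda> $$ (j, i) = - \<Lambda> $$ (i, j)" if "i < 3" "j < 3" for i j
  proof -
    have "transpose_mat \<Lambda> $$ (i, j) = (- \<Lambda>) $$ (i, j)" by (simp add: \<Lambda>_antisym)
    then show ?thesis using that \<Lambda>_carrier by simp
  qed
  from this[of 0 0] this[of 0 1] this[of 0 2] this[of 1 1] this[of 1 2] this[of 2 2]
  show "\<Lambda> $$ (0, 0) = 0" "\<Lambda> $$ (0, 1) = \<theta>" "\<Lambda> $$ (0, 2) = - \<theta>"
    "\<Lambda> $$ (1, 0) = - \<theta>" "\<Lambda> $$ (1, 1) = 0" "\<Lambda> $$ (1, 2) = \<theta>"
    "\<Lambda> $$ (2, 0) = \<theta>" "\<Lambda> $$ (2, 1) = - \<theta>" "\<Lambda> $$ (2, 2) = 0"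
    using \<Lambda>_entries by auto
qed

sublocale H: SU_deformation 3 K3
proof
  show "K3 \<in> carrier_mat (3 - 1) (3 - 1)" by (rule carrier_matI) (simp_all add: mat_of_rows_list_def)
  show "transpose_mat K3 = - K3"
    by (rule eq_matI) (auto simp: mat_of_rows_list_def less_Suc_eq numeral_2_eq_2)
qed simp

sublocale A: SU_deformation 4 \<Lambda>
  by unfold_locales (use \<Lambda>_carrier \<Lambda>_antisym in simp_all)

sublocale T: tensor_algebras "deformed_SU 3 K3" "deformed_SU 4 \<Lambda>"
  by (intro tensor_algebras.intro H.D.complex_algebra_axioms A.D.complex_algebra_axioms)

lemma SU3_eq: "SU3 \<theta> = deformed_SU 3 K3" and SU4_eq: "SU4 \<Lambda> = deformed_SU 4 \<Lambda>"
  by (simp_all add: SU3_def SU4_def)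

lemma lessThan_3: "{..<3} = {0, 1, 2::nat}" and lessThan_2: "{..<2} = {0, 1::nat}"
  by auto

text \<open>The last weight is minus the sum of the other two, which completes the 2 x 2 form to the
  cyclic pattern of \<open>\<sigma>\<close>.\<close>

lemma bil_wvec_3: "i < 3 \<Longrightarrow> j < 3 \<Longrightarrow> bil 2 K3 (wvec 3 i) (wvec 3 j) = \<sigma> \<theta> i j"
proof -
  assume "i < 3" "j < 3"
  then have "i \<in> {0, 1, 2}" "j \<in> {0, 1, 2}" by auto
  then show ?thesis
    by (auto simp: bil_def wvec_def \<sigma>_def lessThan_2 mat_of_rows_list_def)
qed

text \<open>The conditions on \<open>\<Lambda>\<close> enter here: its entries are those of
  \<open>\<sigma>\<close>, and its vanishing row sums make the last weight pair to zero with all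
  others.\<close>

lemma bil_wvec_4: "i < 4 \<Longrightarrow> j < 4 \<Longrightarrow> bil 3 \<Lambda> (wvec 4 i) (wvec 4 j) = \<sigma> \<theta> i j"
proof -
  assume "i < 4" "j < 4"
  then have "i \<in> {0, 1, 2, 3}" "j \<in> {0, 1, 2, 3}" by auto
  then show ?thesis
    by (auto simp: bil_def wvec_def \<sigma>_def lessThan_3 \<Lambda>_values)
qed

lemma \<sigma>_3: "\<sigma> \<theta> i 3 = 0" "\<sigma> \<theta> 3 i = 0"
  by (simp_all add: \<sigma>_def)

abbreviation "tw3 k l \<equiv> H.twist (wvec 3 k, wvec 3 l)"
abbreviation "tw4 k l \<equiv> A.twist (wvec 4 k, wvec 4 l)"

lemma tw3_index: "U \<in> SU 3 \<Longrightarrow> k < 3 \<Longrightarrow> l < 3 \<Longrightarrow> i < 3 \<Longrightarrow> j < 3 \<Longrightarrow>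
    tw3 k l U $$ (i, j) = cis (pi * \<sigma> \<theta> k i) * cis (- (pi * \<sigma> \<theta> l j)) * U $$ (i, j)"
  using H.twist_index[OF SU_carrier] by (simp add: bil_wvec_3 cis_mult ring_distribs)

lemma tw4_index: "U \<in> SU 4 \<Longrightarrow> k < 4 \<Longrightarrow> l < 4 \<Longrightarrow> i < 4 \<Longrightarrow> j < 4 \<Longrightarrow>
    tw4 k l U $$ (i, j) = cis (pi * \<sigma> \<theta> k i) * cis (- (pi * \<sigma> \<theta> l j)) * U $$ (i, j)"
  using A.twist_index[OF SU_carrier] by (simp add: bil_wvec_4 cis_mult ring_distribs)

lemma SU_eqI: "U \<in> SU n \<Longrightarrow> V \<in> SU n \<Longrightarrow> (\<And>i j. i < n \<Longrightarrow> j < n \<Longrightarrow> U $$ (i, j) = V $$ (i, j)) \<Longrightarrow> U = V"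
  by (intro eq_matI) (auto dest!: SU_carrier)

text \<open>The torus factors meeting in the middle cancel because \<open>\<Lambda>\<close> extends the matrix defining \<open>SU(3)\<^sub>\<theta>\<close>.\<close>

lemma block_embed_twist:
  assumes h: "h \<in> SU 3" and U: "U \<in> SU 4" and k: "k < 3" and l: "l < 4" and \<alpha>: "\<alpha> < 3"
  shows "block_embed (tw3 k \<alpha> h) * tw4 \<alpha> l U = tw4 k l (block_embed h * U)"
proof (rule SU_eqI)
  note SU = H.twist_SU[OF h] A.twist_SU[OF U] block_embed_SU[OF h]
  show "block_embed (tw3 k \<alpha> h) * tw4 \<alpha> l U \<in> SU 4"
    by (intro SU_mult block_embed_SU SU)
  have V: "block_embed h * U \<in> SU 4" by (intro SU_mult SU U)
  then show "tw4 k l (block_embed h * U) \<in> SU 4" by (rule A.twist_SU)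
  fix i j :: nat assume ij: "i < 4" "j < 4"
  have cancel: "cis x * (cis (- x) * z) = z" for x z by (simp add: mult.assoc[symmetric] cis_mult)
  show "(block_embed (tw3 k \<alpha> h) * tw4 \<alpha> l U) $$ (i, j) = tw4 k l (block_embed h * U) $$ (i, j)"
  proof (cases "i < 3")
    case True
    have "(block_embed (tw3 k \<alpha> h) * tw4 \<alpha> l U) $$ (i, j)
      = (\<Sum>c<3. tw3 k \<alpha> h $$ (i, c) * tw4 \<alpha> l U $$ (c, j))"
      using True by (simp add: block_embed_mult_index[OF SU_carrier SU_carrier] SU ij)
    also have "\<dots> = (\<Sum>c<3. cis (pi * \<sigma> \<theta> k i) * cis (- (pi * \<sigma> \<theta> l j)) * (h $$ (i, c) * U $$ (c, j)))"
    proof (rule sum.cong[OF refl])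
      fix c :: nat assume "c \<in> {..<3}"
      then show "tw3 k \<alpha> h $$ (i, c) * tw4 \<alpha> l U $$ (c, j)
          = cis (pi * \<sigma> \<theta> k i) * cis (- (pi * \<sigma> \<theta> l j)) * (h $$ (i, c) * U $$ (c, j))"
        using True ij k l \<alpha> cancel[of "pi * \<sigma> \<theta> \<alpha> c"]
        by (simp add: tw3_index[OF h] tw4_index[OF U] mult.assoc mult.left_commute del: cis_mult)
    qed
    also have "\<dots> = tw4 k l (block_embed h * U) $$ (i, j)"
      using True k l ij
      by (simp add: tw4_index[OF V] block_embed_mult_index[OF SU_carrier[OF h] SU_carrier[OF U]] sum_distrib_left)
    finally show ?thesis .
  next
    case False
    then have "i = 3" using ij by simp
    then show ?thesis
      using k l \<alpha> ij
      by (simp add: block_embed_mult_index[OF SU_carrier SU_carrier] SU h U tw4_index V \<sigma>_3)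
  qed
qed

text \<open>For row index 3 the left torus factor is trivial; the right one only scales columns and
  commutes with multiplication from the left.\<close>

lemma block_embed_twist_last:
  assumes h: "h \<in> SU 3" and U: "U \<in> SU 4" and l: "l < 4"
  shows "block_embed h * tw4 3 l U = tw4 3 l (block_embed h * U)"
proof (rule SU_eqI)
  note SU = A.twist_SU[OF U] block_embed_SU[OF h]
  show "block_embed h * tw4 3 l U \<in> SU 4" by (intro SU_mult SU)
  have V: "block_embed h * U \<in> SU 4" by (intro SU_mult SU U)
  then show "tw4 3 l (block_embed h * U) \<in> SU 4" by (rule A.twist_SU)
  fix i j :: nat assume ij: "i < 4" "j < 4"
  show "(block_embed h * tw4 3 l U) $$ (i, j) = tw4 3 l (block_embed h * U) $$ (i, j)"
    using l ij
    by (simp add: block_embed_mult_index[OF SU_carrier SU_carrier] SU h U tw4_index V \<sigma>_3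
        sum_distrib_left mult.left_commute)
qed

section \<open>The action as pullback along the block embedding\<close>

definition eval_at :: "complex mat \<Rightarrow> complex mat
    \<Rightarrow> (complex mat \<Rightarrow> complex) \<times> (complex mat \<Rightarrow> complex) \<Rightarrow> complex" where
  "eval_at h U = (\<lambda>(a, b). a h * b U)"

lemma linear_form_eval3: "h \<in> SU 3 \<Longrightarrow> linear_form (deformed_SU 3 K3) (\<lambda>a. a h)"
  by (simp add: linear_form_def)

lemma linear_form_eval4: "U \<in> SU 4 \<Longrightarrow> linear_form (deformed_SU 4 \<Lambda>) (\<lambda>a. a U)"
  by (simp add: linear_form_def)

lemma bilinear_eval_at:
  "h \<in> SU 3 \<Longrightarrow> U \<in> SU 4 \<Longrightarrow> bilinear_form (deformed_SU 3 K3) (deformed_SU 4 \<Lambda>) (eval_at h U)"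
  unfolding eval_at_def by (intro bilinear_form_prod linear_form_eval3 linear_form_eval4)

lemma \<rho>_hom: "\<rho> \<in> alg_hom (deformed_SU 4 \<Lambda>) (tensor (deformed_SU 3 K3) (deformed_SU 4 \<Lambda>))"
  using action unfolding is_action_def SU3_eq SU4_eq by blast

lemma \<rho>_simps:
  assumes "f \<in> mon_span 4"
  shows "\<rho> f \<in> carrier (tensor (deformed_SU 3 K3) (deformed_SU 4 \<Lambda>))"
    and "g \<in> mon_span 4 \<Longrightarrow> \<rho> (\<lambda>U\<in>SU 4. f U + g U) = \<rho> f \<oplus>\<^bsub>tensor (deformed_SU 3 K3) (deformed_SU 4 \<Lambda>)\<^esub> \<rho> g"
    and "g \<in> mon_span 4 \<Longrightarrow> \<rho> (A.dm f g) = \<rho> f \<otimes>\<^bsub>tensor (deformed_SU 3 K3) (deformed_SU 4 \<Lambda>)\<^esub> \<rho> g"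
    and "\<rho> (\<lambda>U\<in>SU 4. c * f U) = c \<odot>\<^bsub>tensor (deformed_SU 3 K3) (deformed_SU 4 \<Lambda>)\<^esub> \<rho> f"
    and "\<rho> (\<lambda>U\<in>SU 4. 1) = \<one>\<^bsub>tensor (deformed_SU 3 K3) (deformed_SU 4 \<Lambda>)\<^esub>"
  using \<rho>_hom assms by (auto simp: alg_hom_def Ring.ring_hom_def Pi_iff)

lemma coord_isotypic:
  assumes "n > 0" "i < n" "j < n"
  shows "coord n i j \<in> isotypic n (wvec n i, wvec n j)" "coord n i j \<in> mon_span n"
proof -
  \<comment> \<open>Homogeneity of a coordinate does not involve the deformation matrix, so the zero
    matrix gives access to the facts of the locale.\<close>
  interpret SU_deformation n "0\<^sub>m (n - 1) (n - 1)" by unfold_locales (use assms in auto)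
  have "weight n [(i, j)] = (wvec n i, wvec n j)" by simp
  then show "coord n i j \<in> isotypic n (wvec n i, wvec n j)" "coord n i j \<in> mon_span n"
    using entry_mon_isotypic[of "[(i, j)]"] assms mon_span.mon[of "[(i, j)]" n]
    by (auto simp: coord_eq_entry_mon)
qed

lemma coord_mult:
  assumes "k < 4" "l < 4" "f \<in> mon_span 4" "U \<in> SU 4"
  shows "A.dm (coord 4 k l) f U = U $$ (k, l) * f (tw4 k l U)"
  using A.dm_homogeneous[OF coord_isotypic(1)[of 4 k l] A.wvec_W assms(3,4)] assms
  by (simp add: coord_def)

text \<open>For \<open>k < 3\<close> the twisted arguments depend on the summation index, yet their
  torus factors cancel to the single point \<open>tw4 k l (block_embed h * U)\<close>. The value of
  \<open>f\<close> there factors out, and what remains is an entry of a matrix product.\<close>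

lemma ev_\<rho>_coord_mult:
  assumes kl: "k < 4" "l < 4" and f: "f \<in> mon_span 4"
    and IH: "\<And>h U. h \<in> SU 3 \<Longrightarrow> U \<in> SU 4 \<Longrightarrow> T.ev (eval_at h U) (\<rho> f) = f (block_embed h * U)"
    and h: "h \<in> SU 3" and U: "U \<in> SU 4"
  shows "T.ev (eval_at h U) (\<rho> (A.dm (coord 4 k l) f)) = A.dm (coord 4 k l) f (block_embed h * U)"
proof -
  let ?T = "tensor (deformed_SU 3 K3) (deformed_SU 4 \<Lambda>)"
  let ?pure = "pure_tensor (deformed_SU 3 K3) (deformed_SU 4 \<Lambda>)"
  have V: "block_embed h * U \<in> SU 4" by (intro SU_mult block_embed_SU h U)
  note [simp] = coord_isotypic(2) \<rho>_simps(1)[OF f]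
  have prod: "\<rho> (A.dm (coord 4 k l) f) = \<rho> (coord 4 k l) \<otimes>\<^bsub>?T\<^esub> \<rho> f"
    by (rule \<rho>_simps(3)) (use kl f in simp_all)
  have rhs: "A.dm (coord 4 k l) f (block_embed h * U) = (block_embed h * U) $$ (k, l) * f (tw4 k l (block_embed h * U))"
    by (rule coord_mult[OF kl f V])
  show ?thesis
  proof (cases "k < 3")
    case True
    have part: "T.ev (eval_at h U) (?pure (coord 3 k \<alpha>) (coord 4 \<alpha> l) \<otimes>\<^bsub>?T\<^esub> \<rho> f)
        = (h $$ (k, \<alpha>) * U $$ (\<alpha>, l)) * f (tw4 k l (block_embed h * U))" if \<alpha>: "\<alpha> < 3" for \<alpha>
    proof -
      have "T.ev (eval_at h U) (?pure (coord 3 k \<alpha>) (coord 4 \<alpha> l) \<otimes>\<^bsub>?T\<^esub> \<rho> f)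
          = (h $$ (k, \<alpha>) * U $$ (\<alpha>, l)) * T.ev (eval_at (tw3 k \<alpha> h) (tw4 \<alpha> l U)) (\<rho> f)"
      proof (rule T.ev_pure_mult)
        fix a b assume "a \<in> carrier (deformed_SU 3 K3)" and b: "b \<in> carrier (deformed_SU 4 \<Lambda>)"
        then have "H.dm (coord 3 k \<alpha>) a h = h $$ (k, \<alpha>) * a (tw3 k \<alpha> h)"
          using H.dm_homogeneous[OF coord_isotypic(1)[of 3 k \<alpha>] H.wvec_W _ h] True \<alpha> h
          by (simp add: coord_def)
        moreover have "A.dm (coord 4 \<alpha> l) b U = U $$ (\<alpha>, l) * b (tw4 \<alpha> l U)"
          by (rule coord_mult) (use \<alpha> kl U b in simp_all)
        ultimately show "eval_at h U (coord 3 k \<alpha> \<otimes>\<^bsub>deformed_SU 3 K3\<^esub> a, coord 4 \<alpha> l \<otimes>\<^bsub>deformed_SU 4 \<Lambda>\<^esub> b)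
            = (h $$ (k, \<alpha>) * U $$ (\<alpha>, l)) * eval_at (tw3 k \<alpha> h) (tw4 \<alpha> l U) (a, b)"
          by (simp add: eval_at_def)
      qed (use True \<alpha> kl h U in \<open>auto intro!: bilinear_eval_at H.twist_SU A.twist_SU\<close>)
      also have "T.ev (eval_at (tw3 k \<alpha> h) (tw4 \<alpha> l U)) (\<rho> f) = f (tw4 k l (block_embed h * U))"
        by (simp add: IH H.twist_SU A.twist_SU h U block_embed_twist[OF h U True kl(2) \<alpha>])
      finally show ?thesis .
    qed
    have closed: "?pure (coord 3 k \<alpha>) (coord 4 \<alpha> l) \<in> carrier ?T" if "\<alpha> < 3" for \<alpha>
      by (rule T.pure_closed) (use True kl that in simp_all)
    have "T.ev (eval_at h U) ((\<Oplus>\<^bsub>?T\<^esub>\<alpha>\<in>{..<3}. ?pure (coord 3 k \<alpha>) (coord 4 \<alpha> l)) \<otimes>\<^bsub>?T\<^esub> \<rho> f)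
        = (\<Sum>\<alpha><3. T.ev (eval_at h U) (?pure (coord 3 k \<alpha>) (coord 4 \<alpha> l) \<otimes>\<^bsub>?T\<^esub> \<rho> f))"
      by (rule T.T.additive_finsum)
        (use closed in \<open>simp_all add: T.T.l_distr T.ev_add T.ev_zero bilinear_eval_at h U\<close>)
    also have "\<dots> = (\<Sum>\<alpha><3. h $$ (k, \<alpha>) * U $$ (\<alpha>, l)) * f (tw4 k l (block_embed h * U))"
      by (simp add: part sum_distrib_right)
    finally show ?thesis
      using True kl unfolding prod rhs \<rho>_upper[unfolded SU3_eq SU4_eq, OF True kl(2)]
      by (simp add: block_embed_mult_index[OF SU_carrier[OF h] SU_carrier[OF U]])
  next
    case False
    then have k: "k = 3" using kl by simp
    have "T.ev (eval_at h U) (?pure (\<lambda>U\<in>SU 3. 1) (coord 4 3 l) \<otimes>\<^bsub>?T\<^esub> \<rho> f)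
        = U $$ (3, l) * T.ev (eval_at h (tw4 3 l U)) (\<rho> f)"
    proof (rule T.ev_pure_mult)
      fix a b assume "a \<in> carrier (deformed_SU 3 K3)" "b \<in> carrier (deformed_SU 4 \<Lambda>)"
      then show "eval_at h U ((\<lambda>U\<in>SU 3. 1) \<otimes>\<^bsub>deformed_SU 3 K3\<^esub> a, coord 4 3 l \<otimes>\<^bsub>deformed_SU 4 \<Lambda>\<^esub> b)
          = U $$ (3, l) * eval_at h (tw4 3 l U) (a, b)"
        using kl U by (simp add: eval_at_def H.dm_one_left coord_mult)
    qed (use kl h U mon_span_const in \<open>auto intro!: bilinear_eval_at A.twist_SU\<close>)
    also have "T.ev (eval_at h (tw4 3 l U)) (\<rho> f) = f (tw4 3 l (block_embed h * U))"
      by (simp add: IH A.twist_SU h U block_embed_twist_last kl)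
    finally show ?thesis
      using kl unfolding prod rhs unfolding k \<rho>_last[unfolded SU3_eq SU4_eq, OF kl(2)]
      by (simp add: block_embed_mult_index[OF SU_carrier[OF h] SU_carrier[OF U]])
  qed
qed

text \<open>\<open>\<rho>\<close> is multiplicative only for the deformed product, so monomials are
  taken apart one coordinate at a time.\<close>

lemma ev_\<rho>:
  assumes "f \<in> mon_span 4" "h \<in> SU 3" "U \<in> SU 4"
  shows "T.ev (eval_at h U) (\<rho> f) = f (block_embed h * U)"
  using assms
proof (induction arbitrary: h U rule: mon_span.induct)
  case (mon L)
  then show ?case
  proof (induction L arbitrary: h U)
    case Nil
    have "T.ev (eval_at h U) (\<rho> (\<lambda>U\<in>SU 4. 1)) = 1"
      using Nil \<rho>_simps(5)[OF mon_span_const]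
      by (simp add: T.tensor_one T.ev_pure bilinear_eval_at mon_span_const) (simp add: eval_at_def)
    moreover have "block_embed h * U \<in> SU 4" by (intro SU_mult block_embed_SU Nil)
    ultimately show ?case by (simp add: entry_mon_def)
  next
    case (Cons kl L)
    obtain k l where kl: "kl = (k, l)" "k < 4" "l < 4" using Cons.hyps by auto
    have L: "L \<in> idx 4" using Cons.hyps by simp
    \<comment> \<open>The phase between the deformed and the pointwise product of the first entry
      with the rest; multiplying by its conjugate writes the monomial as a scalar times a deformed
      product.\<close>
    let ?c = "deform_phase \<Lambda> (weight 4 [(k, l)]) (weight 4 L)"
    have c: "cnj ?c * ?c = 1"
      using A.weight_W[of "[(k, l)]"] A.weight_W[of L]
      by (cases "weight 4 [(k, l)]"; cases "weight 4 L")
        (simp del: weight.simps add: A.phase_bil cis_cnj cis_mult)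
    have e: "entry_mon 4 (kl # L) = (\<lambda>U\<in>SU 4. cnj ?c * A.dm (coord 4 k l) (entry_mon 4 L) U)"
      using A.dm_entry_mon[of "[(k, l)]" L] kl L c mon_span_extensional[OF mon_span.mon[of "kl # L" 4]]
      by (intro A.SU_ext) (simp_all add: coord_eq_entry_mon mult.assoc[symmetric] del: weight.simps)
    have f: "A.dm (coord 4 k l) (entry_mon 4 L) \<in> mon_span 4"
      by (intro A.dm_closed coord_isotypic(2) mon_span.mon L) (use kl in simp_all)
    have "block_embed h * U \<in> SU 4" by (intro SU_mult block_embed_SU Cons.prems)
    moreover have "T.ev (eval_at h U) (\<rho> (A.dm (coord 4 k l) (entry_mon 4 L)))
        = A.dm (coord 4 k l) (entry_mon 4 L) (block_embed h * U)"
      by (rule ev_\<rho>_coord_mult[OF kl(2,3) mon_span.mon[OF L] Cons.IH Cons.prems])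
    ultimately show ?case
      unfolding e
      by (simp add: \<rho>_simps(4)[OF f] T.ev_smult[OF bilinear_eval_at[OF Cons.prems] \<rho>_simps(1)[OF f]])
  qed
next
  case (add f g)
  have "block_embed h * U \<in> SU 4" by (intro SU_mult block_embed_SU add.prems)
  then show ?case
    using add by (simp add: \<rho>_simps T.ev_add bilinear_eval_at)
next
  case (smult f c)
  have "block_embed h * U \<in> SU 4" by (intro SU_mult block_embed_SU smult.prems)
  then show ?case
    using smult by (simp add: \<rho>_simps T.ev_smult bilinear_eval_at)
qed

text \<open>Both tensors are compared at all pairs of points: on one side \<open>ev_\<rho>\<close>
  gives \<open>f (block_embed h * U)\<close>, on the other the value is \<open>f U\<close>. The
  converse direction needs that these evaluations separate tensors.\<close>

lemma fixed_points_iff: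
  "f \<in> fixed_points (SU3 \<theta>) (SU4 \<Lambda>) \<rho> \<longleftrightarrow>
    f \<in> mon_span 4 \<and> (\<forall>h\<in>SU 3. \<forall>U\<in>SU 4. f (block_embed h * U) = f U)"
proof (cases "f \<in> mon_span 4")
  case True
  let ?pure = "pure_tensor (deformed_SU 3 K3) (deformed_SU 4 \<Lambda>)"
  have one: "(\<lambda>U\<in>SU 3. 1) \<in> carrier (deformed_SU 3 K3)" using mon_span_const by simp
  have f: "f \<in> carrier (deformed_SU 4 \<Lambda>)" using True by simp
  have ev1: "T.ev (eval_at h U) (?pure (\<lambda>U\<in>SU 3. 1) f) = f U" if "h \<in> SU 3" "U \<in> SU 4" for h U
    using T.ev_pure[OF bilinear_eval_at[OF that] one f] that by (simp add: eval_at_def)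
  have "\<rho> f = ?pure (\<lambda>U\<in>SU 3. 1) f \<longleftrightarrow> (\<forall>h\<in>SU 3. \<forall>U\<in>SU 4. f (block_embed h * U) = f U)"
  proof
    assume "\<rho> f = ?pure (\<lambda>U\<in>SU 3. 1) f"
    then show "\<forall>h\<in>SU 3. \<forall>U\<in>SU 4. f (block_embed h * U) = f U"
      using ev_\<rho>[OF True] ev1 by metis
  next
    assume inv: "\<forall>h\<in>SU 3. \<forall>U\<in>SU 4. f (block_embed h * U) = f U"
    obtain p where p: "p \<in> carrier T.F" "\<rho> f = T.J +>\<^bsub>T.F\<^esub> p"
      using \<rho>_simps(1)[OF True] T.tensor_carrierE by metis
    let ?e = "basis_elt (\<lambda>U\<in>SU 3. 1, f)"
    have e: "?e \<in> carrier T.F" using one f by simp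
    have d: "(\<lambda>x. p x - ?e x) \<in> carrier T.F" using T.F.minus_closed[OF p(1) e] unfolding T.F_minus[OF p(1) e] .
    have "(\<lambda>x. p x - ?e x) \<in> T.J"
    proof (rule T.J_separating[where X = "SU 3" and Y = "SU 4" and eA = "\<lambda>h a. a h" and eB = "\<lambda>U b. b U", OF _ _ _ _ d])
      fix h U assume hU: "h \<in> SU 3" "U \<in> SU 4"
      have "lin_ext (eval_at h U) (\<lambda>x. p x - ?e x) = lin_ext (eval_at h U) p - lin_ext (eval_at h U) ?e"
        by (rule lin_ext_diff) (use T.finite_supp p e in auto)
      also have "lin_ext (eval_at h U) p = f U"
        using T.ev_coset[OF bilinear_eval_at[OF hU] p(1)] p(2) ev_\<rho>[OF True hU] inv hU by simp
      finally show "lin_ext (\<lambda>(a, b). a h * b U) (\<lambda>x. p x - ?e x) = 0"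
        using hU by (simp add: eval_at_def)
    qed (auto simp: linear_form_eval3 linear_form_eval4 dest!: mon_span_extensional intro: H.SU_ext A.SU_ext)
    then show "\<rho> f = ?pure (\<lambda>U\<in>SU 3. 1) f"
      using T.coset_eq_iff[OF p(1) e] p(2) by (simp add: pure_tensor_def)
  qed
  then show ?thesis using True by (simp add: fixed_points_def SU3_eq SU4_eq)
qed (simp add: fixed_points_def SU4_eq)

end

section \<open>Invariant functions are polynomials in the last row\<close>

abbreviation letters :: "nat letter set" where
  "letters \<equiv> Gen ` {..<4} \<union> GenStar ` {..<4}"

primrec lval :: "(nat \<Rightarrow> complex) \<Rightarrow> nat letter \<Rightarrow> complex" where
  "lval x (Gen j) = x j"
| "lval x (GenStar j) = cnj (x j)"

definition wval :: "(nat \<Rightarrow> complex) \<Rightarrow> nat letter list \<Rightarrow> complex" where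
  "wval x w = (\<Prod>a\<leftarrow>w. lval x a)"

lemma wval_simps [simp]:
  "wval x [] = 1" "wval x (a # w) = lval x a * wval x w" "wval x (w @ w') = wval x w * wval x w'"
  by (simp_all add: wval_def)

text \<open>Polynomials in the coordinates and their conjugates, as functions of arbitrary
  \<open>x\<close>; the sphere enters only where identities between them are restricted to
  it.\<close>

inductive_set Pol :: "((nat \<Rightarrow> complex) \<Rightarrow> complex) set" where
  const: "(\<lambda>x. c) \<in> Pol"
| gen: "j < 4 \<Longrightarrow> (\<lambda>x. x j) \<in> Pol"
| gen_star: "j < 4 \<Longrightarrow> (\<lambda>x. cnj (x j)) \<in> Pol"
| add: "p \<in> Pol \<Longrightarrow> q \<in> Pol \<Longrightarrow> (\<lambda>x. p x + q x) \<in> Pol"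
| mult: "p \<in> Pol \<Longrightarrow> q \<in> Pol \<Longrightarrow> (\<lambda>x. p x * q x) \<in> Pol"

lemma Pol_cnj: "p \<in> Pol \<Longrightarrow> (\<lambda>x. cnj (p x)) \<in> Pol"
  by (induction rule: Pol.induct) (auto intro: Pol.intros)

lemma Pol_power: "p \<in> Pol \<Longrightarrow> (\<lambda>x. p x ^ n) \<in> Pol"
  by (induction n) (auto intro: Pol.const Pol.mult)

lemma Pol_diff: "p \<in> Pol \<Longrightarrow> q \<in> Pol \<Longrightarrow> (\<lambda>x. p x - q x) \<in> Pol"
  using Pol.add[OF _ Pol.mult[OF Pol.const[of "- 1"]], of p q] by simp

lemma free_monoid_monoid: "Group.monoid (free_monoid X)"
  by (rule monoidI) (auto simp: free_monoid_def)

lemma Pol_span: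
  assumes "p \<in> Pol"
  shows "\<exists>c\<in>carrier (monoid_algebra (free_monoid letters)). \<forall>x. p x = lin_ext (wval x) c"
proof -
  let ?F = "monoid_algebra (free_monoid letters)"
  interpret F: ring ?F by (rule monoid_algebra_ring[OF free_monoid_monoid])
  have fin: "finite {w. c w \<noteq> 0}" if "c \<in> carrier ?F" for c
    using that by (simp add: monoid_algebra_simps)
  have letter: "\<exists>c\<in>carrier ?F. \<forall>x. lval x a = lin_ext (wval x) c" if "a \<in> letters" for a
    by (rule bexI[of _ "basis_elt [a]"]) (use that in \<open>auto simp: free_monoid_def\<close>)
  show ?thesis
    using assms
  proof (induction rule: Pol.induct)
    case (const k)
    have "(\<lambda>w. k * \<one>\<^bsub>?F\<^esub> w) \<in> carrier ?F" using F.one_closed by (auto simp: monoid_algebra_simps(1))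
    moreover have "lin_ext (wval x) (\<lambda>w. k * \<one>\<^bsub>?F\<^esub> w) = k" for x
      unfolding lin_ext_smult by (simp add: monoid_algebra_simps(2) free_monoid_def)
    ultimately show ?case by metis
  next
    case (gen j)
    then show ?case using letter[of "Gen j"] by simp
  next
    case (gen_star j)
    then show ?case using letter[of "GenStar j"] by simp
  next
    case (add p q)
    then obtain c d where cd: "c \<in> carrier ?F" "d \<in> carrier ?F"
      "\<And>x. p x = lin_ext (wval x) c" "\<And>x. q x = lin_ext (wval x) d" by blast
    show ?case
      by (rule bexI[of _ "c \<oplus>\<^bsub>?F\<^esub> d"]) (use cd fin in \<open>simp_all add: monoid_algebra_simps(4) lin_ext_add\<close>,
        use cd F.add.m_closed[of c d] in \<open>simp add: monoid_algebra_simps(4)\<close>)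
  next
    case (mult p q)
    then obtain c d where cd: "c \<in> carrier ?F" "d \<in> carrier ?F"
      "\<And>x. p x = lin_ext (wval x) c" "\<And>x. q x = lin_ext (wval x) d" by blast
    have "lin_ext (wval x) (c \<otimes>\<^bsub>?F\<^esub> d) = p x * q x" for x
    proof -
      have "lin_ext (wval x) (c \<otimes>\<^bsub>?F\<^esub> d) = lin_ext (\<lambda>y. lin_ext (\<lambda>z. wval x y * wval x z) d) c"
        unfolding lin_ext_mult[OF fin[OF cd(1)] fin[OF cd(2)]] by (simp add: free_monoid_def)
      also have "\<dots> = lin_ext (\<lambda>y. lin_ext (wval x) d * wval x y) c"
        by (simp add: lin_ext_beta_smult mult.commute)
      finally show ?thesis using cd by (simp add: lin_ext_beta_smult)
    qed
    then show ?case using F.m_closed[OF cd(1,2)] by metis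
  qed
qed

section \<open>The fibration of SU(4) over the sphere\<close>

definition S7 :: "(nat \<Rightarrow> complex) set" where
  "S7 = {x. (\<Sum>k<4. x k * cnj (x k)) = 1}"

definition last_row :: "complex mat \<Rightarrow> nat \<Rightarrow> complex" where
  "last_row U = (\<lambda>j. U $$ (3, j))"

lemma last_row_S7: "U \<in> SU 4 \<Longrightarrow> last_row U \<in> S7"
  by (simp add: SU_iff S7_def last_row_def)

lemma SU_adjoint: assumes "V \<in> SU n" shows "mat_adjoint V \<in> SU n"
proof -
  interpret cnj: comm_ring_hom cnj by unfold_locales auto
  have V: "V \<in> carrier_mat n n" using assms by (rule SU_carrier)
  have c: "mat_adjoint V \<in> carrier_mat n n" using V by simp
  have "mat_adjoint V = map_mat cnj (transpose_mat V)"
    using V carrier_matD[OF c] by (intro eq_matI) (auto simp: mat_adjoint_index[OF V])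
  then have "det (mat_adjoint V) = 1"
    using assms V by (simp add: det_transpose[OF V] SU_iff)
  moreover have "mat_adjoint (mat_adjoint V) = V"
    using V carrier_matD[OF mat_adjoint_carrier[OF c]] by (intro eq_matI) (auto simp: mat_adjoint_index[OF V] mat_adjoint_index[OF c])
  ultimately show ?thesis using c SU_adjoint_left[OF assms] by (simp add: SU_def)
qed

text \<open>\<open>U\<close> times the adjoint of \<open>V\<close> is unitary with last row and last
  column those of the identity: the row by unitarity of \<open>V\<close>, the column by unitarity of
  \<open>U\<close>. So the fibres of \<open>last_row\<close> are the orbits of the block-embedded
  SU(3).\<close>

lemma same_last_row:
  assumes U: "U \<in> SU 4" and V: "V \<in> SU 4" and eq: "\<And>j. j < 4 \<Longrightarrow> U $$ (3, j) = V $$ (3, j)"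
  shows "\<exists>h\<in>SU 3. U = block_embed h * V"
proof -
  note c = SU_carrier[OF U] SU_carrier[OF V]
  define W where "W = U * mat_adjoint V"
  have W: "W \<in> SU 4" unfolding W_def by (intro SU_mult U SU_adjoint V)
  have Widx: "W $$ (i, j) = (\<Sum>k<4. U $$ (i, k) * cnj (V $$ (j, k)))" if "i < 4" "j < 4" for i j
    unfolding W_def mat_mult_index[OF c(1) mat_adjoint_carrier[OF c(2)] that]
    by (rule sum.cong) (use that in \<open>simp_all add: mat_adjoint_index[OF c(2)]\<close>)
  have row: "W $$ (3, j) = (if j = 3 then 1 else 0)" if "j < 4" for j
  proof -
    have "W $$ (3, j) = (\<Sum>k<4. V $$ (3, k) * cnj (V $$ (j, k)))"
      using that by (simp add: Widx eq)
    then show ?thesis using V that by (auto simp: SU_iff)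
  qed
  have col: "W $$ (i, 3) = (if i = 3 then 1 else 0)" if "i < 4" for i
  proof -
    have "W $$ (i, 3) = (\<Sum>k<4. U $$ (i, k) * cnj (U $$ (3, k)))"
      using that by (simp add: Widx eq)
    then show ?thesis using U that by (auto simp: SU_iff)
  qed
  define h where "h = mat 3 3 (\<lambda>ij. W $$ ij)"
  have h: "h \<in> carrier_mat 3 3" by (simp add: h_def)
  have Wh: "W = block_embed h"
  proof (rule eq_matI)
    fix i j assume "i < dim_row (block_embed h)" "j < dim_col (block_embed h)"
    then have "i < 4" "j < 4" using block_embed_carrier[OF h] by auto
    then have "i < 3 \<or> i = 3" "j < 3 \<or> j = 3" by auto
    then have "W $$ (i, j) = (if i < 3 \<and> j < 3 then h $$ (i, j) else if i = j then 1 else 0)"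
      by (auto simp: h_def row col)
    then show "W $$ (i, j) = block_embed h $$ (i, j)"
      using \<open>i < 4\<close> \<open>j < 4\<close> by (simp add: block_embed_index[OF h])
  qed (use block_embed_carrier[OF h] SU_carrier[OF W] in auto)
  have "det (block_embed h) = det h"
    unfolding block_embed_def using h by (subst det_four_block_mat_lower_left_zero[of _ 3 _ 1]) auto
  then have "det h = 1" using W Wh by (simp add: SU_iff)
  moreover have "(\<Sum>k<3. h $$ (i, k) * cnj (h $$ (j, k))) = (if i = j then 1 else 0)" if "i < 3" "j < 3" for i j
  proof -
    have "(\<Sum>k<4. W $$ (i, k) * cnj (W $$ (j, k)))
        = (\<Sum>k<3. W $$ (i, k) * cnj (W $$ (j, k))) + W $$ (i, 3) * cnj (W $$ (j, 3))"
      using sum.lessThan_Suc[of "\<lambda>k. W $$ (i, k) * cnj (W $$ (j, k))" 3] by simp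
    then have "(\<Sum>k<3. h $$ (i, k) * cnj (h $$ (j, k))) = (\<Sum>k<4. W $$ (i, k) * cnj (W $$ (j, k)))"
      using that by (simp add: h_def col)
    then show ?thesis using W that by (simp add: SU_iff)
  qed
  ultimately have "h \<in> SU 3" using h by (simp add: SU_iff)
  moreover have "U = W * V"
    using c SU_adjoint_left[OF V] unfolding W_def
    by (simp add: assoc_mult_mat[OF c(1) mat_adjoint_carrier[OF c(2)] c(2)])
  ultimately show ?thesis using Wh by blast
qed

text \<open>
  For \<open>\<bar>c\<bar> = 1\<close> and \<open>x \<noteq> c e\<^sub>3\<close> on the sphere, the complex reflection \<open>c (I - c\<^sup>* w\<^sup>* w / w\<^sub>3\<^sup>*)\<close> with
  \<open>w = c e\<^sub>3 - x\<close> is unitary with last row \<open>x\<close>; rescaling its first row makes its determinant 1.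
\<close>

definition reflection_vec :: "complex \<Rightarrow> (nat \<Rightarrow> complex) \<Rightarrow> nat \<Rightarrow> complex" where
  "reflection_vec c x j = (if j = 3 then c else 0) - x j"

definition reflection :: "complex \<Rightarrow> (nat \<Rightarrow> complex) \<Rightarrow> complex mat" where
  "reflection c x = mat 4 4 (\<lambda>(i, j). (if i = j then c else 0)
     + - 1 * (cnj (reflection_vec c x i) * (reflection_vec c x j * (1 / cnj (c - x 3)))))"

definition special_reflection :: "complex \<Rightarrow> (nat \<Rightarrow> complex) \<Rightarrow> complex mat" where
  "special_reflection c x = multrow 0 (cnj (det (reflection c x))) (reflection c x)"

lemma reflection_carrier [simp]: "reflection c x \<in> carrier_mat 4 4" "special_reflection c x \<in> carrier_mat 4 4"
  by (simp_all add: reflection_def special_reflection_def)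

lemma reflection_unitary:
  assumes x: "x \<in> S7" and c: "c * cnj c = 1" and ne: "x 3 \<noteq> c" and ij: "i < 4" "j < 4"
  shows "(\<Sum>k<4. reflection c x $$ (i, k) * cnj (reflection c x $$ (j, k))) = (if i = j then 1 else 0)"
proof -
  define w where "w = reflection_vec c x"
  define t where "t = cnj (c - x 3)"
  have t: "t \<noteq> 0" using ne by (simp add: t_def)
  have sum4: "(\<Sum>k<4. f k) = f 0 + f 1 + f 2 + f 3" for f :: "nat \<Rightarrow> complex"
  proof -
    have "{..<4} = {0, 1, 2, 3::nat}" by auto
    then show ?thesis by (simp add: add.assoc)
  qed
  \<comment> \<open>The only use of the sphere equation. The squared length of \<open>w\<close> is
    twice the real part of \<open>c * t\<close>, exactly what lets the quadratic term cancel the two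
    cross terms below.\<close>
  have "(\<Sum>k<4. w k * cnj (w k)) = c * t + cnj c * cnj t"
    using x c by (simp add: S7_def w_def reflection_vec_def t_def sum4 algebra_simps)
  then have norm: "(\<Sum>k<4. w k * cnj (w k)) / (t * cnj t) = c / cnj t + cnj c / t"
    using t by (simp add: field_simps)
  have r: "reflection c x $$ (a, k) = (if a = k then c else 0) - cnj (w a) * w k / t" if "a < 4" "k < 4" for a k
    using that by (simp add: reflection_def w_def t_def)
  have "(\<Sum>k<4. reflection c x $$ (i, k) * cnj (reflection c x $$ (j, k)))
    = (\<Sum>k<4. (if k = i then if i = j then c * cnj c else 0 else 0)
        - (if k = i then c * (w j * cnj (w i)) / cnj t else 0)
        - (if k = j then cnj c * (cnj (w i) * w j) / t else 0)
        + cnj (w i) * w j * (w k * cnj (w k) / (t * cnj t)))"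
    by (rule sum.cong) (use ij in \<open>auto simp: r algebra_simps\<close>)
  also have "\<dots> = (if i = j then 1 else 0) - c * (w j * cnj (w i)) / cnj t - cnj c * (cnj (w i) * w j) / t
      + cnj (w i) * w j * ((\<Sum>k<4. w k * cnj (w k)) / (t * cnj t))"
    using ij c by (simp add: sum.distrib sum_subtractf sum_distrib_left sum_divide_distrib)
  also have "\<dots> = (if i = j then 1 else 0)"
    unfolding norm by (simp add: algebra_simps)
  finally show ?thesis .
qed

lemma special_reflection_SU:
  assumes "x \<in> S7" "c * cnj c = 1" "x 3 \<noteq> c"
  shows "special_reflection c x \<in> SU 4"
proof -
  interpret cnj: comm_ring_hom cnj by unfold_locales auto
  let ?M = "reflection c x"
  note u = reflection_unitary[OF assms]
  have c: "?M \<in> carrier_mat 4 4" by simp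
  have "?M * transpose_mat (map_mat cnj ?M) = 1\<^sub>m 4"
  proof (rule eq_matI)
    fix i j assume "i < dim_row (1\<^sub>m 4)" "j < dim_col (1\<^sub>m 4)"
    then have ij: "i < 4" "j < 4" by simp_all
    have "(?M * transpose_mat (map_mat cnj ?M)) $$ (i, j) = (\<Sum>k<4. ?M $$ (i, k) * transpose_mat (map_mat cnj ?M) $$ (k, j))"
      by (rule mat_mult_index) (use ij c in auto)
    also have "\<dots> = (\<Sum>k<4. ?M $$ (i, k) * cnj (?M $$ (j, k)))"
      by (rule sum.cong) (use ij carrier_matD[OF c] in auto)
    finally show "(?M * transpose_mat (map_mat cnj ?M)) $$ (i, j) = 1\<^sub>m 4 $$ (i, j)"
      using u ij by simp
  qed (use carrier_matD[OF c] in auto)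
  then have "det ?M * det (transpose_mat (map_mat cnj ?M)) = 1"
    using det_mult[of ?M 4 "transpose_mat (map_mat cnj ?M)"] c by simp
  then have d: "det ?M * cnj (det ?M) = 1"
    using c by (simp add: det_transpose[of _ 4])
  have "det (special_reflection c x) = 1"
    using d c unfolding special_reflection_def by (subst det_multrow[of _ 4]) (simp_all add: mult.commute)
  moreover have "(\<Sum>k<4. special_reflection c x $$ (i, k) * cnj (special_reflection c x $$ (j, k))) = (if i = j then 1 else 0)"
    if ij: "i < 4" "j < 4" for i j
  proof -
    let ?s = "\<lambda>i::nat. if i = 0 then cnj (det ?M) else 1"
    have "(\<Sum>k<4. special_reflection c x $$ (i, k) * cnj (special_reflection c x $$ (j, k)))
        = (\<Sum>k<4. ?s i * cnj (?s j) * (?M $$ (i, k) * cnj (?M $$ (j, k))))"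
      by (rule sum.cong) (use ij carrier_matD[OF c] in \<open>auto simp: special_reflection_def\<close>)
    also have "\<dots> = ?s i * cnj (?s j) * (if i = j then 1 else 0)"
      using u[OF ij] by (simp add: sum_distrib_left[symmetric])
    also have "\<dots> = (if i = j then 1 else 0)" using d by (simp add: mult.commute)
    finally show ?thesis .
  qed
  ultimately show ?thesis by (simp add: SU_iff)
qed

lemma special_reflection_last_row:
  assumes "x 3 \<noteq> c" "j < 4"
  shows "special_reflection c x $$ (3, j) = x j"
proof -
  have "cnj (c - x 3) \<noteq> 0" using assms by simp
  then have "reflection c x $$ (3, j) = (if j = 3 then c else 0) - reflection_vec c x j"
    using assms by (simp add: reflection_def) (simp add: reflection_vec_def)
  then show ?thesis
    using assms carrier_matD[OF reflection_carrier(1)[of c x]] unfolding special_reflection_def by (subst index_mat_multrow) (auto simp: reflection_vec_def)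
qed

lemma S7_last_row: assumes "x \<in> S7" shows "\<exists>U\<in>SU 4. \<forall>j<4. last_row U j = x j"
proof -
  \<comment> \<open>Any centre on the unit circle other than \<open>x 3\<close> makes the reflection
    available.\<close>
  define c where "c = (if x 3 = 1 then - 1 else 1 :: complex)"
  have "c * cnj c = 1" "x 3 \<noteq> c" by (auto simp: c_def)
  then show ?thesis
    using special_reflection_SU[OF assms] special_reflection_last_row unfolding last_row_def by blast
qed

section \<open>Localization at the poles of the section\<close>

definition pole :: "complex \<Rightarrow> (nat \<Rightarrow> complex) \<Rightarrow> complex" where
  "pole c x = (c - x 3) * cnj (c - x 3)"

text \<open>The localization of polynomial functions on the sphere at \<open>pole c\<close>. At
  \<open>x 3 = c\<close>, where the reflection degenerates, no condition is imposed.\<close>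

definition Loc :: "complex \<Rightarrow> ((nat \<Rightarrow> complex) \<Rightarrow> complex) set" where
  "Loc c = {f. \<exists>n. \<exists>p\<in>Pol. \<forall>x\<in>S7. x 3 \<noteq> c \<longrightarrow> f x * pole c x ^ n = p x}"

lemma LocI:
  "p \<in> Pol \<Longrightarrow> (\<And>x. x \<in> S7 \<Longrightarrow> x 3 \<noteq> c \<Longrightarrow> f x * pole c x ^ n = p x) \<Longrightarrow> f \<in> Loc c"
  unfolding Loc_def by auto

lemma LocE:
  assumes "f \<in> Loc c"
  obtains p n where "p \<in> Pol" "\<And>x. x \<in> S7 \<Longrightarrow> x 3 \<noteq> c \<Longrightarrow> f x * pole c x ^ n = p x"
  using assms unfolding Loc_def by auto

lemma pole_Pol: "pole c \<in> Pol"
proof -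
  have "(\<lambda>x. c - x 3) \<in> Pol" by (intro Pol_diff Pol.intros) simp
  from Pol.mult[OF this Pol_cnj[OF this]] show ?thesis unfolding pole_def[abs_def] .
qed

lemma Loc_Pol: "p \<in> Pol \<Longrightarrow> p \<in> Loc c"
  unfolding Loc_def by (auto intro!: exI[of _ 0] bexI[of _ p])

lemma Loc_add: assumes "f \<in> Loc c" "g \<in> Loc c" shows "(\<lambda>x. f x + g x) \<in> Loc c"
proof -
  obtain n p where f: "p \<in> Pol" "\<And>x. x \<in> S7 \<Longrightarrow> x 3 \<noteq> c \<Longrightarrow> f x * pole c x ^ n = p x"
    using assms(1) by (rule LocE) (rule that)
  obtain m q where g: "q \<in> Pol" "\<And>x. x \<in> S7 \<Longrightarrow> x 3 \<noteq> c \<Longrightarrow> g x * pole c x ^ m = q x"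
    using assms(2) by (rule LocE) (rule that)
  have "(f x + g x) * pole c x ^ (n + m) = p x * pole c x ^ m + q x * pole c x ^ n"
    if "x \<in> S7" "x 3 \<noteq> c" for x
    unfolding f(2)[OF that, symmetric] g(2)[OF that, symmetric] by (simp add: power_add algebra_simps)
  moreover have "(\<lambda>x. p x * pole c x ^ m + q x * pole c x ^ n) \<in> Pol"
    by (intro Pol.add Pol.mult Pol_power pole_Pol f g)
  ultimately show ?thesis by (intro LocI)
qed

lemma Loc_mult: assumes "f \<in> Loc c" "g \<in> Loc c" shows "(\<lambda>x. f x * g x) \<in> Loc c"
proof -
  obtain n p where f: "p \<in> Pol" "\<And>x. x \<in> S7 \<Longrightarrow> x 3 \<noteq> c \<Longrightarrow> f x * pole c x ^ n = p x"
    using assms(1) by (rule LocE) (rule that)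
  obtain m q where g: "q \<in> Pol" "\<And>x. x \<in> S7 \<Longrightarrow> x 3 \<noteq> c \<Longrightarrow> g x * pole c x ^ m = q x"
    using assms(2) by (rule LocE) (rule that)
  have "(f x * g x) * pole c x ^ (n + m) = p x * q x"
    if "x \<in> S7" "x 3 \<noteq> c" for x
    unfolding f(2)[OF that, symmetric] g(2)[OF that, symmetric] by (simp add: power_add algebra_simps)
  moreover have "(\<lambda>x. p x * q x) \<in> Pol" by (intro Pol.mult f g)
  ultimately show ?thesis by (intro LocI)
qed

text \<open>\<open>pole c\<close> is invariant under conjugation; this is why the squared modulus of
  \<open>c - x 3\<close> serves as denominator. The scaling factor of
  \<open>special_reflection\<close>, a conjugated determinant, requires this closure.\<close>

lemma Loc_cnj: assumes "f \<in> Loc c" shows "(\<lambda>x. cnj (f x)) \<in> Loc c"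
proof -
  obtain n p where *: "p \<in> Pol" "\<And>x. x \<in> S7 \<Longrightarrow> x 3 \<noteq> c \<Longrightarrow> f x * pole c x ^ n = p x"
    using assms by (rule LocE) (rule that)
  have "cnj (f x) * pole c x ^ n = cnj (p x)" if "x \<in> S7" "x 3 \<noteq> c" for x
    unfolding *(2)[OF that, symmetric] by (simp add: pole_def mult.commute)
  then show ?thesis by (intro LocI[OF Pol_cnj[OF *(1)]])
qed

lemma Loc_cong:
  assumes "f \<in> Loc c" "\<And>x. x \<in> S7 \<Longrightarrow> x 3 \<noteq> c \<Longrightarrow> g x = f x"
  shows "g \<in> Loc c"
  using assms unfolding Loc_def by auto

lemma reflection_Loc:
  assumes "i < 4" "j < 4"
  shows "(\<lambda>x. reflection c x $$ (i, j)) \<in> Loc c"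
proof -
  have "(1 / cnj (c - x 3)) * pole c x ^ 1 = c - x 3" if "x 3 \<noteq> c" for x
    using that by (simp add: pole_def)
  moreover have w: "(\<lambda>x. reflection_vec c x k) \<in> Pol" if "k < 4" for k
    unfolding reflection_vec_def by (intro Pol_diff Pol.intros that)
  have "(\<lambda>x. c - x 3) \<in> Pol" by (intro Pol_diff Pol.intros) simp
  ultimately have inv: "(\<lambda>x. 1 / cnj (c - x 3)) \<in> Loc c" by (intro LocI[where n = 1]) simp_all
  have "(\<lambda>x. (if i = j then c else 0)
      + - 1 * (cnj (reflection_vec c x i) * (reflection_vec c x j * (1 / cnj (c - x 3))))) \<in> Loc c"
    by (intro Loc_add Loc_mult inv Loc_Pol Pol.const Pol_cnj w assms)
  then show ?thesis using assms by (simp add: reflection_def)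
qed

lemma special_reflection_Loc:
  assumes "i < 4" "j < 4"
  shows "(\<lambda>x. special_reflection c x $$ (i, j)) \<in> Loc c"
proof -
  have "(\<lambda>x. det (reflection c x)) \<in> Loc c"
    by (rule det_closed[where m = 4]) (auto intro: Loc_add Loc_mult Loc_Pol Pol.const reflection_Loc)
  from Loc_mult[OF Loc_cnj[OF this] reflection_Loc[OF assms]] reflection_Loc[OF assms]
  show ?thesis
    using assms carrier_matD[OF reflection_carrier(1)[of c]] unfolding special_reflection_def
    by (cases "i = 0") (auto simp: index_mat_multrow)
qed

lemma mon_span_section_Loc:
  assumes "f \<in> mon_span 4" "c * cnj c = 1"
  shows "(\<lambda>x. f (special_reflection c x)) \<in> Loc c"
  using assms(1)
proof (induction rule: mon_span.induct)
  case (mon L)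
  then have "(\<lambda>x. \<Prod>ij\<leftarrow>L. special_reflection c x $$ ij) \<in> Loc c"
  proof (induction L)
    case Nil
    show ?case using Loc_Pol[OF Pol.const[of 1]] by simp
  next
    case (Cons ij L)
    then obtain i j where ij: "ij = (i, j)" "i < 4" "j < 4" by auto
    from Loc_mult[OF special_reflection_Loc[OF ij(2,3)] Cons.IH] show ?case by (simp add: ij)
  qed
  then show ?case
    by (rule Loc_cong) (simp add: entry_mon_def special_reflection_SU assms(2))
next
  case (add f g)
  show ?case
    by (rule Loc_cong[OF Loc_add[OF add.IH]]) (simp add: special_reflection_SU assms(2))
next
  case (smult f k)
  show ?case
    by (rule Loc_cong[OF Loc_mult[OF Loc_Pol[OF Pol.const[of k]] smult.IH]]) (simp add: special_reflection_SU assms(2))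
qed

text \<open>
  The polynomials \<open>g\<close> for which \<open>g f\<close> is polynomial form an ideal containing a power of
  \<open>pole c\<close> for every \<open>c\<close> on the unit circle, and \<open>pole 1\<close>, \<open>pole (-1)\<close>, \<open>pole \<i>\<close> generate the unit ideal.
\<close>

lemma invariant_polynomial:
  assumes f: "f \<in> mon_span 4"
    and inv: "\<And>h U. h \<in> SU 3 \<Longrightarrow> U \<in> SU 4 \<Longrightarrow> f (block_embed h * U) = f U"
  shows "\<exists>p\<in>Pol. \<forall>U\<in>SU 4. f U = p (last_row U)"
proof -
  define J where "J = {g \<in> Pol. \<exists>p\<in>Pol. \<forall>U\<in>SU 4. g (last_row U) * f U = p (last_row U)}"
  have JI: "g \<in> J" if "g \<in> Pol" "p \<in> Pol" "\<And>U. U \<in> SU 4 \<Longrightarrow> g (last_row U) * f U = p (last_row U)" for g p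
    unfolding J_def using that by auto
  have J_add: "(\<lambda>x. g x + g' x) \<in> J" if g: "g \<in> J" "g' \<in> J" for g g'
  proof -
    obtain p where "p \<in> Pol" "g \<in> Pol" "\<forall>U\<in>SU 4. g (last_row U) * f U = p (last_row U)"
      using g(1) unfolding J_def by auto
    moreover obtain q where "q \<in> Pol" "g' \<in> Pol" "\<forall>U\<in>SU 4. g' (last_row U) * f U = q (last_row U)"
      using g(2) unfolding J_def by auto
    ultimately show ?thesis
      unfolding J_def by (auto intro!: Pol.add bexI[of _ "\<lambda>x. p x + q x"] simp: ring_distribs)
  qed
  have J_mult: "(\<lambda>x. a x * g x) \<in> J" if g: "g \<in> J" and a: "a \<in> Pol" for g a
  proof -
    obtain p where "p \<in> Pol" "g \<in> Pol" "\<forall>U\<in>SU 4. g (last_row U) * f U = p (last_row U)"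
      using g unfolding J_def by auto
    then show ?thesis
      unfolding J_def using a by (auto intro!: Pol.mult bexI[of _ "\<lambda>x. a x * p x"] simp: mult.assoc)
  qed
  have J_sum: "(\<lambda>x. \<Sum>i\<in>I. g i x) \<in> J" if "finite I" "\<And>i. i \<in> I \<Longrightarrow> g i \<in> J" for I :: "nat set" and g
    using that
  proof (induction I rule: finite_induct)
    case empty
    have "(\<lambda>x. 0) \<in> J" unfolding J_def by (auto intro!: Pol.const bexI[of _ "\<lambda>x. 0"])
    then show ?case by simp
  qed (auto intro: J_add)
  \<comment> \<open>The radical of \<open>J\<close>. Each pole lies in it whatever exponent its
    denominators require, and 1 in the radical already means 1 in \<open>J\<close>.\<close>
  define R where "R = {g \<in> Pol. \<exists>n. (\<lambda>x. g x ^ n) \<in> J}"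
  have R_add: "(\<lambda>x. a x + b x) \<in> R" if a: "a \<in> R" and b: "b \<in> R" for a b
  proof -
    obtain n m where n: "(\<lambda>x. a x ^ n) \<in> J" and m: "(\<lambda>x. b x ^ m) \<in> J" and P: "a \<in> Pol" "b \<in> Pol"
      using a b unfolding R_def by blast
    \<comment> \<open>Every term of the binomial expansion contains \<open>a x ^ n\<close> or
      \<open>b x ^ m\<close>.\<close>
    have "(\<lambda>x. of_nat ((n + m) choose k) * a x ^ k * b x ^ (n + m - k)) \<in> J" if "k \<le> n + m" for k
    proof (cases "n \<le> k")
      case True
      have "(\<lambda>x. (of_nat ((n + m) choose k) * (a x ^ (k - n) * b x ^ (n + m - k))) * a x ^ n) \<in> J"
        by (intro J_mult[OF n] Pol.mult Pol.const Pol_power P)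
      moreover have "a x ^ k = a x ^ (k - n) * a x ^ n" for x
        using True by (simp add: power_add[symmetric])
      ultimately show ?thesis by (simp add: ac_simps)
    next
      case False
      have "(\<lambda>x. (of_nat ((n + m) choose k) * (a x ^ k * b x ^ (n - k))) * b x ^ m) \<in> J"
        by (intro J_mult[OF m] Pol.mult Pol.const Pol_power P)
      moreover have "b x ^ (n + m - k) = b x ^ (n - k) * b x ^ m" for x
        using False by (simp add: power_add[symmetric])
      ultimately show ?thesis by (simp add: ac_simps)
    qed
    then have "(\<lambda>x. \<Sum>k\<in>{..n + m}. of_nat ((n + m) choose k) * a x ^ k * b x ^ (n + m - k)) \<in> J"
      by (intro J_sum) auto
    then have "(\<lambda>x. (a x + b x) ^ (n + m)) \<in> J" unfolding binomial_ring .
    then show ?thesis unfolding R_def using Pol.add[OF P] by blast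
  qed
  have R_mult: "(\<lambda>x. a x * b x) \<in> R" if a: "a \<in> Pol" and b: "b \<in> R" for a b
  proof -
    obtain m where m: "(\<lambda>x. b x ^ m) \<in> J" and P: "b \<in> Pol" using b unfolding R_def by blast
    have "(\<lambda>x. (a x * b x) ^ m) \<in> J"
      unfolding power_mult_distrib by (rule J_mult[OF m Pol_power[OF a]])
    then show ?thesis unfolding R_def using Pol.mult[OF a P] by blast
  qed
  have R_pole: "pole c \<in> R" if c: "c * cnj c = 1" for c
  proof -
    obtain n p where p: "p \<in> Pol"
      "\<And>x. x \<in> S7 \<Longrightarrow> x 3 \<noteq> c \<Longrightarrow> f (special_reflection c x) * pole c x ^ n = p x"
      using mon_span_section_Loc[OF f c] by (rule LocE) (rule that)
    \<comment> \<open>The additional factor makes both sides vanish where the last entry equals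
      \<open>c\<close>, a place about which membership in \<open>Loc c\<close> says nothing.\<close>
    have "pole c (last_row U) ^ Suc n * f U = pole c (last_row U) * p (last_row U)" if U: "U \<in> SU 4" for U
    proof (cases "last_row U 3 = c")
      case True
      then show ?thesis by (simp add: pole_def)
    next
      case False
      let ?V = "special_reflection c (last_row U)"
      have V: "?V \<in> SU 4" by (rule special_reflection_SU[OF last_row_S7[OF U] c False])
      have "U $$ (3, j) = ?V $$ (3, j)" if "j < 4" for j
        using special_reflection_last_row[of "last_row U", OF False that] by (simp add: last_row_def)
      then obtain h where "h \<in> SU 3" "U = block_embed h * ?V" using same_last_row[OF U V] by blast
      then have "f U = f ?V" using inv[OF _ V] by metis
      then show ?thesis using p(2)[OF last_row_S7[OF U] False] by (simp add: ac_simps)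
    qed
    then have "(\<lambda>x. pole c x ^ Suc n) \<in> J"
      by (intro JI[OF Pol_power[OF pole_Pol] Pol.mult[OF pole_Pol p(1)]])
    then show ?thesis unfolding R_def using pole_Pol by blast
  qed
  have z: "(\<lambda>x. x 3) \<in> Pol" "(\<lambda>x. cnj (x 3)) \<in> Pol" by (intro Pol.intros, simp)+
  text \<open>With \<open>z = x\<^sub>3\<close> and \<open>s = 1 + z z\<^sup>*\<close> the three poles are \<open>s - (z + z\<^sup>*)\<close>, \<open>s + (z + z\<^sup>*)\<close> and
    \<open>s + \<i> (z - z\<^sup>*)\<close>, so \<open>1 = s - z\<^sup>* z\<close> is a combination of them.\<close>
  let ?s = "\<lambda>x. 1 / 2 * pole 1 x + 1 / 2 * pole (- 1) x"
  let ?z = "\<lambda>x. (1 / 4 * pole (- 1) x + - 1 / 4 * pole 1 x) + - \<i> / 2 * (pole \<i> x + - 1 * ?s x)"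
  have s: "?s \<in> R" by (intro R_add R_mult R_pole Pol.const) auto
  have "(\<lambda>x. ?s x + (- 1 * cnj (x 3)) * ?z x) \<in> R"
    by (intro R_add[OF s] R_mult R_add R_pole Pol.mult Pol.const z s) auto
  moreover have "?s x + (- 1 * cnj (x 3)) * ?z x = 1" for x
  proof -
    have 1: "?s x = 1 + x 3 * cnj (x 3)" by (simp add: pole_def algebra_simps)
    have 2: "pole (- 1) x - pole 1 x = 2 * (x 3 + cnj (x 3))" by (simp add: pole_def algebra_simps)
    have 3: "pole \<i> x - (1 + x 3 * cnj (x 3)) = \<i> * (x 3 - cnj (x 3))" by (simp add: pole_def algebra_simps)
    have "?z x = (pole (- 1) x - pole 1 x) / 4 - \<i> / 2 * (pole \<i> x - ?s x)"
      by (simp add: diff_divide_distrib)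
    also have "\<dots> = x 3"
      unfolding 1 2 3 by (simp add: mult.assoc[symmetric]) (simp add: field_simps)
    finally show ?thesis unfolding 1 by simp
  qed
  ultimately have "(\<lambda>x. 1) \<in> R" by simp
  then have "(\<lambda>x. 1) \<in> J" unfolding R_def by simp
  then show ?thesis unfolding J_def by simp
qed

section \<open>Polynomials vanishing on the sphere\<close>

lemma wval_mset: "wval x w = (\<Prod>a\<in>#mset w. lval x a)"
  by (induction w) auto

lemma lval_char: "lval (\<lambda>k. x k * y k) a = lval x a * lval y a"
  by (cases a) auto

text \<open>The total degree is seen at the point 2; for equal total degrees the difference of the
  two exponents is seen on the unit circle.\<close>

lemma cis_powers_separate:
  assumes "(a, b) \<noteq> (a', b' :: nat)"
  shows "\<exists>y. y ^ a * cnj y ^ b \<noteq> y ^ a' * cnj y ^ b'"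
proof (cases "a + b = a' + b'")
  case False
  have "(2::complex) ^ (a + b) \<noteq> 2 ^ (a' + b')"
  proof
    assume "(2::complex) ^ (a + b) = 2 ^ (a' + b')"
    then have "norm ((2::complex) ^ (a + b)) = norm ((2::complex) ^ (a' + b'))" by simp
    then have "(2::real) ^ (a + b) = 2 ^ (a' + b')" by (simp add: norm_power)
    with False show False by simp
  qed
  then show ?thesis by (intro exI[of _ 2]) (simp add: power_add)
next
  case True
  define d where "d = real a - real a'"
  have d: "d \<noteq> 0" using True assms by (auto simp: d_def)
  have "real b' = real a + real b - real a'" using True by linarith
  then have e: "real a - real b - (real a' - real b') = 2 * d" by (simp add: d_def)
  \<comment> \<open>On the unit circle the quotient of the two monomials depends only on the
    difference \<open>2 * d\<close> computed above; this angle makes it \<open>cis pi\<close>, that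
    is -1.\<close>
  define y where "y = cis (pi / (2 * d))"
  have y: "y ^ k * cnj y ^ l = cis (pi / (2 * d) * (real k - real l))" for k l
    by (simp add: y_def cis_cnj DeMoivre cis_mult algebra_simps) (simp add: diff_divide_distrib)
  have "y ^ a * cnj y ^ b / (y ^ a' * cnj y ^ b')
      = cis (pi / (2 * d) * (real a - real b - (real a' - real b')))"
    unfolding y by (simp only: cis_divide right_diff_distrib)
  also have "\<dots> = cis (pi / (2 * d) * (2 * d))" unfolding e ..
  also have "\<dots> = - 1" using d by simp
  finally have "y ^ a * cnj y ^ b \<noteq> y ^ a' * cnj y ^ b'"
    by (auto simp: y)
  then show ?thesis by blast
qed

lemma prod_mset_lval_single:
  "(\<Prod>a\<in>#m. lval ((\<lambda>_. 1)(j := y)) a) = y ^ count m (Gen j) * cnj y ^ count m (GenStar j)"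
proof (induction m)
  case (add a m)
  then show ?case by (cases a) (auto simp: mult_ac)
qed simp

lemma prod_mset_lval_separate:
  assumes "m \<noteq> m'"
  shows "\<exists>x. (\<Prod>a\<in>#m. lval x a) \<noteq> (\<Prod>a\<in>#m'. lval x a)"
proof -
  obtain a where "count m a \<noteq> count m' a" using assms by (meson multiset_eqI)
  moreover obtain j where "a = Gen j \<or> a = GenStar j" by (cases a) auto
  ultimately have "(count m (Gen j), count m (GenStar j)) \<noteq> (count m' (Gen j), count m' (GenStar j))" by auto
  from cis_powers_separate[OF this] show ?thesis
    unfolding prod_mset_lval_single[symmetric] by blast
qed

lemma wval_scale:
  assumes "w \<in> lists letters"
  shows "wval (\<lambda>k. complex_of_real r * x k) w = complex_of_real r ^ length w * wval x w"
  using assms by (induction w) auto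

lemma wval_cong: "w \<in> lists letters \<Longrightarrow> (\<And>k. k < 4 \<Longrightarrow> x k = y k) \<Longrightarrow> wval x w = wval y w"
  by (induction w) auto

text \<open>Undeformed values cannot distinguish words with the same letters, so only the
  coefficient sums over permutation classes are forced to vanish; these are the coefficients of
  distinct characters.\<close>

lemma wval_class_sums:
  assumes fin: "finite {w. c w \<noteq> 0}" and van: "\<And>x. lin_ext (wval x) c = 0"
  shows "(\<Sum>w | c w \<noteq> 0 \<and> mset w = m. c w) = 0"
proof (cases "m \<in> mset ` {w. c w \<noteq> 0}")
  case True
  let ?S = "{w. c w \<noteq> 0}"
  let ?C = "\<lambda>m. \<Sum>w | w \<in> ?S \<and> mset w = m. c w"
  have "?C m = 0"
  proof (rule characters_independent[where S = "mset ` ?S" and M = UNIV and op = "\<lambda>x y k. x k * y k"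
        and \<chi> = "\<lambda>m x. \<Prod>a\<in>#m. lval x a" and c = ?C])
    fix a :: "nat letter multiset" and x y :: "nat \<Rightarrow> complex"
    show "(\<Prod>a\<in>#a. lval (\<lambda>k. x k * y k) a) = (\<Prod>a\<in>#a. lval x a) * (\<Prod>a\<in>#a. lval y a)"
      by (simp only: lval_char prod_mset.distrib)
  next
    fix a :: "nat letter multiset"
    have "(\<Prod>a\<in>#a. lval (\<lambda>_. 1) a) = 1"
    proof (induction a)
      case (add b a)
      then show ?case by (cases b) auto
    qed simp
    then show "\<exists>x\<in>UNIV. (\<Prod>a\<in>#a. lval x a) \<noteq> 0" by (metis UNIV_I zero_neq_one)
  next
    fix x
    have "0 = (\<Sum>w\<in>?S. c w * wval x w)" using van[of x] by (simp add: lin_ext_def)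
    also have "\<dots> = (\<Sum>m\<in>mset ` ?S. \<Sum>w | w \<in> ?S \<and> mset w = m. c w * wval x w)"
      by (rule sum.image_gen[OF fin])
    also have "\<dots> = (\<Sum>m\<in>mset ` ?S. ?C m * (\<Prod>a\<in>#m. lval x a))"
      by (rule sum.cong[OF refl]) (simp add: sum_distrib_right wval_mset)
    finally show "(\<Sum>m\<in>mset ` ?S. ?C m * (\<Prod>a\<in>#m. lval x a)) = 0" by simp
  qed (use fin True prod_mset_lval_separate in auto)
  then show ?thesis by simp
next
  case False
  then have "{w. c w \<noteq> 0 \<and> mset w = m} = {}" by auto
  then show ?thesis by (simp only: sum.empty)
qed

text \<open>
  Multiplying monomials by powers of \<open>\<Sum> x\<^sub>k x\<^sub>k\<^sup>*\<close> gives all of them degree \<open>M\<close> or \<open>M + 1\<close>.  By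
  homogeneity and the antipodal map such a polynomial vanishes on \<open>\<complex>\<^sup>4\<close> if it does on the sphere.
\<close>

lemma sphere_vanishing:
  fixes V :: "(nat letter list \<Rightarrow> complex) set"
  assumes V_zero: "(\<lambda>_. 0) \<in> V"
    and V_add: "\<And>p q. p \<in> V \<Longrightarrow> q \<in> V \<Longrightarrow> (\<lambda>w. p w + q w) \<in> V"
    and V_smult: "\<And>k p. p \<in> V \<Longrightarrow> (\<lambda>w. k * p w) \<in> V"
    and comm: "\<And>w w'. w \<in> lists letters \<Longrightarrow> w' \<in> lists letters \<Longrightarrow> mset w = mset w' \<Longrightarrow>
      (\<lambda>v. basis_elt w v - basis_elt w' v) \<in> V"
    and sphere: "\<And>w. w \<in> lists letters \<Longrightarrow>
      (\<lambda>v. basis_elt w v - (\<Sum>k<4. basis_elt (Gen k # GenStar k # w) v)) \<in> V"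
    and c: "c \<in> carrier (monoid_algebra (free_monoid letters))"
    and van: "\<And>x. x \<in> S7 \<Longrightarrow> lin_ext (wval x) c = 0"
  shows "c \<in> V"
proof -
  let ?F = "monoid_algebra (free_monoid letters)"
  have V_sum: "(\<lambda>w. \<Sum>i\<in>I. f i w) \<in> V" if "finite I" "\<And>i. i \<in> I \<Longrightarrow> f i \<in> V" for I :: "'i set" and f
    using that by (induction I rule: finite_induct) (auto intro: V_zero V_add)
  have F_iff: "p \<in> carrier ?F \<longleftrightarrow> finite {w. p w \<noteq> 0} \<and> (\<forall>w. p w \<noteq> 0 \<longrightarrow> w \<in> lists letters)" for p
    by (auto simp: monoid_algebra_simps(1) free_monoid_def)
  define S where "S = {w. c w \<noteq> 0}"
  have S: "finite S" "S \<subseteq> lists letters" using c by (auto simp: S_def F_iff)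
  \<comment> \<open>\<open>Suc\<close> keeps \<open>M\<close> positive, so that words of length
    \<open>M\<close> or \<open>M + 1\<close> are nonempty and vanish at the origin;
    \<open>insert 0\<close> covers an empty support.\<close>
  define M where "M = Suc (Max (insert 0 (length ` S)))"
  have M: "length w \<le> Suc M" if "w \<in> S" for w
  proof -
    have "length w \<le> Max (insert 0 (length ` S))" using that S by (intro Max_ge) auto
    then show ?thesis by (simp add: M_def)
  qed
  \<comment> \<open>A word shorter than \<open>M\<close> is replaced by words two letters longer,
    still of length at most \<open>M + 1\<close>. Two target degrees are needed because this
    preserves the parity of the length.\<close>
  have homog: "\<exists>d. finite {v. d v \<noteq> 0} \<and> (\<forall>v. d v \<noteq> 0 \<longrightarrow> v \<in> lists letters \<and> length v \<in> {M, Suc M}) \<and>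
      (\<lambda>v. basis_elt w v - d v) \<in> V \<and> (\<forall>x\<in>S7. lin_ext (wval x) d = wval x w)"
    if "w \<in> lists letters" "length w \<le> Suc M" for w
    using that
  proof (induction "Suc M - length w" arbitrary: w rule: less_induct)
    case less
    show ?case
    proof (cases "length w < M")
      case False
      then have "length w \<in> {M, Suc M}" using less.prems by auto
      moreover have "finite {v. basis_elt w v \<noteq> (0::complex)}" "\<And>v. basis_elt w v \<noteq> (0::complex) \<Longrightarrow> v = w"
        by (auto simp: basis_elt_def split: if_splits)
      ultimately show ?thesis
        using less.prems V_zero by (intro exI[of _ "basis_elt w"]) auto
    next
      case True
      let ?w = "\<lambda>k::nat. Gen k # GenStar k # w"
      let ?P = "\<lambda>k d. finite {v. d v \<noteq> 0} \<and> (\<forall>v. d v \<noteq> 0 \<longrightarrow> v \<in> lists letters \<and> length v \<in> {M, Suc M}) \<and>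
        (\<lambda>v. basis_elt (?w k) v - d v) \<in> V \<and> (\<forall>x\<in>S7. lin_ext (wval x) d = wval x (?w k))"
      define d where "d k = (SOME d. ?P k d)" for k
      have d: "?P k (d k)" if "k < 4" for k
      proof -
        have "\<exists>d. ?P k d" by (rule less.hyps) (use True less.prems that in auto)
        from someI_ex[OF this] show ?thesis unfolding d_def .
      qed
      let ?d = "\<lambda>v. \<Sum>k\<in>{..<4}. d k v"
      have fin: "finite {v. ?d v \<noteq> 0}"
        using lin_ext_sum[of "{..<4}" d "\<lambda>_. 0"] d by auto
      have "lin_ext (wval x) ?d = (\<Sum>k<4. lin_ext (wval x) (d k))" for x
        using lin_ext_sum[of "{..<4}" d "wval x"] d by auto
      then have "lin_ext (wval x) ?d = wval x w" if x: "x \<in> S7" for x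
      proof -
        assume "\<And>x. lin_ext (wval x) ?d = (\<Sum>k<4. lin_ext (wval x) (d k))"
        then have "lin_ext (wval x) ?d = (\<Sum>k<4. x k * cnj (x k) * wval x w)"
          using d x by (simp add: mult.assoc)
        then show ?thesis using x by (simp add: sum_distrib_right[symmetric] S7_def)
      qed
      moreover have "v \<in> lists letters \<and> length v \<in> {M, Suc M}" if ne: "?d v \<noteq> 0" for v
      proof -
        obtain k where "k < 4" "d k v \<noteq> 0" using sum.not_neutral_contains_not_neutral[OF ne] by auto
        then show ?thesis using d by blast
      qed
      moreover have "(\<lambda>v. basis_elt w v - ?d v) \<in> V"
      proof -
        have "(\<lambda>v. (basis_elt w v - (\<Sum>k<4. basis_elt (?w k) v)) + (\<Sum>k\<in>{..<4}. basis_elt (?w k) v - d k v)) \<in> V"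
          by (intro V_add sphere V_sum less.prems) (use d in auto)
        then show ?thesis by (simp add: sum_subtractf)
      qed
      ultimately show ?thesis using fin by (intro exI[of _ ?d] conjI allI impI ballI) simp_all
    qed
  qed
  let ?P = "\<lambda>w d. finite {v. d v \<noteq> 0} \<and> (\<forall>v. d v \<noteq> 0 \<longrightarrow> v \<in> lists letters \<and> length v \<in> {M, Suc M}) \<and>
      (\<lambda>v. basis_elt w v - d v) \<in> V \<and> (\<forall>x\<in>S7. lin_ext (wval x) d = wval x w)"
  define d where "d w = (SOME d. ?P w d)" for w
  have d: "?P w (d w)" if "w \<in> S" for w
  proof -
    have "\<exists>d. ?P w d" by (rule homog) (use that S M in auto)
    from someI_ex[OF this] show ?thesis unfolding d_def .
  qed
  define e where "e v = (\<Sum>w\<in>S. c w * d w v)" for v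
  have fin_cd: "finite {v. c w * d w v \<noteq> 0}" if "w \<in> S" for w
    using d[OF that] by (auto intro: finite_subset[of _ "{v. d w v \<noteq> 0}"])
  have e_fin: "finite {v. e v \<noteq> 0}"
    using lin_ext_sum[OF S(1), of "\<lambda>w v. c w * d w v" "\<lambda>_. 0"] fin_cd unfolding e_def by blast
  have e_supp: "v \<in> lists letters \<and> length v \<in> {M, Suc M}" if ne: "e v \<noteq> 0" for v
  proof -
    obtain w where "w \<in> S" "d w v \<noteq> 0"
      using sum.not_neutral_contains_not_neutral[OF ne[unfolded e_def]] by auto
    then show ?thesis using d by blast
  qed
  have c_eq: "(\<Sum>w\<in>S. c w * basis_elt w v) = c v" for v
    using S(1) by (auto simp: basis_elt_def if_distrib S_def sum.delta cong: if_cong)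
  have diff: "(\<lambda>v. c v - e v) \<in> V"
  proof -
    have "(\<lambda>v. \<Sum>w\<in>S. c w * (basis_elt w v - d w v)) \<in> V"
      by (intro V_sum V_smult S(1)) (use d in blast)
    then show ?thesis by (simp add: e_def c_eq right_diff_distrib sum_subtractf)
  qed
  have e_S7: "lin_ext (wval x) e = 0" if x: "x \<in> S7" for x
  proof -
    have "lin_ext (wval x) e = (\<Sum>w\<in>S. lin_ext (wval x) (\<lambda>v. c w * d w v))"
      using lin_ext_sum[OF S(1), of "\<lambda>w v. c w * d w v" "wval x"] fin_cd unfolding e_def by blast
    also have "\<dots> = (\<Sum>w\<in>S. c w * wval x w)"
      by (rule sum.cong) (use d x in \<open>auto simp: lin_ext_smult\<close>)
    finally show ?thesis using van[OF x] by (simp add: lin_ext_def S_def)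
  qed
  define E where "E L x = (\<Sum>w | e w \<noteq> 0 \<and> length w = L. e w * wval x w)" for L x
  have E_split: "lin_ext (wval x) e = E M x + E (Suc M) x" for x
  proof -
    let ?A = "\<lambda>L. {w. e w \<noteq> 0 \<and> length w = L}"
    have "{w. e w \<noteq> 0} = ?A M \<union> ?A (Suc M)"
      using e_supp by auto
    moreover have "finite (?A L)" for L by (rule finite_subset[OF _ e_fin]) auto
    moreover have "?A M \<inter> ?A (Suc M) = {}" by auto
    ultimately show ?thesis
      unfolding lin_ext_def E_def by (simp only: sum.union_disjoint)
  qed
  have E_scale: "E L (\<lambda>k. complex_of_real r * x k) = complex_of_real r ^ L * E L x" for L r x
    unfolding E_def sum_distrib_left
    by (rule sum.cong) (use e_supp wval_scale in auto)
  have E_S7: "E M x = 0 \<and> E (Suc M) x = 0" if x: "x \<in> S7" for x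
  proof -
    have "(\<lambda>k. complex_of_real (- 1) * x k) \<in> S7" using x by (simp add: S7_def)
    from e_S7[OF this] have "(- 1) ^ M * (E M x - E (Suc M) x) = 0"
      unfolding E_split E_scale by (simp add: algebra_simps)
    then have "E M x = E (Suc M) x" by simp
    moreover have "E M x + E (Suc M) x = 0" using e_S7[OF x] E_split by simp
    ultimately show ?thesis by simp
  qed
  have e_all: "lin_ext (wval x) e = 0" for x
  proof -
    define r where "r = sqrt (\<Sum>k<4. (norm (x k))\<^sup>2)"
    have r2: "complex_of_real (r\<^sup>2) = (\<Sum>k<4. x k * cnj (x k))"
      by (simp add: r_def sum_nonneg complex_norm_square[symmetric])
    show ?thesis
    proof (cases "r = 0")
      case True
      then have "(\<Sum>k<4. (norm (x k))\<^sup>2) = 0" by (simp add: r_def)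
      then have x0: "x k = 0" if "k < 4" for k using that by (simp add: sum_nonneg_eq_0_iff)
      have "wval x w = 0" if "e w \<noteq> 0" for w
      proof -
        have "w \<noteq> []" "w \<in> lists letters" using e_supp[OF that] by (auto simp: M_def)
        then show ?thesis using x0 by (cases w) auto
      qed
      then show ?thesis by (simp add: lin_ext_def)
    next
      case False
      let ?y = "\<lambda>k. complex_of_real (1 / r) * x k"
      have "(\<Sum>k<4. ?y k * cnj (?y k)) = complex_of_real (1 / r\<^sup>2) * (\<Sum>k<4. x k * cnj (x k))"
        by (simp add: sum_distrib_left power2_eq_square)
      also have "\<dots> = 1" using False unfolding r2[symmetric] by simp
      finally have y: "?y \<in> S7" by (simp add: S7_def)
      have "x = (\<lambda>k. complex_of_real r * ?y k)" using False by auto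
      then have "E L x = complex_of_real r ^ L * E L ?y" for L using E_scale[of L r ?y] by simp
      then show ?thesis using E_S7[OF y] E_split[of x] by simp
    qed
  qed
  \<comment> \<open>One word for each permutation class. Modulo \<open>V\<close> every word equals
    its representative, and the coefficients collected at a representative sum to zero.\<close>
  define rep where "rep m = (SOME w. e w \<noteq> 0 \<and> mset w = m)" for m
  have rep: "e (rep (mset w)) \<noteq> 0 \<and> mset (rep (mset w)) = mset w" if "e w \<noteq> 0" for w
    unfolding rep_def by (rule someI[of _ w]) (use that in simp)
  let ?E = "{w. e w \<noteq> 0}"
  have "(\<lambda>v. \<Sum>w\<in>?E. e w * (basis_elt w v - basis_elt (rep (mset w)) v)) \<in> V"
    by (intro V_sum V_smult comm e_fin) (use rep e_supp in \<open>simp_all add: lists_eq_set\<close>)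
  moreover have "(\<Sum>w\<in>?E. e w * basis_elt w v) = e v" for v
    using e_fin by (auto simp: basis_elt_def if_distrib sum.delta cong: if_cong)
  moreover have "(\<Sum>w\<in>?E. e w * basis_elt (rep (mset w)) v) = 0" for v
  proof -
    have "(\<Sum>w\<in>?E. e w * basis_elt (rep (mset w)) v)
        = (\<Sum>m\<in>mset ` ?E. \<Sum>w | w \<in> ?E \<and> mset w = m. e w * basis_elt (rep (mset w)) v)"
      by (rule sum.image_gen[OF e_fin])
    also have "\<dots> = (\<Sum>m\<in>mset ` ?E. (\<Sum>w | e w \<noteq> 0 \<and> mset w = m. e w) * basis_elt (rep m) v)"
      by (rule sum.cong[OF refl]) (simp add: sum_distrib_right)
    also have "\<dots> = 0" by (simp add: wval_class_sums[OF e_fin e_all])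
    finally show ?thesis .
  qed
  ultimately have "e \<in> V" by (simp add: right_diff_distrib sum_subtractf)
  from V_add[OF diff this] show ?thesis by simp
qed

section \<open>Words of generators and their images\<close>

abbreviation FM :: "(complex, nat letter list \<Rightarrow> complex) module" where
  "FM \<equiv> monoid_algebra (free_monoid letters)"

abbreviation FS :: "(nat letter list \<Rightarrow> complex) star_algebra" where
  "FS \<equiv> free_star_algebra {..<4}"

lemma free_star_algebra_simps:
  "carrier FS = carrier FM" "monoid.mult FS = monoid.mult FM" "one FS = one FM"
  "zero FS = zero FM" "add FS = add FM" "module.smult FS = module.smult FM"
  "star FS p = (\<lambda>w. cnj (p (rev (map letter_star w))))"
  by (simp_all add: free_star_algebra_def module.defs star_algebra.defs)

lemma FM_carrier_iff: "p \<in> carrier FM \<longleftrightarrow> finite {w. p w \<noteq> 0} \<and> (\<forall>w. p w \<noteq> 0 \<longrightarrow> w \<in> lists letters)"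
  by (auto simp: monoid_algebra_simps(1) free_monoid_def)

lemma finite_supp_FM: "p \<in> carrier FM \<Longrightarrow> finite {w. p w \<noteq> 0}"
  by (simp add: FM_carrier_iff)

lemma FM_ring: "ring FM"
  by (rule monoid_algebra_ring[OF free_monoid_monoid])

lemma FS_ring: "ring FS"
  by (rule ring_extend_cong[OF FM_ring]) (simp_all add: free_star_algebra_simps)

lemma basis_FM: "w \<in> lists letters \<Longrightarrow> basis_elt w \<in> carrier FM"
  by (simp add: free_monoid_def)

lemma basis_FM_mult: "basis_elt u \<otimes>\<^bsub>FM\<^esub> basis_elt w = basis_elt (u @ w)"
  by (simp add: basis_elt_mult free_monoid_def)

lemma FS_minus:
  assumes "p \<in> carrier FM" "q \<in> carrier FM"
  shows "p \<ominus>\<^bsub>FS\<^esub> q = (\<lambda>w. p w - q w)"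
proof -
  interpret ring FS by (rule FS_ring)
  have m: "(\<lambda>w. - q w) \<in> carrier FM"
    using assms(2) by (simp add: FM_carrier_iff)
  have "\<ominus>\<^bsub>FS\<^esub> q = (\<lambda>w. - q w)"
    by (rule minus_equality) (use assms m in \<open>simp_all add: free_star_algebra_simps monoid_algebra_simps(3,4)\<close>)
  then show ?thesis by (simp add: a_minus_def free_star_algebra_simps monoid_algebra_simps(4))
qed

lemma letter_star_star [simp]: "letter_star (letter_star a) = a"
  by (cases a) auto

lemma rev_letter_star [simp]: "rev (map letter_star (rev (map letter_star w))) = w"
  by (simp add: rev_map comp_def)

lemma letter_star_letters [simp]: "a \<in> letters \<Longrightarrow> letter_star a \<in> letters"
  by auto

lemma rev_letter_star_lists: "w \<in> lists letters \<Longrightarrow> rev (map letter_star w) \<in> lists letters"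
  by (auto simp: lists_eq_set)

lemma star_FM_closed: assumes "p \<in> carrier FM" shows "star FS p \<in> carrier FM"
proof -
  have "{w. star FS p w \<noteq> 0} \<subseteq> (\<lambda>w. rev (map letter_star w)) ` {w. p w \<noteq> 0}"
  proof
    fix w assume "w \<in> {w. star FS p w \<noteq> 0}"
    then have "rev (map letter_star w) \<in> {w. p w \<noteq> 0}" by (simp add: free_star_algebra_simps)
    then show "w \<in> (\<lambda>w. rev (map letter_star w)) ` {w. p w \<noteq> 0}"
      by (rule image_eqI[rotated]) simp
  qed
  then have "finite {w. star FS p w \<noteq> 0}"
    using finite_supp_FM[OF assms] by (meson finite_imageI finite_subset)
  moreover have "w \<in> lists letters" if "star FS p w \<noteq> 0" for w
  proof -
    have "rev (map letter_star w) \<in> lists letters"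
      using that assms by (simp add: free_star_algebra_simps FM_carrier_iff)
    from rev_letter_star_lists[OF this] show ?thesis by simp
  qed
  ultimately show ?thesis by (simp add: FM_carrier_iff)
qed

section \<open>Deformed products of last-row letters\<close>

primrec letter_index :: "nat letter \<Rightarrow> nat" where
  "letter_index (Gen j) = j" | "letter_index (GenStar j) = j"

primrec letter_sign :: "nat letter \<Rightarrow> real" where
  "letter_sign (Gen j) = 1" | "letter_sign (GenStar j) = - 1"

text \<open>The product of the letters \<open>a\<close> and \<open>b\<close> in the deformed algebra is \<open>twist_factor \<theta> a b\<close> times
  their undeformed product; \<open>word_phase\<close> is the corresponding factor of a word.\<close>

definition twist_factor :: "real \<Rightarrow> nat letter \<Rightarrow> nat letter \<Rightarrow> complex" where
  "twist_factor \<theta> a b = cis (- (pi * (letter_sign a * letter_sign b * \<sigma> \<theta> (letter_index a) (letter_index b))))"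

primrec word_phase :: "real \<Rightarrow> nat letter list \<Rightarrow> complex" where
  "word_phase \<theta> [] = 1"
| "word_phase \<theta> (a # w) = (\<Prod>b\<leftarrow>w. twist_factor \<theta> a b) * word_phase \<theta> w"

lemma \<sigma>_antisym: "\<sigma> \<theta> j i = - \<sigma> \<theta> i j"
  by (auto simp: \<sigma>_def)

lemma \<sigma>_self [simp]: "\<sigma> \<theta> i i = 0"
  by (auto simp: \<sigma>_def)

lemma twist_factor_commute: "twist_factor \<theta> b a = cnj (twist_factor \<theta> a b)"
  by (simp add: twist_factor_def cis_cnj \<sigma>_antisym[of \<theta> "letter_index b"] mult.commute)

lemma twist_factor_norm: "twist_factor \<theta> a b * cnj (twist_factor \<theta> a b) = 1"
  by (simp add: twist_factor_def cis_cnj cis_mult)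

lemma prod_twist_factor_norm:
  "(\<Prod>b\<leftarrow>w. twist_factor \<theta> a b) * cnj (\<Prod>b\<leftarrow>w. twist_factor \<theta> a b) = 1"
proof (induction w)
  case (Cons b w)
  then show ?case using twist_factor_norm[of \<theta> a b] by (simp add: mult_ac)
qed simp

lemma word_phase_norm: "word_phase \<theta> w * cnj (word_phase \<theta> w) = 1"
proof (induction w)
  case (Cons a w)
  have "word_phase \<theta> (a # w) * cnj (word_phase \<theta> (a # w))
      = ((\<Prod>b\<leftarrow>w. twist_factor \<theta> a b) * cnj (\<Prod>b\<leftarrow>w. twist_factor \<theta> a b)) * (word_phase \<theta> w * cnj (word_phase \<theta> w))"
    by (simp add: mult_ac)
  then show ?case unfolding prod_twist_factor_norm Cons.IH by simp
qed simp

lemma prod_twist_factor_mset: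
  "mset w = mset w' \<Longrightarrow> (\<Prod>b\<leftarrow>w. twist_factor \<theta> a b) = (\<Prod>b\<leftarrow>w'. twist_factor \<theta> a b)"
  by (metis mset_map prod_mset_prod_list)

context SU3_action
begin

definition gen_elt :: "nat letter \<Rightarrow> complex mat \<Rightarrow> complex" where
  "gen_elt a = (\<lambda>U\<in>SU 4. lval (last_row U) a)"

text \<open>Closed form of the deformed product of the letters; \<open>word_elt_Cons\<close> and
  \<open>word_elt_append\<close> show that it is this product.\<close>

definition word_elt :: "nat letter list \<Rightarrow> complex mat \<Rightarrow> complex" where
  "word_elt w = (\<lambda>U\<in>SU 4. word_phase \<theta> w * wval (last_row U) w)"

lemma gen_elt_coord: "j < 4 \<Longrightarrow> gen_elt (Gen j) = coord 4 3 j"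
  "j < 4 \<Longrightarrow> gen_elt (GenStar j) = (\<lambda>U\<in>SU 4. cnj (coord 4 3 j U))"
  by (simp_all add: gen_elt_def coord_def last_row_def)

text \<open>Index 3 pairs trivially with every weight, so the twist acts on the last row by column
  phases alone; a conjugated letter has the negated weight, hence the sign. Only the last row of
  \<open>V\<close> matters afterwards, which allows one statement for both kinds of letters.\<close>

lemma gen_elt_mult:
  assumes a: "a \<in> letters" and f: "f \<in> mon_span 4" and U: "U \<in> SU 4"
  shows "\<exists>V\<in>SU 4. A.dm (gen_elt a) f U = gen_elt a U * f V \<and>
    (\<forall>j<4. V $$ (3, j) = cis (- (pi * (letter_sign a * \<sigma> \<theta> (letter_index a) j))) * U $$ (3, j))"
proof (cases a)
  case (Gen l)
  then have l: "l < 4" using a by auto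
  show ?thesis
  proof (rule bexI[of _ "tw4 3 l U"])
    show "A.dm (gen_elt a) f U = gen_elt a U * f (tw4 3 l U) \<and>
      (\<forall>j<4. tw4 3 l U $$ (3, j) = cis (- (pi * (letter_sign a * \<sigma> \<theta> (letter_index a) j))) * U $$ (3, j))"
      using l U coord_mult[OF _ l f U, of 3]
      by (simp add: Gen gen_elt_coord tw4_index \<sigma>_3) (simp add: coord_def)
  qed (rule A.twist_SU[OF U])
next
  case (GenStar l)
  then have l: "l < 4" using a by auto
  let ?a = "(- wvec 4 3, - wvec 4 l)"
  have iso: "gen_elt a \<in> isotypic 4 ?a"
    using A.isotypic_cnj[OF coord_isotypic(1)[of 4 3 l] A.wvec_W] l by (simp add: GenStar gen_elt_coord)
  have W: "?a \<in> A.W" using A.wvec_W[of 3 l] by (simp add: A.W_iff)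
  have bil: "bil 3 \<Lambda> (- wvec 4 i) (wvec 4 j) = - \<sigma> \<theta> i j" if "i < 4" "j < 4" for i j
    using A.bil_uminus(1)[of "wvec 4 i" "wvec 4 j"] wvec_carrier[of 4 i] that by (simp add: bil_wvec_4)
  show ?thesis
  proof (rule bexI[of _ "A.twist ?a U"])
    have "A.twist ?a U $$ (3, j) = cis (- (pi * (letter_sign a * \<sigma> \<theta> (letter_index a) j))) * U $$ (3, j)" if "j < 4" for j
      using A.twist_index[OF SU_carrier[OF U], of 3 j "- wvec 4 3" "- wvec 4 l"] that l
      by (simp add: bil \<sigma>_3 GenStar)
    then show "A.dm (gen_elt a) f U = gen_elt a U * f (A.twist ?a U) \<and>
      (\<forall>j<4. A.twist ?a U $$ (3, j) = cis (- (pi * (letter_sign a * \<sigma> \<theta> (letter_index a) j))) * U $$ (3, j))"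
      using A.dm_homogeneous[OF iso W f U] by blast
  qed (rule A.twist_SU[OF U])
qed

lemma gen_elt_span: "a \<in> letters \<Longrightarrow> gen_elt a \<in> mon_span 4"
  using mon_span_cnj[OF coord_isotypic(2)] coord_isotypic(2)[of 4 3]
  by (cases a) (auto simp: gen_elt_coord)

lemma word_elt_Nil: "word_elt [] = (\<lambda>U\<in>SU 4. 1)"
  by (simp add: word_elt_def)

text \<open>Membership in the span is a hypothesis at this stage because
  \<open>word_elt_span\<close> is itself derived from this recursion.\<close>

lemma word_elt_Cons_aux:
  assumes a: "a \<in> letters" and w: "w \<in> lists letters" and span: "word_elt w \<in> mon_span 4"
  shows "A.dm (gen_elt a) (word_elt w) = word_elt (a # w)"
proof (rule A.SU_ext)
  fix U assume U: "U \<in> SU 4"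
  obtain V where V: "V \<in> SU 4" "A.dm (gen_elt a) (word_elt w) U = gen_elt a U * word_elt w V"
    "\<And>j. j < 4 \<Longrightarrow> V $$ (3, j) = cis (- (pi * (letter_sign a * \<sigma> \<theta> (letter_index a) j))) * U $$ (3, j)"
    using gen_elt_mult[OF a span U] by blast
  have l: "lval (last_row V) b = twist_factor \<theta> a b * lval (last_row U) b" if "b \<in> letters" for b
    using that V(3) by (cases b) (auto simp: last_row_def twist_factor_def cis_cnj mult_ac)
  have "wval (last_row V) w = (\<Prod>b\<leftarrow>w. twist_factor \<theta> a b) * wval (last_row U) w"
    using w by (induction w) (simp_all add: l mult_ac)
  then show "A.dm (gen_elt a) (word_elt w) U = word_elt (a # w) U"
    using U V(1) unfolding V(2) by (simp add: word_elt_def gen_elt_def mult_ac)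
qed (simp_all add: word_elt_def)

lemma word_elt_span: "w \<in> lists letters \<Longrightarrow> word_elt w \<in> mon_span 4"
proof (induction w)
  case Nil
  show ?case by (simp add: word_elt_Nil mon_span_const)
next
  case (Cons a w)
  then have "A.dm (gen_elt a) (word_elt w) \<in> mon_span 4"
    by (intro A.dm_closed gen_elt_span) auto
  then show ?case using Cons word_elt_Cons_aux[of a w] by simp
qed

lemma word_elt_Cons:
  "a \<in> letters \<Longrightarrow> w \<in> lists letters \<Longrightarrow> word_elt (a # w) = A.dm (gen_elt a) (word_elt w)"
  by (rule word_elt_Cons_aux[symmetric]) (auto intro: word_elt_span)

lemma word_elt_append:
  assumes w': "w' \<in> lists letters" and w: "w \<in> lists letters"
  shows "word_elt (w @ w') = A.dm (word_elt w) (word_elt w')"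
  using w
proof (induction w)
  case Nil
  show ?case by (simp add: word_elt_Nil A.dm_one_left word_elt_span[OF w'])
next
  case (Cons a w)
  then have "a \<in> letters" "w \<in> lists letters" by auto
  then show ?case
    using Cons.IH w' by (simp add: word_elt_Cons A.dm_assoc gen_elt_span word_elt_span)
qed

lemma word_elt_single: "word_elt [a] = gen_elt a"
  by (simp add: word_elt_def gen_elt_def)

lemma cnj_gen_elt: "(\<lambda>U\<in>SU 4. cnj (gen_elt a U)) = gen_elt (letter_star a)"
  by (cases a) (simp_all add: gen_elt_def)

text \<open>Obtained from anti-multiplicativity of the star, so no phases of reversed words need to
  be compared.\<close>

lemma cnj_word_elt:
  "w \<in> lists letters \<Longrightarrow> (\<lambda>U\<in>SU 4. cnj (word_elt w U)) = word_elt (rev (map letter_star w))"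
proof (induction w)
  case Nil
  show ?case by (simp add: word_elt_Nil)
next
  case (Cons a w)
  then have a: "a \<in> letters" and w: "w \<in> lists letters" by auto
  have "(\<lambda>U\<in>SU 4. cnj (word_elt (a # w) U)) = (\<lambda>U\<in>SU 4. cnj (A.dm (gen_elt a) (word_elt w) U))"
    by (simp only: word_elt_Cons[OF a w])
  also have "\<dots> = A.dm (\<lambda>U\<in>SU 4. cnj (word_elt w U)) (\<lambda>U\<in>SU 4. cnj (gen_elt a U))"
    by (rule A.dm_cnj[OF gen_elt_span[OF a] word_elt_span[OF w]])
  also have "\<dots> = A.dm (word_elt (rev (map letter_star w))) (word_elt [letter_star a])"
    by (simp only: Cons.IH[OF w] cnj_gen_elt word_elt_single)
  also have "\<dots> = word_elt (rev (map letter_star w) @ [letter_star a])"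
    by (rule word_elt_append[symmetric]) (use a rev_letter_star_lists[OF w] in auto)
  finally show ?case by simp
qed

section \<open>The homomorphism from the free star-algebra\<close>

definition \<Phi> :: "(nat letter list \<Rightarrow> complex) \<Rightarrow> complex mat \<Rightarrow> complex" where
  "\<Phi> p = (\<lambda>U\<in>SU 4. lin_ext (\<lambda>w. word_elt w U) p)"

text \<open>Lets linear forms pass through the finite combination \<open>\<Phi> p\<close>.
  Multiplication by a fixed element followed by evaluation at a point gives multiplicativity of
  \<open>\<Phi>\<close>; the zero form gives membership in the span.\<close>

lemma \<Phi>_linear_form:
  assumes e: "linear_form (deformed_SU 4 \<Lambda>) e" and p: "p \<in> carrier FM"
  shows "\<Phi> p \<in> mon_span 4 \<and> e (\<Phi> p) = lin_ext (\<lambda>w. e (word_elt w)) p"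
proof -
  have e_zero: "e (\<lambda>U\<in>SU 4. 0) = 0" using T.linear_form_zero(2)[OF e] by simp
  have "(\<lambda>U\<in>SU 4. \<Sum>w\<in>S. p w * word_elt w U) \<in> mon_span 4 \<and>
      e (\<lambda>U\<in>SU 4. \<Sum>w\<in>S. p w * word_elt w U) = (\<Sum>w\<in>S. p w * e (word_elt w))"
    if "finite S" "S \<subseteq> lists letters" for S
    using that
  proof (induction S rule: finite_induct)
    case empty
    then show ?case by (simp add: mon_span_const e_zero)
  next
    case (insert w S)
    let ?f = "\<lambda>U\<in>SU 4. p w * word_elt w U" and ?g = "\<lambda>U\<in>SU 4. \<Sum>w\<in>S. p w * word_elt w U"
    have w: "word_elt w \<in> mon_span 4" using insert.prems by (intro word_elt_span) auto
    then have f: "?f \<in> mon_span 4" "e ?f = p w * e (word_elt w)"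
      using e by (auto simp: linear_form_def intro: mon_span.smult)
    have g: "?g \<in> mon_span 4" "e ?g = (\<Sum>w\<in>S. p w * e (word_elt w))" using insert by auto
    have "(\<lambda>U\<in>SU 4. \<Sum>w\<in>insert w S. p w * word_elt w U) = (\<lambda>U\<in>SU 4. ?f U + ?g U)"
      using insert.hyps by simp
    moreover have "e (\<lambda>U\<in>SU 4. ?f U + ?g U) = e ?f + e ?g"
      using e f g by (simp only: linear_form_def A.deformed_SU_simps)
    ultimately show ?case using f g mon_span.add[OF f(1) g(1)] insert.hyps by simp
  qed
  from this[of "{w. p w \<noteq> 0}"] show ?thesis
    using p by (auto simp: \<Phi>_def lin_ext_def FM_carrier_iff)
qed

lemma \<Phi>_span: "p \<in> carrier FM \<Longrightarrow> \<Phi> p \<in> mon_span 4"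
  using \<Phi>_linear_form[of "\<lambda>_. 0"] by (simp add: linear_form_def)

lemma \<Phi>_extensional [simp]: "\<Phi> p \<in> extensional (SU 4)"
  by (simp add: \<Phi>_def)

lemma \<Phi>_add: "p \<in> carrier FM \<Longrightarrow> q \<in> carrier FM \<Longrightarrow> \<Phi> (p \<oplus>\<^bsub>FM\<^esub> q) = (\<lambda>U\<in>SU 4. \<Phi> p U + \<Phi> q U)"
  by (simp add: \<Phi>_def monoid_algebra_simps(4) lin_ext_add finite_supp_FM)

lemma \<Phi>_diff: "p \<in> carrier FM \<Longrightarrow> q \<in> carrier FM \<Longrightarrow> \<Phi> (\<lambda>w. p w - q w) = (\<lambda>U\<in>SU 4. \<Phi> p U - \<Phi> q U)"
  by (simp add: \<Phi>_def lin_ext_diff finite_supp_FM)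

lemma \<Phi>_smult: "\<Phi> (c \<odot>\<^bsub>FM\<^esub> p) = (\<lambda>U\<in>SU 4. c * \<Phi> p U)"
  by (simp add: \<Phi>_def monoid_algebra_simps(5) lin_ext_smult)

lemma \<Phi>_basis: "\<Phi> (basis_elt w) = word_elt w"
  by (rule A.SU_ext) (simp_all add: \<Phi>_def word_elt_def)

lemma \<Phi>_mult:
  assumes p: "p \<in> carrier FM" and q: "q \<in> carrier FM"
  shows "\<Phi> (p \<otimes>\<^bsub>FM\<^esub> q) = A.dm (\<Phi> p) (\<Phi> q)"
proof (rule A.SU_ext)
  fix U assume U: "U \<in> SU 4"
  have left: "linear_form (deformed_SU 4 \<Lambda>) (\<lambda>f. A.dm f g U)" if "g \<in> mon_span 4" for g
    using U that by (simp add: linear_form_def A.dm_add_left A.dm_smult_left)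
  have right: "linear_form (deformed_SU 4 \<Lambda>) (\<lambda>g. A.dm f g U)" if "f \<in> mon_span 4" for f
    using U that by (simp add: linear_form_def A.dm_add_right A.dm_smult_right)
  have "A.dm (\<Phi> p) (\<Phi> q) U = lin_ext (\<lambda>w. A.dm (word_elt w) (\<Phi> q) U) p"
    using \<Phi>_linear_form[OF left[OF \<Phi>_span[OF q]] p] by simp
  also have "\<dots> = lin_ext (\<lambda>w. lin_ext (\<lambda>w'. word_elt (w @ w') U) q) p"
  proof (rule lin_ext_cong)
    fix w assume "p w \<noteq> 0"
    then have w: "w \<in> lists letters" using p by (simp add: FM_carrier_iff)
    have "A.dm (word_elt w) (\<Phi> q) U = lin_ext (\<lambda>w'. A.dm (word_elt w) (word_elt w') U) q"
      using \<Phi>_linear_form[OF right[OF word_elt_span[OF w]] q] by simp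
    also have "\<dots> = lin_ext (\<lambda>w'. word_elt (w @ w') U) q"
      by (rule lin_ext_cong) (use q w in \<open>simp add: FM_carrier_iff word_elt_append\<close>)
    finally show "A.dm (word_elt w) (\<Phi> q) U = lin_ext (\<lambda>w'. word_elt (w @ w') U) q" .
  qed
  also have "\<dots> = \<Phi> (p \<otimes>\<^bsub>FM\<^esub> q) U"
    using U unfolding \<Phi>_def by (simp add: lin_ext_mult[OF finite_supp_FM[OF p] finite_supp_FM[OF q]]) (simp add: free_monoid_def)
  finally show "\<Phi> (p \<otimes>\<^bsub>FM\<^esub> q) U = A.dm (\<Phi> p) (\<Phi> q) U" by simp
qed simp_all

lemma \<Phi>_star:
  assumes p: "p \<in> carrier FM"
  shows "\<Phi> (star FS p) = (\<lambda>U\<in>SU 4. cnj (\<Phi> p U))"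
proof (rule A.SU_ext)
  fix U assume U: "U \<in> SU 4"
  let ?r = "\<lambda>w. rev (map letter_star w)"
  have "\<Phi> (star FS p) U = (\<Sum>w | p (?r w) \<noteq> 0. cnj (p (?r w)) * word_elt w U)"
    using U by (simp add: \<Phi>_def lin_ext_def free_star_algebra_simps)
  also have "\<dots> = (\<Sum>w | p w \<noteq> 0. cnj (p w) * word_elt (?r w) U)"
    by (rule sum.reindex_bij_witness[of _ ?r ?r]) simp_all
  also have "\<dots> = (\<Sum>w | p w \<noteq> 0. cnj (p w * word_elt w U))"
  proof (rule sum.cong[OF refl])
    fix w assume "w \<in> {w. p w \<noteq> 0}"
    then have "w \<in> lists letters" using p by (simp add: FM_carrier_iff)
    from fun_cong[OF cnj_word_elt[OF this], of U]
    show "cnj (p w) * word_elt (?r w) U = cnj (p w * word_elt w U)" using U by simp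
  qed
  also have "\<dots> = (\<lambda>U\<in>SU 4. cnj (\<Phi> p U)) U"
    using U by (simp add: \<Phi>_def lin_ext_def)
  finally show "\<Phi> (star FS p) U = (\<lambda>U\<in>SU 4. cnj (\<Phi> p U)) U" .
qed simp_all

section \<open>The sphere relations and the ideal they generate\<close>

abbreviation "\<Theta> \<equiv> mat_of_rows_list 4
        [[0, - \<theta>, \<theta>, 0],
         [\<theta>, 0, - \<theta>, 0],
         [- \<theta>, \<theta>, 0, 0],
         [0, 0, 0, 0]]"

lemma \<Theta>_index: "j < 4 \<Longrightarrow> k < 4 \<Longrightarrow> \<Theta> $$ (j, k) = - \<sigma> \<theta> j k"
proof -
  assume "j < 4" "k < 4"
  then have "j \<in> {0, 1, 2, 3}" "k \<in> {0, 1, 2, 3}" by auto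
  then show ?thesis by (auto simp: mat_of_rows_list_def \<sigma>_def numeral_2_eq_2 numeral_3_eq_3)
qed

abbreviation "Rel \<equiv> sphere_relations 4 \<Theta>"

text \<open>A common shape for all commutation relations, normality included: for a letter and its
  adjoint \<open>\<sigma>\<close> vanishes and the factor is 1.\<close>

definition commutator_rel :: "nat letter \<Rightarrow> nat letter \<Rightarrow> nat letter list \<Rightarrow> complex" where
  "commutator_rel a b = (\<lambda>w. basis_elt [a, b] w - (twist_factor \<theta> a b)\<^sup>2 * basis_elt [b, a] w)"

definition norm_rel :: "nat letter list \<Rightarrow> complex" where
  "norm_rel = (\<lambda>w. (\<Sum>k<4. basis_elt [Gen k, GenStar k] w) - basis_elt [] w)"

lemma star_basis: "star FS (basis_elt w) = basis_elt (rev (map letter_star w))"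
proof
  fix v
  have "rev (map letter_star v) = w \<longleftrightarrow> v = rev (map letter_star w)" by auto
  then show "star FS (basis_elt w) v = basis_elt (rev (map letter_star w)) v"
    by (simp add: free_star_algebra_simps basis_elt_def)
qed

lemma FS_finsum_basis:
  fixes f :: "nat \<Rightarrow> nat letter list"
  assumes "\<And>k. k < 4 \<Longrightarrow> f k \<in> lists letters"
  shows "(\<Oplus>\<^bsub>FS\<^esub>k\<in>{..<4}. basis_elt (f k)) = (\<lambda>w. \<Sum>k<4. basis_elt (f k) w)"
proof -
  interpret ring FS by (rule FS_ring)
  have "(\<Oplus>\<^bsub>FS\<^esub>k\<in>S. basis_elt (f k)) = (\<lambda>w. \<Sum>k\<in>S. basis_elt (f k) w)"
    if "finite S" "S \<subseteq> {..<4}" for S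
    using that
  proof (induction S rule: finite_induct)
    case empty
    then show ?case by (simp add: free_star_algebra_simps monoid_algebra_simps(3))
  next
    case (insert k S)
    then have c: "basis_elt (f i) \<in> carrier FS" if "i \<in> insert k S" for i
      unfolding free_star_algebra_simps(1) by (intro basis_FM assms) (use that insert.prems in auto)
    show ?case
      using insert c by (subst finsum_insert) (auto simp: free_star_algebra_simps(5) monoid_algebra_simps(4))
  qed
  then show ?thesis by simp
qed

lemma twist_factor_square:
  "(twist_factor \<theta> a b)\<^sup>2 = cis (- 2 * pi * (letter_sign a * letter_sign b * \<sigma> \<theta> (letter_index a) (letter_index b)))"
  by (simp add: twist_factor_def power2_eq_square cis_mult) (simp add: mult_ac)

lemma Collect_cong_1: "(\<And>j. P j \<Longrightarrow> f j = g j) \<Longrightarrow> {f j |j. P j} = {g j |j. P j}"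
  unfolding setcompr_eq_image by (rule image_cong) auto

lemma Collect_cong_2: "(\<And>j k. P j k \<Longrightarrow> f j k = g j k) \<Longrightarrow> {f j k |j k. P j k} = {g j k |j k. P j k}"
  by (rule Collect_cong) (metis)

lemma Gen_letters: "j < 4 \<Longrightarrow> Gen j \<in> letters" and GenStar_letters: "j < 4 \<Longrightarrow> GenStar j \<in> letters"
  by auto

lemma basis_pair: "a \<in> letters \<Longrightarrow> b \<in> letters \<Longrightarrow> basis_elt [a, b] \<in> carrier FM"
  by (intro basis_FM) auto

lemma smult_basis_pair: "a \<in> letters \<Longrightarrow> b \<in> letters \<Longrightarrow> (\<lambda>w. c * basis_elt [a, b] w) \<in> carrier FM"
  by (auto simp: FM_carrier_iff basis_elt_def)

lemma Rel_eq:
  "Rel = {commutator_rel (Gen j) (GenStar j) | j. j < 4} \<union>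
    {commutator_rel (Gen j) (Gen k) | j k. j < 4 \<and> k < 4} \<union>
    {commutator_rel (Gen j) (GenStar k) | j k. j < 4 \<and> k < 4} \<union> {norm_rel}"
proof -
  have m: "basis_elt [a] \<otimes>\<^bsub>FS\<^esub> basis_elt [b] = basis_elt [a, b]" for a b
    by (simp add: free_star_algebra_simps(2) basis_FM_mult)
  have zs: "star FS (basis_elt [Gen j]) = basis_elt [GenStar j]" for j
    by (simp add: star_basis)
  have comm: "basis_elt [a, b] \<ominus>\<^bsub>FS\<^esub> c \<odot>\<^bsub>FS\<^esub> basis_elt [b, a] = commutator_rel a b"
    if "a \<in> letters" "b \<in> letters" "c = (twist_factor \<theta> a b)\<^sup>2" for a b c
    unfolding free_star_algebra_simps(6) monoid_algebra_simps(5) commutator_rel_def that(3)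
    by (rule FS_minus[OF basis_pair[OF that(1,2)] smult_basis_pair[OF that(2,1)]])
  have comm1: "basis_elt [Gen j, GenStar j] \<ominus>\<^bsub>FS\<^esub> basis_elt [GenStar j, Gen j]
      = commutator_rel (Gen j) (GenStar j)" if "j < 4" for j
    unfolding FS_minus[OF basis_pair basis_pair, OF Gen_letters[OF that] GenStar_letters[OF that]
        GenStar_letters[OF that] Gen_letters[OF that]]
    by (simp add: commutator_rel_def twist_factor_square)
  have norm: "(\<Oplus>\<^bsub>FS\<^esub>k\<in>{..<4}. basis_elt [Gen k, GenStar k]) \<ominus>\<^bsub>FS\<^esub> \<one>\<^bsub>FS\<^esub> = norm_rel"
  proof -
    have "(\<Oplus>\<^bsub>FS\<^esub>k\<in>{..<4}. basis_elt [Gen k, GenStar k]) = (\<lambda>w. \<Sum>k<4. basis_elt [Gen k, GenStar k] w)"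
      by (rule FS_finsum_basis) auto
    moreover have "(\<lambda>w. \<Sum>k<4. basis_elt [Gen k, GenStar k] w) \<in> carrier FM"
    proof -
      interpret ring FS by (rule FS_ring)
      have "(\<Oplus>\<^bsub>FS\<^esub>k\<in>{..<4}. basis_elt [Gen k, GenStar k]) \<in> carrier FS"
        by (rule finsum_closed) (auto simp: free_star_algebra_simps(1) free_monoid_def)
      with calculation show ?thesis by (simp add: free_star_algebra_simps(1))
    qed
    moreover have "\<one>\<^bsub>FS\<^esub> = basis_elt []"
      by (simp add: free_star_algebra_simps(3) monoid_algebra_simps(2) free_monoid_def)
    moreover have "basis_elt [] \<in> carrier FM" by (intro basis_FM) simp
    ultimately show ?thesis by (simp add: FS_minus norm_rel_def)
  qed
  show ?thesis
    unfolding sphere_relations_def Let_def zs m norm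
  proof (intro arg_cong2[where f = "(\<union>)"] refl Collect_cong_1 Collect_cong_2)
    fix j :: nat assume "j < 4"
    then show "basis_elt [Gen j, GenStar j] \<ominus>\<^bsub>FS\<^esub> basis_elt [GenStar j, Gen j]
      = commutator_rel (Gen j) (GenStar j)" by (rule comm1)
  next
    fix j k :: nat assume "j < 4 \<and> k < 4"
    then show "basis_elt [Gen j, Gen k] \<ominus>\<^bsub>FS\<^esub> cis (2 * pi * \<Theta> $$ (j, k)) \<odot>\<^bsub>FS\<^esub> basis_elt [Gen k, Gen j]
        = commutator_rel (Gen j) (Gen k)"
      by (intro comm) (simp_all add: \<Theta>_index twist_factor_square)
  next
    fix j k :: nat assume "j < 4 \<and> k < 4"
    then show "basis_elt [Gen j, GenStar k] \<ominus>\<^bsub>FS\<^esub> cis (- 2 * pi * \<Theta> $$ (j, k)) \<odot>\<^bsub>FS\<^esub> basis_elt [GenStar k, Gen j]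
        = commutator_rel (Gen j) (GenStar k)"
      by (intro comm) (simp_all add: \<Theta>_index twist_factor_square)
  qed
qed

abbreviation "I \<equiv> Idl\<^bsub>FS\<^esub> (Rel \<union> star FS ` Rel)"

lemma commutator_rel_carrier: "a \<in> letters \<Longrightarrow> b \<in> letters \<Longrightarrow> commutator_rel a b \<in> carrier FM"
proof -
  assume ab: "a \<in> letters" "b \<in> letters"
  interpret ring FS by (rule FS_ring)
  note c = basis_pair[OF ab] smult_basis_pair[OF ab(2,1), of "(twist_factor \<theta> a b)\<^sup>2"]
  show ?thesis
    using minus_closed[unfolded free_star_algebra_simps(1), OF c]
    unfolding FS_minus[OF c] commutator_rel_def .
qed

lemma norm_rel_carrier: "norm_rel \<in> carrier FM"
proof -
  have "norm_rel w = 0" if "w \<notin> insert [] ((\<lambda>k. [Gen k, GenStar k]) ` {..<4})" for w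
    using that by (auto simp: norm_rel_def basis_elt_def intro!: sum.neutral)
  then have sub: "{w. norm_rel w \<noteq> 0} \<subseteq> insert [] ((\<lambda>k. [Gen k, GenStar k]) ` {..<4})" by blast
  have T: "insert [] ((\<lambda>k. [Gen k, GenStar k]) ` {..<4}) \<subseteq> lists letters" by auto
  have "carrier (free_monoid letters) = lists letters" by (simp add: free_monoid_def)
  then show ?thesis
    unfolding monoid_algebra_simps(1)
    by (simp only:) (intro conjI finite_subset[OF sub] subset_trans[OF sub T], simp)
qed

lemma Rel_carrier: "Rel \<subseteq> carrier FM"
  unfolding Rel_eq by (auto intro!: commutator_rel_carrier norm_rel_carrier)

lemma Rel_star_carrier: "Rel \<union> star FS ` Rel \<subseteq> carrier FS"
  using Rel_carrier star_FM_closed by (auto simp: free_star_algebra_simps(1))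

lemma I_ideal: "ideal I FS"
  by (rule ring.genideal_ideal[OF FS_ring Rel_star_carrier])

lemma Rel_I: "r \<in> Rel \<Longrightarrow> r \<in> I" "r \<in> Rel \<Longrightarrow> star FS r \<in> I"
  using ring.genideal_self[OF FS_ring Rel_star_carrier] by auto

lemma \<Phi>_ring_hom: "\<Phi> \<in> Ring.ring_hom FS (deformed_SU 4 \<Lambda>)"
proof (rule ring_hom_memI)
  have "\<one>\<^bsub>FS\<^esub> = basis_elt []"
    by (simp add: free_star_algebra_simps(3) monoid_algebra_simps(2) free_monoid_def)
  then show "\<Phi> \<one>\<^bsub>FS\<^esub> = \<one>\<^bsub>deformed_SU 4 \<Lambda>\<^esub>" by (simp add: \<Phi>_basis word_elt_Nil)
qed (simp_all add: free_star_algebra_simps \<Phi>_span \<Phi>_mult \<Phi>_add)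

lemma \<Phi>_kernel_ideal: "ideal {p \<in> carrier FS. \<Phi> p = (\<lambda>U\<in>SU 4. 0)} FS"
  using ring_hom_ring.kernel_is_ideal[OF ring_hom_ringI2[OF FS_ring A.D.ring_axioms \<Phi>_ring_hom]]
  unfolding a_kernel_def' A.deformed_SU_simps .

lemma word_elt_pair: "U \<in> SU 4 \<Longrightarrow> word_elt [a, b] U = twist_factor \<theta> a b * (lval (last_row U) a * lval (last_row U) b)"
  by (simp add: word_elt_def)

lemma finite_basis: "finite {v. basis_elt w v \<noteq> (0::complex)}"
  by (simp add: basis_elt_def)

lemma finite_smult_basis: "finite {v. c * basis_elt w v \<noteq> (0::complex)}"
  by (rule finite_subset[OF _ finite_basis[of w]]) auto

lemma lin_ext_commutator_rel:
  "lin_ext f (commutator_rel a b) = f [a, b] - (twist_factor \<theta> a b)\<^sup>2 * f [b, a]"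
  unfolding commutator_rel_def
  by (subst lin_ext_diff[OF finite_basis finite_smult_basis]) (simp add: lin_ext_smult)

lemma lin_ext_norm_rel: "lin_ext f norm_rel = (\<Sum>k<4. f [Gen k, GenStar k]) - f []"
proof -
  have "lin_ext f (\<lambda>w. \<Sum>k\<in>{..<4}. basis_elt [Gen k, GenStar k] w)
      = (\<Sum>k\<in>{..<4}. lin_ext f (basis_elt [Gen k, GenStar k])) \<and>
    finite {w. (\<Sum>k\<in>{..<4::nat}. basis_elt [Gen k, GenStar k] w) \<noteq> (0::complex)}"
    by (rule lin_ext_sum) (rule finite_lessThan, rule finite_basis)
  then have *: "lin_ext f (\<lambda>w. \<Sum>k\<in>{..<4}. basis_elt [Gen k, GenStar k] w) = (\<Sum>k<4. f [Gen k, GenStar k])"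
    "finite {w. (\<Sum>k\<in>{..<4::nat}. basis_elt [Gen k, GenStar k] w) \<noteq> (0::complex)}"
    by simp_all
  show ?thesis
    unfolding norm_rel_def by (subst lin_ext_diff[OF *(2) finite_basis]) (simp add: *(1))
qed

lemma \<Phi>_Rel:
  assumes "r \<in> Rel"
  shows "\<Phi> r = (\<lambda>U\<in>SU 4. 0)"
proof -
  have "\<Phi> (commutator_rel a b) = (\<lambda>U\<in>SU 4. 0)" for a b
  proof (rule A.SU_ext)
    fix U assume U: "U \<in> SU 4"
    have "(twist_factor \<theta> a b)\<^sup>2 * twist_factor \<theta> b a = twist_factor \<theta> a b * (twist_factor \<theta> a b * cnj (twist_factor \<theta> a b))"
      unfolding twist_factor_commute[of \<theta> b a] by (simp add: power2_eq_square)
    then have "(twist_factor \<theta> a b)\<^sup>2 * twist_factor \<theta> b a = twist_factor \<theta> a b"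
      unfolding twist_factor_norm by simp
    then have "(twist_factor \<theta> a b)\<^sup>2 * word_elt [b, a] U = word_elt [a, b] U"
      using U by (simp add: word_elt_pair mult.assoc[symmetric])
    then show "\<Phi> (commutator_rel a b) U = (\<lambda>U\<in>SU 4. 0) U"
      using U by (simp add: \<Phi>_def lin_ext_commutator_rel)
  qed simp_all
  moreover have "\<Phi> norm_rel = (\<lambda>U\<in>SU 4. 0)"
  proof (rule A.SU_ext)
    fix U assume U: "U \<in> SU 4"
    have "(\<Sum>k<4. word_elt [Gen k, GenStar k] U) = (\<Sum>k<4. last_row U k * cnj (last_row U k))"
      using U by (simp add: word_elt_pair twist_factor_def)
    also have "\<dots> = 1" using last_row_S7[OF U] by (simp add: S7_def)
    finally show "\<Phi> norm_rel U = (\<lambda>U\<in>SU 4. 0) U"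
      using U by (simp add: \<Phi>_def lin_ext_norm_rel word_elt_Nil)
  qed simp_all
  ultimately show ?thesis using assms unfolding Rel_eq by auto
qed

lemma I_kernel: "I \<subseteq> {p \<in> carrier FS. \<Phi> p = (\<lambda>U\<in>SU 4. 0)}"
proof (rule ring.genideal_minimal[OF FS_ring \<Phi>_kernel_ideal])
  have "\<Phi> (star FS r) = (\<lambda>U\<in>SU 4. 0)" if "r \<in> Rel" for r
    using that Rel_carrier by (subst \<Phi>_star) (auto simp: \<Phi>_Rel)
  then show "Rel \<union> star FS ` Rel \<subseteq> {p \<in> carrier FS. \<Phi> p = (\<lambda>U\<in>SU 4. 0)}"
    using Rel_star_carrier \<Phi>_Rel by auto
qed

lemma I_carrier: "p \<in> I \<Longrightarrow> p \<in> carrier FM"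
  using I_kernel by (auto simp: free_star_algebra_simps(1))

lemma I_add: "p \<in> I \<Longrightarrow> q \<in> I \<Longrightarrow> (\<lambda>w. p w + q w) \<in> I"
  using additive_subgroup.a_closed[OF ideal.axioms(1)[OF I_ideal], of p q]
  by (simp only: free_star_algebra_simps(5) monoid_algebra_simps(4))

lemma I_mult_basis:
  assumes "p \<in> I" "u \<in> lists letters"
  shows "(\<lambda>v. lin_ext (\<lambda>w. basis_elt (u @ w) v) p) \<in> I" "(\<lambda>v. lin_ext (\<lambda>w. basis_elt (w @ u) v) p) \<in> I"
proof -
  interpret ideal I FS by (rule I_ideal)
  have u: "basis_elt u \<in> carrier FS" unfolding free_star_algebra_simps(1) by (rule basis_FM[OF assms(2)])
  have "(basis_elt u \<otimes>\<^bsub>FM\<^esub> p) = (\<lambda>v. lin_ext (\<lambda>w. basis_elt (u @ w) v) p)"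
    by (simp add: monoid_algebra_mult free_monoid_def) (simp add: basis_elt_def eq_commute)
  moreover have "(p \<otimes>\<^bsub>FM\<^esub> basis_elt u) = (\<lambda>v. lin_ext (\<lambda>w. basis_elt (w @ u) v) p)"
    by (simp add: monoid_algebra_mult free_monoid_def) (simp add: basis_elt_def eq_commute)
  ultimately show "(\<lambda>v. lin_ext (\<lambda>w. basis_elt (u @ w) v) p) \<in> I" "(\<lambda>v. lin_ext (\<lambda>w. basis_elt (w @ u) v) p) \<in> I"
    using I_l_closed[OF assms(1) u] I_r_closed[OF assms(1) u] by (simp_all add: free_star_algebra_simps(2))
qed

lemma I_smult: assumes "p \<in> I" shows "(\<lambda>w. c * p w) \<in> I"
proof -
  interpret ideal I FS by (rule I_ideal)
  have "basis_elt [] \<in> carrier FM" by (intro basis_FM) simp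
  then have "c \<odot>\<^bsub>FM\<^esub> basis_elt [] \<in> carrier FS"
    by (auto simp: free_star_algebra_simps(1) monoid_algebra_simps(1,5))
  from I_l_closed[OF assms this] have "c \<odot>\<^bsub>FM\<^esub> (basis_elt [] \<otimes>\<^bsub>FM\<^esub> p) \<in> I"
    by (simp add: free_star_algebra_simps(2) monoid_algebra_smult_mult)
  moreover have "basis_elt [] \<otimes>\<^bsub>FM\<^esub> p = p"
  proof -
    interpret M: ring FM by (rule FM_ring)
    show ?thesis using M.l_one[OF I_carrier[OF assms]] by (simp add: monoid_algebra_simps(2) free_monoid_def)
  qed
  ultimately show ?thesis by (simp add: monoid_algebra_simps(5))
qed

lemma I_diff: "p \<in> I \<Longrightarrow> q \<in> I \<Longrightarrow> (\<lambda>w. p w - q w) \<in> I"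
  using I_add[of p "\<lambda>w. - 1 * q w"] I_smult[of q "- 1"] by simp

text \<open>The listed relations have an unstarred first letter. A starred letter before an
  unstarred one gives a multiple of the reversed relation, because the squared factors of both
  orders are inverse; two starred letters give the adjoint of a relation.\<close>

lemma commutator_rel_I: assumes "a \<in> letters" "b \<in> letters" shows "commutator_rel a b \<in> I"
proof -
  have gen: "commutator_rel (Gen j) c \<in> I" if "j < 4" "c \<in> letters" for j c
  proof (rule Rel_I(1), cases c)
    case (Gen k)
    then have "k < 4" using that by auto
    then show "commutator_rel (Gen j) c \<in> Rel" unfolding Gen Rel_eq using that(1) by blast
  next
    case (GenStar k)
    then have "k < 4" using that by auto
    then show "commutator_rel (Gen j) c \<in> Rel" unfolding GenStar Rel_eq using that(1) by blast
  qed
  have t: "(twist_factor \<theta> a b)\<^sup>2 * (twist_factor \<theta> b a)\<^sup>2 = 1"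
    unfolding twist_factor_commute[of \<theta> b a] power_mult_distrib[symmetric] twist_factor_norm by simp
  show ?thesis
  proof (cases a)
    case (Gen j)
    then show ?thesis using gen assms by auto
  next
    case a: (GenStar j)
    show ?thesis
    proof (cases b)
      case (Gen k)
      have "(\<lambda>w. - (twist_factor \<theta> a b)\<^sup>2 * commutator_rel b a w) \<in> I"
        by (rule I_smult) (use gen assms Gen in auto)
      moreover have "- (twist_factor \<theta> a b)\<^sup>2 * commutator_rel b a w = commutator_rel a b w" for w
      proof -
        have "- (twist_factor \<theta> a b)\<^sup>2 * commutator_rel b a w
          = ((twist_factor \<theta> a b)\<^sup>2 * (twist_factor \<theta> b a)\<^sup>2) * basis_elt [a, b] w - (twist_factor \<theta> a b)\<^sup>2 * basis_elt [b, a] w"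
          by (simp add: commutator_rel_def algebra_simps)
        then show ?thesis unfolding t by (simp add: commutator_rel_def)
      qed
      ultimately show ?thesis by simp
    next
      case b: (GenStar k)
      have "star FS (commutator_rel (Gen k) (Gen j)) \<in> I"
      proof (rule Rel_I(2))
        have "j < 4" "k < 4" using assms a b by auto
        then show "commutator_rel (Gen k) (Gen j) \<in> Rel" unfolding Rel_eq by blast
      qed
      moreover have "star FS (commutator_rel (Gen k) (Gen j)) = commutator_rel a b"
      proof
        fix w
        have s: "cnj (basis_elt [Gen x, Gen y] (rev (map letter_star w))) = basis_elt [GenStar y, GenStar x] w" for x y :: nat
          using fun_cong[OF star_basis[of "[Gen x, Gen y]"], of w] by (simp add: free_star_algebra_simps(7))
        have "twist_factor \<theta> (Gen k) (Gen j) = cnj (twist_factor \<theta> a b)"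
          unfolding twist_factor_commute[symmetric] by (simp add: a b twist_factor_def)
        then show "star FS (commutator_rel (Gen k) (Gen j)) w = commutator_rel a b w"
          by (simp add: free_star_algebra_simps(7) commutator_rel_def s) (simp add: a b)
      qed
      ultimately show ?thesis by simp
    qed
  qed
qed

text \<open>Rescaling words by their phases turns the relations of the sphere into those of the
  commutative polynomial ring.\<close>

definition scaled :: "nat letter list \<Rightarrow> nat letter list \<Rightarrow> complex" where
  "scaled w = (\<lambda>v. cnj (word_phase \<theta> w) * basis_elt w v)"

text \<open>The phase contributed by the new first letter depends only on the multiset of the
  remaining letters, hence is the same for \<open>w\<close> and \<open>w'\<close>.\<close>

lemma I_Cons:
  assumes "a \<in> letters" "(\<lambda>v. scaled w v - scaled w' v) \<in> I" "mset w = mset w'"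
  shows "(\<lambda>v. scaled (a # w) v - scaled (a # w') v) \<in> I"
proof -
  have fin: "finite {v. scaled w v \<noteq> 0}" for w
    unfolding scaled_def by (rule finite_smult_basis)
  have "(\<lambda>v. cnj (\<Prod>b\<leftarrow>w. twist_factor \<theta> a b) *
      lin_ext (\<lambda>x. basis_elt ([a] @ x) v) (\<lambda>v. scaled w v - scaled w' v)) \<in> I"
    by (intro I_smult I_mult_basis(1) assms) (use assms in simp)
  moreover have "lin_ext (\<lambda>x. basis_elt ([a] @ x) v) (\<lambda>v. scaled w v - scaled w' v)
      = cnj (word_phase \<theta> w) * basis_elt (a # w) v - cnj (word_phase \<theta> w') * basis_elt (a # w') v" for v
    unfolding lin_ext_diff[OF fin fin] unfolding scaled_def lin_ext_smult by simp
  ultimately show ?thesis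
    by (simp add: scaled_def prod_twist_factor_mset[OF assms(3)] right_diff_distrib mult.assoc)
qed

text \<open>The phases of the two words differ exactly by the squared twist factor of the
  commutation relation, so the rescaling absorbs it.\<close>

lemma I_swap:
  assumes "a \<in> letters" "b \<in> letters" "w \<in> lists letters"
  shows "(\<lambda>v. scaled (a # b # w) v - scaled (b # a # w) v) \<in> I"
proof -
  let ?c = "cnj (word_phase \<theta> (a # b # w))"
  have "(\<lambda>v. ?c * lin_ext (\<lambda>x. basis_elt (x @ w) v) (commutator_rel a b)) \<in> I"
    by (intro I_smult I_mult_basis(2) commutator_rel_I assms)
  moreover have "?c * (twist_factor \<theta> a b)\<^sup>2 = cnj (word_phase \<theta> (b # a # w))"
  proof -
    let ?r = "cnj (\<Prod>x\<leftarrow>w. twist_factor \<theta> a x) * cnj (\<Prod>x\<leftarrow>w. twist_factor \<theta> b x) * cnj (word_phase \<theta> w)"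
    have "?c * (twist_factor \<theta> a b)\<^sup>2 = (twist_factor \<theta> a b * cnj (twist_factor \<theta> a b)) * twist_factor \<theta> a b * ?r"
      by (simp add: power2_eq_square mult_ac)
    also have "\<dots> = twist_factor \<theta> a b * ?r" unfolding twist_factor_norm by simp
    also have "\<dots> = cnj (word_phase \<theta> (b # a # w))"
      by (simp add: twist_factor_commute[of \<theta> b a] mult_ac)
    finally show ?thesis .
  qed
  ultimately show ?thesis
    by (simp add: lin_ext_commutator_rel scaled_def right_diff_distrib mult.assoc[symmetric] del: word_phase.simps)
qed

lemma I_move:
  assumes "a \<in> letters" "u \<in> lists letters" "w \<in> lists letters"
  shows "(\<lambda>v. scaled (u @ a # w) v - scaled (a # u @ w) v) \<in> I"
  using assms(2)
proof (induction u)
  case Nil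
  show ?case using I_smult[OF commutator_rel_I[OF assms(1,1)], of 0] by simp
next
  case (Cons b u)
  then have b: "b \<in> letters" and u: "u \<in> lists letters" by auto
  have "(\<lambda>v. (scaled (b # u @ a # w) v - scaled (b # a # u @ w) v) + (scaled (b # a # u @ w) v - scaled (a # b # u @ w) v)) \<in> I"
    by (intro I_add I_Cons I_swap b assms(1) Cons.IH) (use u assms in auto)
  then show ?case by simp
qed

lemma I_permute:
  assumes "w \<in> lists letters" "w' \<in> lists letters" "mset w = mset w'"
  shows "(\<lambda>v. scaled w v - scaled w' v) \<in> I"
  using assms
proof (induction w arbitrary: w')
  case Nil
  then show ?case using I_smult[OF commutator_rel_I[of "Gen 0" "Gen 0"], of 0] by simp
next
  case (Cons a t)
  then have a: "a \<in> letters" and t: "t \<in> lists letters" by auto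
  have "a \<in> set w'" using Cons.prems(2) by (metis list.set_intros(1) mset_eq_setD)
  then obtain u v where w': "w' = u @ a # v" by (meson split_list)
  have uv: "u \<in> lists letters" "v \<in> lists letters" using Cons.prems(1) w' by auto
  have m: "mset t = mset (u @ v)" using Cons.prems(2) w' by simp
  have "(\<lambda>x. (scaled (a # t) x - scaled (a # u @ v) x) - (scaled (u @ a # v) x - scaled (a # u @ v) x)) \<in> I"
    by (intro I_diff I_Cons a Cons.IH[OF _ m] m I_move uv) (use uv in auto)
  then show ?case by (simp add: w')
qed

lemma I_norm:
  assumes "w \<in> lists letters"
  shows "(\<lambda>v. scaled w v - (\<Sum>k<4. scaled (Gen k # GenStar k # w) v)) \<in> I"
proof -
  have "(\<lambda>v. - cnj (word_phase \<theta> w) * lin_ext (\<lambda>x. basis_elt (x @ w) v) norm_rel) \<in> I"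
    by (intro I_smult I_mult_basis(2) Rel_I(1) assms) (simp add: Rel_eq)
  \<comment> \<open>\<open>Gen k\<close> and \<open>GenStar k\<close> have conjugate twist factors
    with every letter, so prefixing the pair changes no phase and the norm relation keeps its
    undeformed form.\<close>
  moreover have "word_phase \<theta> (Gen k # GenStar k # w) = word_phase \<theta> w" for k
  proof -
    have t: "twist_factor \<theta> (GenStar k) b = cnj (twist_factor \<theta> (Gen k) b)" for b
      by (simp add: twist_factor_def cis_cnj)
    have "(\<Prod>b\<leftarrow>w. twist_factor \<theta> (GenStar k) b) = cnj (\<Prod>b\<leftarrow>w. twist_factor \<theta> (Gen k) b)"
      by (induction w) (simp_all add: t)
    then have "(\<Prod>b\<leftarrow>w. twist_factor \<theta> (Gen k) b) * (\<Prod>b\<leftarrow>w. twist_factor \<theta> (GenStar k) b) = 1"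
      by (simp only: prod_twist_factor_norm)
    moreover have "twist_factor \<theta> (Gen k) (GenStar k) = 1" by (simp add: twist_factor_def)
    ultimately show ?thesis by (simp add: mult.assoc[symmetric])
  qed
  ultimately show ?thesis
    by (simp add: lin_ext_norm_rel scaled_def right_diff_distrib sum_distrib_left sum_negf del: word_phase.simps)
qed

lemma kernel_eq: "I = {p \<in> carrier FS. \<Phi> p = (\<lambda>U\<in>SU 4. 0)}"
proof (intro equalityI I_kernel subsetI)
  fix p assume "p \<in> {p \<in> carrier FS. \<Phi> p = (\<lambda>U\<in>SU 4. 0)}"
  then have p: "p \<in> carrier FM" and p0: "\<Phi> p = (\<lambda>U\<in>SU 4. 0)" by (auto simp: free_star_algebra_simps(1))
  \<comment> \<open>The ideal seen after rescaling words by their phases: membership in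
    \<open>V\<close> obeys the commutative rules that \<open>sphere_vanishing\<close>
    requires.\<close>
  define V where "V = {c. (\<lambda>w. c w * cnj (word_phase \<theta> w)) \<in> I}"
  have scaled: "basis_elt w v * cnj (word_phase \<theta> v) = scaled w v" for w v
    by (simp add: scaled_def basis_elt_def)
  let ?c = "\<lambda>w. p w * word_phase \<theta> w"
  have nz: "word_phase \<theta> w \<noteq> 0" for w using word_phase_norm[of \<theta> w] by auto
  have "?c \<in> V"
  proof (rule sphere_vanishing)
    show "(\<lambda>_. 0) \<in> V" using I_smult[OF commutator_rel_I[of "Gen 0" "Gen 0"], of 0] by (simp add: V_def)
    show "(\<lambda>w. f w + g w) \<in> V" if "f \<in> V" "g \<in> V" for f g
      using I_add that by (simp add: V_def ring_distribs)
    show "(\<lambda>w. k * f w) \<in> V" if "f \<in> V" for k f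
      using I_smult that by (simp add: V_def mult.assoc)
    show "(\<lambda>v. basis_elt w v - basis_elt w' v) \<in> V"
      if "w \<in> lists letters" "w' \<in> lists letters" "mset w = mset w'" for w w'
      using I_permute[OF that] by (simp add: V_def left_diff_distrib scaled)
    show "(\<lambda>v. basis_elt w v - (\<Sum>k<4. basis_elt (Gen k # GenStar k # w) v)) \<in> V"
      if "w \<in> lists letters" for w
      using I_norm[OF that] by (simp add: V_def left_diff_distrib sum_distrib_right scaled)
    show "?c \<in> carrier FM" using p nz by (simp add: FM_carrier_iff)
    fix x assume "x \<in> S7"
    then obtain U where U: "U \<in> SU 4" "\<And>j. j < 4 \<Longrightarrow> last_row U j = x j" using S7_last_row by blast
    have "lin_ext (wval x) ?c = (\<Sum>w | p w \<noteq> 0. p w * word_elt w U)"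
      unfolding lin_ext_def
    proof (rule sum.cong)
      show "{y. p y * word_phase \<theta> y \<noteq> 0} = {w. p w \<noteq> 0}" using nz by simp
      fix w assume "w \<in> {w. p w \<noteq> 0}"
      then have "w \<in> lists letters" using p by (simp add: FM_carrier_iff)
      from wval_cong[OF this U(2)] show "p w * word_phase \<theta> w * wval x w = p w * word_elt w U"
        using U(1) by (simp add: word_elt_def)
    qed
    also have "\<dots> = \<Phi> p U" using U(1) by (simp add: \<Phi>_def lin_ext_def)
    finally show "lin_ext (wval x) ?c = 0" using p0 U(1) by simp
  qed
  then show "p \<in> I" by (simp add: V_def mult.assoc word_phase_norm)
qed

end

section \<open>The fixed-point algebra is the noncommutative sphere\<close>

context SU3_action
begin

abbreviation "fixed \<equiv> fixed_points (SU3 \<theta>) (SU4 \<Lambda>) \<rho>"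

lemma \<Phi>_image: "\<Phi> ` carrier FM = fixed"
proof (intro equalityI subsetI)
  fix f assume "f \<in> \<Phi> ` carrier FM"
  then obtain p where p: "p \<in> carrier FM" "f = \<Phi> p" by blast
  have "\<Phi> p (block_embed h * U) = \<Phi> p U" if h: "h \<in> SU 3" and U: "U \<in> SU 4" for h U
  proof -
    have V: "block_embed h * U \<in> SU 4" by (intro SU_mult block_embed_SU h U)
    have row: "last_row (block_embed h * U) j = last_row U j" if "j < 4" for j
      using that by (simp add: last_row_def block_embed_mult_index[OF SU_carrier[OF h] SU_carrier[OF U]])
    have "lin_ext (\<lambda>w. word_elt w (block_embed h * U)) p = lin_ext (\<lambda>w. word_elt w U) p"
    proof (rule lin_ext_cong)
      fix w assume "p w \<noteq> 0"
      then have "w \<in> lists letters" using p by (simp add: FM_carrier_iff)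
      from wval_cong[OF this row] show "word_elt w (block_embed h * U) = word_elt w U"
        using U V by (simp add: word_elt_def)
    qed
    then show ?thesis using U V by (simp add: \<Phi>_def)
  qed
  then show "f \<in> fixed" unfolding fixed_points_iff p(2) using \<Phi>_span[OF p(1)] by blast
next
  fix f assume "f \<in> fixed"
  then have f: "f \<in> mon_span 4" and inv: "\<And>h U. h \<in> SU 3 \<Longrightarrow> U \<in> SU 4 \<Longrightarrow> f (block_embed h * U) = f U"
    unfolding fixed_points_iff by auto
  obtain p where p: "p \<in> Pol" "\<And>U. U \<in> SU 4 \<Longrightarrow> f U = p (last_row U)"
    using invariant_polynomial[OF f inv] by blast
  obtain c where c: "c \<in> carrier FM" "\<And>x. p x = lin_ext (wval x) c"
    using Pol_span[OF p(1)] by blast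
  \<comment> \<open>Dividing by the word phases compensates the deformation, so
    \<open>\<Phi>\<close> returns the commutative polynomial that represents
    \<open>f\<close>.\<close>
  let ?q = "\<lambda>w. c w * cnj (word_phase \<theta> w)"
  have nz: "cnj (word_phase \<theta> w) \<noteq> 0" for w using word_phase_norm[of \<theta> w] by auto
  have q: "?q \<in> carrier FM" using c(1) nz by (simp add: FM_carrier_iff)
  have "\<Phi> ?q = f"
  proof (rule A.SU_ext)
    fix U assume U: "U \<in> SU 4"
    have "\<Phi> ?q U = (\<Sum>w | c w \<noteq> 0. c w * (word_phase \<theta> w * cnj (word_phase \<theta> w)) * wval (last_row U) w)"
      using U nz by (simp add: \<Phi>_def lin_ext_def word_elt_def mult_ac)
    also have "\<dots> = f U" unfolding word_phase_norm by (simp add: p(2)[OF U] c(2) lin_ext_def)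
    finally show "\<Phi> ?q U = f U" .
  qed (use mon_span_extensional[OF f] in simp_all)
  then show "f \<in> \<Phi> ` carrier FM" using q by blast
qed

text \<open>Closure is read off from the description as the image of \<open>\<Phi>\<close>; for the
  star this is essential, as an action is not defined to respect it.\<close>

lemma fixed_subalgebra: "star_subalgebra fixed (deformed_SU 4 \<Lambda>)"
proof -
  interpret M: ring FM by (rule FM_ring)
  have one: "(\<lambda>U\<in>SU 4. 1) = \<Phi> (basis_elt [])" by (simp add: \<Phi>_basis word_elt_Nil)
  have nil: "basis_elt [] \<in> carrier FM" by (rule basis_FM) simp
  have smult: "c \<odot>\<^bsub>FM\<^esub> p \<in> carrier FM" if "p \<in> carrier FM" for c p
    using that by (auto simp: monoid_algebra_simps(1,5))
  show ?thesis
    unfolding star_subalgebra_def \<Phi>_image[symmetric] A.deformed_SU_simps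
  proof (intro conjI ballI allI)
    show "\<Phi> ` carrier FM \<subseteq> mon_span 4" using \<Phi>_span by blast
    show "(\<lambda>U\<in>SU 4. 1) \<in> \<Phi> ` carrier FM" unfolding one using nil by (rule imageI)
    fix a assume "a \<in> \<Phi> ` carrier FM"
    then obtain p where p: "p \<in> carrier FM" "a = \<Phi> p" by blast
    show "(\<lambda>U\<in>SU 4. c * a U) \<in> \<Phi> ` carrier FM" for c
      unfolding p(2) \<Phi>_smult[symmetric] by (rule imageI[OF smult[OF p(1)]])
    show "(\<lambda>U\<in>SU 4. cnj (a U)) \<in> \<Phi> ` carrier FM"
      unfolding p(2) \<Phi>_star[OF p(1), symmetric] by (rule imageI[OF star_FM_closed[OF p(1)]])
    fix b assume "b \<in> \<Phi> ` carrier FM"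
    then obtain q where q: "q \<in> carrier FM" "b = \<Phi> q" by blast
    show "(\<lambda>U\<in>SU 4. a U + b U) \<in> \<Phi> ` carrier FM"
      unfolding p(2) q(2) \<Phi>_add[OF p(1) q(1), symmetric] by (rule imageI[OF M.add.m_closed[OF p(1) q(1)]])
    show "A.dm a b \<in> \<Phi> ` carrier FM"
      unfolding p(2) q(2) \<Phi>_mult[OF p(1) q(1), symmetric] by (rule imageI[OF M.m_closed[OF p(1) q(1)]])
  qed
qed

text \<open>Every \<open>\<Phi> p\<close> is a combination of deformed products of last-row
  coordinates and their adjoints, so generation is a consequence of
  \<open>\<Phi>_image\<close>.\<close>

lemma fixed_generated: "fixed = star_generated (deformed_SU 4 \<Lambda>) ((\<lambda>l. coord 4 3 l) ` {..<4})"
proof -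
  let ?X = "(\<lambda>l. coord 4 3 l) ` {..<4}"
  let ?G = "star_generated (deformed_SU 4 \<Lambda>) ?X"
  have X: "?X \<subseteq> fixed"
  proof
    fix f assume "f \<in> ?X"
    then obtain l where l: "l < 4" "f = coord 4 3 l" by blast
    have "f = \<Phi> (basis_elt [Gen l])" using l by (simp add: \<Phi>_basis word_elt_single gen_elt_coord)
    moreover have "basis_elt [Gen l] \<in> carrier FM" by (rule basis_FM) (use l in auto)
    ultimately show "f \<in> fixed" unfolding \<Phi>_image[symmetric] by blast
  qed
  note G = star_subalgebraD[OF star_subalgebra_star_generated[OF X fixed_subalgebra], unfolded A.deformed_SU_simps]
  have x: "coord 4 3 l \<in> ?G" if "l < 4" for l
    by (rule subsetD[OF star_generated_superset]) (use that in simp)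
  have gen: "gen_elt a \<in> ?G" if "a \<in> letters" for a
  proof (cases a)
    case (Gen l)
    then show ?thesis using that x[of l] gen_elt_coord(1)[of l] by auto
  next
    case (GenStar l)
    then have l: "l < 4" using that by auto
    show ?thesis unfolding GenStar gen_elt_coord(2)[OF l] by (rule G(6)[OF x[OF l]])
  qed
  have word: "word_elt w \<in> ?G" if "w \<in> lists letters" for w
    using that
  proof (induction w)
    case Nil
    show ?case unfolding word_elt_Nil by (rule G(2))
  next
    case (Cons a w)
    then have a: "a \<in> letters" and w: "w \<in> lists letters" by auto
    show ?case unfolding word_elt_Cons[OF a w] by (rule G(4)[OF gen[OF a] Cons.IH])
  qed
  have "\<Phi> p \<in> ?G" if p: "p \<in> carrier FM" for p
  proof -
    have "(\<lambda>U\<in>SU 4. \<Sum>w\<in>S. p w * word_elt w U) \<in> ?G" if "finite S" "S \<subseteq> lists letters" for S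
      using that
    proof (induction S rule: finite_induct)
      case empty
      show ?case using G(5)[OF G(2), of 0] by simp
    next
      case (insert w S)
      have w: "word_elt w \<in> ?G" by (rule word) (use insert.prems in simp)
      have S: "(\<lambda>U\<in>SU 4. \<Sum>w\<in>S. p w * word_elt w U) \<in> ?G" by (rule insert.IH) (use insert.prems in simp)
      from G(3)[OF G(5)[OF w, of "p w"] S] show ?case using insert.hyps by simp
    qed
    from this[of "{w. p w \<noteq> 0}"] show ?thesis
      using p by (simp add: \<Phi>_def lin_ext_def FM_carrier_iff subset_iff)
  qed
  then have "fixed \<subseteq> ?G" unfolding \<Phi>_image[symmetric] by blast
  moreover have "?G \<subseteq> fixed" by (rule star_generated_subset[OF fixed_subalgebra X])
  ultimately show ?thesis by (rule equalityI)
qed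

section \<open>The quotient by the relations and the isomorphism\<close>

abbreviation "coset p \<equiv> I +>\<^bsub>FS\<^esub> p"

lemma coset_eq_iff:
  assumes p: "p \<in> carrier FM" and q: "q \<in> carrier FM"
  shows "coset p = coset q \<longleftrightarrow> \<Phi> p = \<Phi> q"
proof -
  have "coset p = coset q \<longleftrightarrow> (\<lambda>w. p w - q w) \<in> I"
    using ring.quotient_eq_iff_same_a_r_cos[OF FS_ring I_ideal, of p q] p q
    by (simp add: FS_minus free_star_algebra_simps(1))
  also have "\<dots> \<longleftrightarrow> (\<lambda>U\<in>SU 4. \<Phi> p U - \<Phi> q U) = (\<lambda>U\<in>SU 4. 0)"
  proof -
    interpret ring FS by (rule FS_ring)
    have "(\<lambda>w. p w - q w) \<in> carrier FS"
      using minus_closed[unfolded free_star_algebra_simps(1), OF p q]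
      unfolding FS_minus[OF p q] free_star_algebra_simps(1) .
    then show ?thesis unfolding kernel_eq by (simp add: \<Phi>_diff[OF p q])
  qed
  also have "\<dots> \<longleftrightarrow> \<Phi> p = \<Phi> q"
  proof
    assume eq: "(\<lambda>U\<in>SU 4. \<Phi> p U - \<Phi> q U) = (\<lambda>U\<in>SU 4. 0)"
    show "\<Phi> p = \<Phi> q"
    proof (rule A.SU_ext)
      fix U assume U: "U \<in> SU 4"
      from fun_cong[OF eq, of U] show "\<Phi> p U = \<Phi> q U" using U by simp
    qed simp_all
  qed simp
  finally show ?thesis .
qed

text \<open>Scalars and star on the quotient are defined as unions over representatives. Since
  cosets are the fibres of \<open>\<Phi>\<close>, the union collapses as soon as the operation is
  compatible with \<open>\<Phi>\<close>.\<close>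

lemma UN_coset:
  assumes p: "p \<in> carrier FM" and g: "\<And>q. q \<in> carrier FM \<Longrightarrow> g q \<in> carrier FM"
    and resp: "\<And>q. q \<in> carrier FM \<Longrightarrow> \<Phi> q = \<Phi> p \<Longrightarrow> \<Phi> (g q) = \<Phi> (g p)"
  shows "(\<Union>q\<in>coset p. coset (g q)) = coset (g p)"
proof -
  interpret FS: ring FS by (rule FS_ring)
  have sub: "additive_subgroup I FS" by (rule ideal.axioms(1)[OF I_ideal])
  have asub: "abelian_subgroup I FS"
    by (rule abelian_subgroupI3[OF sub FS.is_abelian_group])
  have p': "p \<in> carrier FS" using p by (simp add: free_star_algebra_simps(1))
  have "coset (g q) = coset (g p)" if q: "q \<in> coset p" for q
  proof -
    have qF: "q \<in> carrier FM"
      using FS.a_r_coset_subset_G[OF additive_subgroup.a_subset[OF sub] p'] q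
      unfolding free_star_algebra_simps(1) by blast
    have "coset p = coset q" by (rule abelian_subgroup.a_repr_independence'[OF asub q p'])
    then have "\<Phi> q = \<Phi> p" using coset_eq_iff[OF p qF] by simp
    then show ?thesis using coset_eq_iff[OF g[OF qF] g[OF p]] resp[OF qF] by simp
  qed
  moreover have "p \<in> coset p" by (rule abelian_subgroup.a_rcos_self[OF asub p'])
  ultimately show ?thesis by blast
qed

lemma nc_sphere_simps:
  "carrier (nc_sphere 4 \<Theta>) = coset ` carrier FM"
  "\<one>\<^bsub>nc_sphere 4 \<Theta>\<^esub> = coset \<one>\<^bsub>FM\<^esub>"
  "p \<in> carrier FM \<Longrightarrow> q \<in> carrier FM \<Longrightarrow>
    coset p \<otimes>\<^bsub>nc_sphere 4 \<Theta>\<^esub> coset q = coset (p \<otimes>\<^bsub>FM\<^esub> q)"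
  "p \<in> carrier FM \<Longrightarrow> q \<in> carrier FM \<Longrightarrow>
    coset p \<oplus>\<^bsub>nc_sphere 4 \<Theta>\<^esub> coset q = coset (p \<oplus>\<^bsub>FM\<^esub> q)"
  "p \<in> carrier FM \<Longrightarrow> c \<odot>\<^bsub>nc_sphere 4 \<Theta>\<^esub> coset p = coset (c \<odot>\<^bsub>FM\<^esub> p)"
  "p \<in> carrier FM \<Longrightarrow> star (nc_sphere 4 \<Theta>) (coset p) = coset (star FS p)"
proof -
  note defs = nc_sphere_def Let_def quot_star_algebra_def quot_algebra_def ring.defs module.defs star_algebra.defs
  have smult: "c \<odot>\<^bsub>FM\<^esub> q \<in> carrier FM" if "q \<in> carrier FM" for c q
    using that by (auto simp: monoid_algebra_simps(1,5))
  show "carrier (nc_sphere 4 \<Theta>) = coset ` carrier FM"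
    by (auto simp: defs FactRing_def A_RCOSETS_def' free_star_algebra_simps(1))
  show "\<one>\<^bsub>nc_sphere 4 \<Theta>\<^esub> = coset \<one>\<^bsub>FM\<^esub>"
    by (simp add: defs FactRing_def free_star_algebra_simps(3))
  show "coset p \<otimes>\<^bsub>nc_sphere 4 \<Theta>\<^esub> coset q = coset (p \<otimes>\<^bsub>FM\<^esub> q)" if "p \<in> carrier FM" "q \<in> carrier FM"
    using ideal.rcoset_mult_add[OF I_ideal, of p q] that
    by (simp add: defs FactRing_def free_star_algebra_simps(1,2))
  show "coset p \<oplus>\<^bsub>nc_sphere 4 \<Theta>\<^esub> coset q = coset (p \<oplus>\<^bsub>FM\<^esub> q)" if "p \<in> carrier FM" "q \<in> carrier FM"
  proof -
    interpret FS: ring FS by (rule FS_ring)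
    have asub: "abelian_subgroup I FS"
      by (rule abelian_subgroupI3[OF ideal.axioms(1)[OF I_ideal] FS.is_abelian_group])
    show ?thesis
      using abelian_subgroup.a_rcos_sum[OF asub, of p q] that
      by (simp add: defs FactRing_def free_star_algebra_simps(1,5))
  qed
  show "c \<odot>\<^bsub>nc_sphere 4 \<Theta>\<^esub> coset p = coset (c \<odot>\<^bsub>FM\<^esub> p)" if p: "p \<in> carrier FM"
  proof -
    have "c \<odot>\<^bsub>nc_sphere 4 \<Theta>\<^esub> coset p = (\<Union>q\<in>coset p. coset (c \<odot>\<^bsub>FM\<^esub> q))"
      by (simp add: defs free_star_algebra_simps(6))
    also have "\<dots> = coset (c \<odot>\<^bsub>FM\<^esub> p)" by (rule UN_coset[OF p smult]) (simp_all add: \<Phi>_smult)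
    finally show ?thesis .
  qed
  show "star (nc_sphere 4 \<Theta>) (coset p) = coset (star FS p)" if p: "p \<in> carrier FM"
  proof -
    have "star (nc_sphere 4 \<Theta>) (coset p) = (\<Union>q\<in>coset p. coset (star FS q))"
      by (simp add: defs)
    also have "\<dots> = coset (star FS p)" by (rule UN_coset[OF p star_FM_closed]) (simp_all add: \<Phi>_star p)
    finally show ?thesis .
  qed
qed

lemma fixed_isomorphic:
  "star_alg_isomorphic ((deformed_SU 4 \<Lambda>)\<lparr>carrier := fixed\<rparr>) (nc_sphere 4 \<Theta>)"
proof -
  interpret M: ring FM by (rule FM_ring)
  \<comment> \<open>The inverse of the isomorphism induced by \<open>\<Phi>\<close> on the quotient:
    a preimage is chosen, and its coset does not depend on the choice because \<open>I\<close> is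
    the whole kernel.\<close>
  define f where "f b = coset (SOME p. p \<in> carrier FM \<and> \<Phi> p = b)" for b
  have f: "f (\<Phi> p) = coset p" if p: "p \<in> carrier FM" for p
  proof -
    let ?q = "SOME q. q \<in> carrier FM \<and> \<Phi> q = \<Phi> p"
    have "?q \<in> carrier FM \<and> \<Phi> ?q = \<Phi> p" by (rule someI[of _ p]) (use p in simp)
    then show ?thesis unfolding f_def using coset_eq_iff[of ?q p] p by blast
  qed
  have smult: "c \<odot>\<^bsub>FM\<^esub> q \<in> carrier FM" if "q \<in> carrier FM" for c q
    using that by (auto simp: monoid_algebra_simps(1,5))
  let ?A = "(deformed_SU 4 \<Lambda>)\<lparr>carrier := fixed\<rparr>" and ?S = "nc_sphere 4 \<Theta>"
  have A_simps: "carrier ?A = \<Phi> ` carrier FM" "a \<otimes>\<^bsub>?A\<^esub> b = A.dm a b" "a \<oplus>\<^bsub>?A\<^esub> b = (\<lambda>U\<in>SU 4. a U + b U)"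
    "\<one>\<^bsub>?A\<^esub> = (\<lambda>U\<in>SU 4. 1)" "c \<odot>\<^bsub>?A\<^esub> a = (\<lambda>U\<in>SU 4. c * a U)" "star ?A a = (\<lambda>U\<in>SU 4. cnj (a U))" for a b c
    using A.deformed_SU_simps by (simp_all add: \<Phi>_image)
  have one: "\<Phi> \<one>\<^bsub>FM\<^esub> = (\<lambda>U\<in>SU 4. 1)"
    by (simp add: monoid_algebra_simps(2) free_monoid_def \<Phi>_basis word_elt_Nil)
  have hom: "f \<in> Ring.ring_hom ?A ?S"
  proof (rule ring_hom_memI)
    fix a b assume "a \<in> carrier ?A" "b \<in> carrier ?A"
    then obtain p q where pq: "p \<in> carrier FM" "a = \<Phi> p" "q \<in> carrier FM" "b = \<Phi> q"
      unfolding A_simps by blast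
    show "f (a \<otimes>\<^bsub>?A\<^esub> b) = f a \<otimes>\<^bsub>?S\<^esub> f b"
      unfolding A_simps pq \<Phi>_mult[OF pq(1,3), symmetric] f[OF M.m_closed[OF pq(1,3)]] f[OF pq(1)] f[OF pq(3)]
      by (rule nc_sphere_simps(3)[OF pq(1,3), symmetric])
    show "f (a \<oplus>\<^bsub>?A\<^esub> b) = f a \<oplus>\<^bsub>?S\<^esub> f b"
      unfolding A_simps pq \<Phi>_add[OF pq(1,3), symmetric] f[OF M.add.m_closed[OF pq(1,3)]] f[OF pq(1)] f[OF pq(3)]
      by (rule nc_sphere_simps(4)[OF pq(1,3), symmetric])
    show "f a \<in> carrier ?S"
      unfolding nc_sphere_simps(1) pq(2) f[OF pq(1)] by (rule imageI[OF pq(1)])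
  next
    show "f \<one>\<^bsub>?A\<^esub> = \<one>\<^bsub>?S\<^esub>"
      unfolding A_simps one[symmetric] f[OF M.one_closed] nc_sphere_simps(2) ..
  qed
  have "inj_on f (\<Phi> ` carrier FM)"
    by (rule inj_onI) (use f coset_eq_iff in auto)
  moreover have "f ` (\<Phi> ` carrier FM) = coset ` carrier FM"
    unfolding image_image by (rule image_cong) (simp_all add: f)
  ultimately have bij: "bij_betw f (carrier ?A) (carrier ?S)"
    unfolding bij_betw_def A_simps nc_sphere_simps(1) by blast
  have "f (c \<odot>\<^bsub>?A\<^esub> a) = c \<odot>\<^bsub>?S\<^esub> f a" if "a \<in> carrier ?A" for a c
  proof -
    obtain p where p: "p \<in> carrier FM" "a = \<Phi> p" using \<open>a \<in> carrier ?A\<close> unfolding A_simps by blast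
    show ?thesis
      unfolding A_simps p(2) \<Phi>_smult[symmetric] f[OF smult[OF p(1)]] f[OF p(1)] nc_sphere_simps(5)[OF p(1)] ..
  qed
  moreover have "f (star ?A a) = star ?S (f a)" if "a \<in> carrier ?A" for a
  proof -
    obtain p where p: "p \<in> carrier FM" "a = \<Phi> p" using \<open>a \<in> carrier ?A\<close> unfolding A_simps by blast
    show ?thesis
      unfolding A_simps p(2) \<Phi>_star[OF p(1), symmetric] f[OF star_FM_closed[OF p(1)]] f[OF p(1)] nc_sphere_simps(6)[OF p(1)] ..
  qed
  ultimately have "f \<in> star_alg_iso ?A ?S"
    unfolding star_alg_iso_def alg_hom_def ring_iso_def using hom bij by blast
  then show ?thesis unfolding star_alg_isomorphic_def by blast
qed

section \<open>Relations among the last-row coordinates\<close>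

lemma last_row_mult:
  assumes "i < 4" "j < 4"
  shows "coord 4 3 i \<otimes>\<^bsub>deformed_SU 4 \<Lambda>\<^esub> coord 4 3 j =
    (\<lambda>U\<in>SU 4. cis (- (pi * \<sigma> \<theta> i j)) * (U $$ (3, i) * U $$ (3, j)))"
proof -
  have "word_elt [Gen i, Gen j] = A.dm (coord 4 3 i) (coord 4 3 j)"
    using assms word_elt_Cons[of "Gen i" "[Gen j]"] by (simp add: word_elt_single gen_elt_coord)
  then show ?thesis
    by (simp add: word_elt_def twist_factor_def last_row_def)
qed

lemma last_row_commute:
  assumes "i < 4" "j < 4"
  shows "coord 4 3 i \<otimes>\<^bsub>deformed_SU 4 \<Lambda>\<^esub> coord 4 3 j = cis (- (2 * pi * \<sigma> \<theta> i j)) \<odot>\<^bsub>deformed_SU 4 \<Lambda>\<^esub>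
    (coord 4 3 j \<otimes>\<^bsub>deformed_SU 4 \<Lambda>\<^esub> coord 4 3 i)"
proof -
  have "cis (- (pi * \<sigma> \<theta> i j)) = cis (- (2 * pi * \<sigma> \<theta> i j)) * cis (- (pi * \<sigma> \<theta> j i))"
    by (simp add: cis_mult \<sigma>_antisym[of \<theta> j])
  then show ?thesis
    unfolding last_row_mult[OF assms] last_row_mult[OF assms(2,1)] by (simp add: mult_ac)
qed

lemma last_row_sphere:
  fixes x defines "x \<equiv> \<lambda>l. coord 4 3 l"
  defines "A \<equiv> deformed_SU 4 \<Lambda>"
  shows "x 0 \<otimes>\<^bsub>A\<^esub> star A (x 0) \<oplus>\<^bsub>A\<^esub> x 1 \<otimes>\<^bsub>A\<^esub> star A (x 1) \<oplus>\<^bsub>A\<^esub>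
         x 2 \<otimes>\<^bsub>A\<^esub> star A (x 2) \<oplus>\<^bsub>A\<^esub> x 3 \<otimes>\<^bsub>A\<^esub> star A (x 3) = \<one>\<^bsub>A\<^esub>"
proof -
  have "x k \<otimes>\<^bsub>A\<^esub> star A (x k) = (\<lambda>U\<in>SU 4. last_row U k * cnj (last_row U k))" if "k < 4" for k
  proof -
    have "word_elt [Gen k, GenStar k] = x k \<otimes>\<^bsub>A\<^esub> star A (x k)"
      using that word_elt_Cons[of "Gen k" "[GenStar k]"]
      by (simp add: word_elt_single gen_elt_coord x_def A_def)
    then show ?thesis by (simp add: word_elt_def twist_factor_def)
  qed
  moreover have "last_row U 0 * cnj (last_row U 0) + last_row U 1 * cnj (last_row U 1)
      + last_row U 2 * cnj (last_row U 2) + last_row U 3 * cnj (last_row U 3) = 1" if "U \<in> SU 4" for U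
  proof -
    have "{..<4} = {0, 1, 2, 3::nat}" by auto
    then show ?thesis using last_row_S7[OF that] by (simp add: S7_def add.assoc)
  qed
  ultimately show ?thesis by (simp add: A_def)
qed

end

theorem mainTheorem2:
  fixes \<theta> :: real and \<Lambda> :: "real mat"
    and \<rho> :: "(complex mat \<Rightarrow> complex)
      \<Rightarrow> ((complex mat \<Rightarrow> complex) \<times> (complex mat \<Rightarrow> complex) \<Rightarrow> complex) set"
  defines "H \<equiv> SU3 \<theta>" and "A \<equiv> SU4 \<Lambda>"
  defines "u \<equiv> coord 3" and "v \<equiv> coord 4"
  defines "B \<equiv> fixed_points H A \<rho>" and "x \<equiv> (\<lambda>l. v 3 l)"
  assumes "\<Lambda> \<in> carrier_mat 3 3" and "transpose_mat \<Lambda> = - \<Lambda>"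
    and "\<theta> = \<Lambda> $$ (0, 1)" and "\<theta> = - \<Lambda> $$ (0, 2)" and "\<theta> = \<Lambda> $$ (1, 2)"
    and "is_action H (SU3_comult \<theta>) (SU_counit 3) A \<rho>"
    and "\<And>k l. k < 3 \<Longrightarrow> l < 4 \<Longrightarrow>
      \<rho> (v k l) = (\<Oplus>\<^bsub>tensor H A\<^esub>\<alpha>\<in>{..<3}. pure_tensor H A (u k \<alpha>) (v \<alpha> l))"
    and "\<And>l. l < 4 \<Longrightarrow> \<rho> (v 3 l) = pure_tensor H A \<one>\<^bsub>H\<^esub> (v 3 l)"
  shows "B = star_generated A (x ` {..<4}) \<and>
    star_alg_isomorphic (A\<lparr>carrier := B\<rparr>)
      (nc_sphere 4 (mat_of_rows_list 4
        [[0, - \<theta>, \<theta>, 0],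
         [\<theta>, 0, - \<theta>, 0],
         [- \<theta>, \<theta>, 0, 0],
         [0, 0, 0, 0]])) \<and>
    x 0 \<otimes>\<^bsub>A\<^esub> x 1 = cis (- 2 * pi * \<theta>) \<odot>\<^bsub>A\<^esub> (x 1 \<otimes>\<^bsub>A\<^esub> x 0) \<and>
    x 0 \<otimes>\<^bsub>A\<^esub> x 2 = cis (2 * pi * \<theta>) \<odot>\<^bsub>A\<^esub> (x 2 \<otimes>\<^bsub>A\<^esub> x 0) \<and>
    x 1 \<otimes>\<^bsub>A\<^esub> x 2 = cis (- 2 * pi * \<theta>) \<odot>\<^bsub>A\<^esub> (x 2 \<otimes>\<^bsub>A\<^esub> x 1) \<and>
    (\<forall>j<3. x j \<otimes>\<^bsub>A\<^esub> x 3 = x 3 \<otimes>\<^bsub>A\<^esub> x j) \<and>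
    x 0 \<otimes>\<^bsub>A\<^esub> star A (x 0) \<oplus>\<^bsub>A\<^esub> x 1 \<otimes>\<^bsub>A\<^esub> star A (x 1) \<oplus>\<^bsub>A\<^esub>
         x 2 \<otimes>\<^bsub>A\<^esub> star A (x 2) \<oplus>\<^bsub>A\<^esub> x 3 \<otimes>\<^bsub>A\<^esub> star A (x 3) = \<one>\<^bsub>A\<^esub>"
proof -
  interpret SU3_action \<theta> \<Lambda> \<rho>
    by unfold_locales (use assms in \<open>simp_all add: H_def A_def u_def v_def\<close>)
  have x: "x = (\<lambda>l. coord 4 3 l)" by (simp add: x_def v_def)
  have A: "A = deformed_SU 4 \<Lambda>" by (simp add: A_def SU4_eq)
  have B: "B = fixed" by (simp add: B_def H_def A_def)
  have swap: "x i \<otimes>\<^bsub>A\<^esub> x j = cis c \<odot>\<^bsub>A\<^esub> (x j \<otimes>\<^bsub>A\<^esub> x i)"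
    if "i < 4" "j < 4" "c = - (2 * pi * \<sigma> \<theta> i j)" for i j c
    unfolding x A that(3) by (rule last_row_commute[OF that(1,2)])
  have swap3: "x j \<otimes>\<^bsub>A\<^esub> x 3 = x 3 \<otimes>\<^bsub>A\<^esub> x j" if "j < 3" for j
    using last_row_commute[of j 3] last_row_mult[of 3 j] that by (simp add: x A \<sigma>_3)
  show ?thesis
    unfolding B
  proof (intro conjI)
    show "fixed = star_generated A (x ` {..<4})"
      unfolding x A by (rule fixed_generated)
    show "star_alg_isomorphic (A\<lparr>carrier := fixed\<rparr>) (nc_sphere 4 \<Theta>)"
      unfolding A by (rule fixed_isomorphic)
    show "x 0 \<otimes>\<^bsub>A\<^esub> x 1 = cis (- 2 * pi * \<theta>) \<odot>\<^bsub>A\<^esub> (x 1 \<otimes>\<^bsub>A\<^esub> x 0)"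
      by (rule swap) (simp_all add: \<sigma>_def)
    show "x 0 \<otimes>\<^bsub>A\<^esub> x 2 = cis (2 * pi * \<theta>) \<odot>\<^bsub>A\<^esub> (x 2 \<otimes>\<^bsub>A\<^esub> x 0)"
      by (rule swap) (simp_all add: \<sigma>_def)
    show "x 1 \<otimes>\<^bsub>A\<^esub> x 2 = cis (- 2 * pi * \<theta>) \<odot>\<^bsub>A\<^esub> (x 2 \<otimes>\<^bsub>A\<^esub> x 1)"
      by (rule swap) (simp_all add: \<sigma>_def)
    show "\<forall>j<3. x j \<otimes>\<^bsub>A\<^esub> x 3 = x 3 \<otimes>\<^bsub>A\<^esub> x j"
      using swap3 by blast
    show "x 0 \<otimes>\<^bsub>A\<^esub> star A (x 0) \<oplus>\<^bsub>A\<^esub> x 1 \<otimes>\<^bsub>A\<^esub> star A (x 1) \<oplus>\<^bsub>A\<^esub>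
         x 2 \<otimes>\<^bsub>A\<^esub> star A (x 2) \<oplus>\<^bsub>A\<^esub> x 3 \<otimes>\<^bsub>A\<^esub> star A (x 3) = \<one>\<^bsub>A\<^esub>"
      unfolding x A by (rule last_row_sphere)
  qed
qed

end
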